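(* Let $R$ be a unital commutative ring and let $X$ be a topological space. Then there is an equivalence of categories $$\mathbf{Fun}\big(\mathbb{N}_0,\mathbf{Shv}(X,\mathbf{Mod}_R)\big)\cong \mathbf{Shv}(X,\mathbf{grMod}_{R[t]}).$$ Moreover, if $R$ is a noetherian ring and $X$ is finite, then the (full) subcategory of $\mathbf{Fun}\big(\mathbb{N}_0,\mathbf{Shv}(X,\mathbf{Mod}_R)\big)$ of functors of finite type is equivalent to $\mathbf{Shv}(X,\mathbf{grmod}_{R[t]})$.
   Context: $\mathbb{N}_0$ denotes the category of the poset $(\mathbb{N}_0,\leq)$ and $\mathbf{Fun}(\mathbf{I},\mathbf{A})$ the category of functors $\mathbf{I}\to\mathbf{A}$ and natural transformations. $\mathbf{Mod}_R$ is the category of $R$-modules. $\mathbf{grMod}_{R[t]}$ is the category of $\mathbb{N}_0$-graded modules over the polynomial ring $R[t]$ ($R$ in degree $0$, $t$ in degree $1$) with degree-preserving morphisms; $\mathbf{grmod}_{R[t]}$ is its full subcategory of finitely generated graded modules. For a category $\mathbf{M}$ of (graded) modules, $\mathbf{Shv}(X,\mathbf{M})$ is the category of sheaves on $X$ with values in $\mathbf{M}$ (products in $\mathbf{grMod}_{R[t]}$ are formed degreewise); $\mathbf{Shv}(X,\mathbf{grmod}_{R[t]})$ consists of the sheaves of graded $R[t]$-modules all of whose values are finitely generated. For a functor $\vec{\mathcal{F}}\colon\mathbb{N}_0\to\mathbf{Shv}(X,\mathbf{Mod}_R)$ write $\mathcal{F}_i=\vec{\mathcal{F}}(i)$ and $\mathcal{F}_i^{i+1}=\vec{\mathcal{F}}(i\to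 i+1)$. The functor $\vec{\mathcal{F}}$ is of finite type if for every $i\in\mathbb{N}_0$ and every open $U\subseteq X$ the $R$-module $\mathcal{F}_i(U)$ is finitely generated, and there exists $m\in\mathbb{N}_0$ such that $\mathcal{F}_i^{i+1}$ is an isomorphism for all $i\geq m$. *)

theory Defs
  imports "HOL-Analysis.Abstract_Topology" "HOL-Algebra.UnivPoly" "HOL-Algebra.Ring_Divisibility"
begin

section \<open>Categories, functors, equivalences\<close>

text \<open>Hom-sets of different pairs of objects may overlap, so composition takes the three objects
  involved: \<open>Cmp C A B D g f\<close> is \<open>g\<close> after \<open>f\<close> for \<open>f\<close> from \<open>A\<close> to \<open>B\<close> and \<open>g\<close> from \<open>B\<close> to \<open>D\<close>.\<close>

record ('o, 'm) cat =
  Ob :: "'o set"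
  Mor :: "'o \<Rightarrow> 'o \<Rightarrow> 'm set"
  Idn :: "'o \<Rightarrow> 'm"
  Cmp :: "'o \<Rightarrow> 'o \<Rightarrow> 'o \<Rightarrow> 'm \<Rightarrow> 'm \<Rightarrow> 'm"

locale category =
  fixes C :: "('o, 'm) cat"
  assumes Idn_in: "A \<in> Ob C \<Longrightarrow> Idn C A \<in> Mor C A A"
    and Cmp_in: "\<lbrakk>A \<in> Ob C; B \<in> Ob C; D \<in> Ob C; f \<in> Mor C A B; g \<in> Mor C B D\<rbrakk>
      \<Longrightarrow> Cmp C A B D g f \<in> Mor C A D"
    and Cmp_Idn_right: "\<lbrakk>A \<in> Ob C; B \<in> Ob C; f \<in> Mor C A B\<rbrakk> \<Longrightarrow> Cmp C A A B f (Idn C A) = f"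
    and Cmp_Idn_left: "\<lbrakk>A \<in> Ob C; B \<in> Ob C; f \<in> Mor C A B\<rbrakk> \<Longrightarrow> Cmp C A B B (Idn C B) f = f"
    and Cmp_assoc: "\<lbrakk>A \<in> Ob C; B \<in> Ob C; D \<in> Ob C; E \<in> Ob C;
        f \<in> Mor C A B; g \<in> Mor C B D; h \<in> Mor C D E\<rbrakk>
      \<Longrightarrow> Cmp C A D E h (Cmp C A B D g f) = Cmp C A B E (Cmp C B D E h g) f"

definition is_iso :: "('o, 'm) cat \<Rightarrow> 'o \<Rightarrow> 'o \<Rightarrow> 'm \<Rightarrow> bool" where
  "is_iso C A B f \<longleftrightarrow> f \<in> Mor C A B \<and>
    (\<exists>g \<in> Mor C B A. Cmp C A B A g f = Idn C A \<and> Cmp C B A B f g = Idn C B)"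

definition isomorphic_in :: "('o, 'm) cat \<Rightarrow> 'o \<Rightarrow> 'o \<Rightarrow> bool" where
  "isomorphic_in C A B \<longleftrightarrow> (\<exists>f. is_iso C A B f)"

definition full_subcat :: "('o, 'm) cat \<Rightarrow> ('o \<Rightarrow> bool) \<Rightarrow> ('o, 'm) cat" where
  "full_subcat C P = C\<lparr>Ob := {A \<in> Ob C. P A}\<rparr>"

definition op_cat :: "('o, 'm) cat \<Rightarrow> ('o, 'm) cat" where
  "op_cat C = \<lparr>Ob = Ob C, Mor = (\<lambda>A B. Mor C B A), Idn = Idn C,
    Cmp = (\<lambda>A B D g f. Cmp C D B A f g)\<rparr>"

definition poset_cat :: "'o set \<Rightarrow> ('o \<Rightarrow> 'o \<Rightarrow> bool) \<Rightarrow> ('o, unit) cat" where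
  "poset_cat S leq = \<lparr>Ob = S, Mor = (\<lambda>A B. {u. leq A B}), Idn = (\<lambda>A. ()), Cmp = (\<lambda>A B D g f. ())\<rparr>"

record ('o1, 'm1, 'o2, 'm2) fctr =
  fobj :: "'o1 \<Rightarrow> 'o2"
  fmap :: "'o1 \<Rightarrow> 'o1 \<Rightarrow> 'm1 \<Rightarrow> 'm2"

definition is_functor ::
    "('o1, 'm1) cat \<Rightarrow> ('o2, 'm2) cat \<Rightarrow> ('o1, 'm1, 'o2, 'm2) fctr \<Rightarrow> bool" where
  "is_functor C D F \<longleftrightarrow>
    (\<forall>A \<in> Ob C. fobj F A \<in> Ob D) \<and>
    (\<forall>A \<in> Ob C. \<forall>B \<in> Ob C. \<forall>f \<in> Mor C A B. fmap F A B f \<in> Mor D (fobj F A) (fobj F B)) \<and>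
    (\<forall>A \<in> Ob C. fmap F A A (Idn C A) = Idn D (fobj F A)) \<and>
    (\<forall>A \<in> Ob C. \<forall>B \<in> Ob C. \<forall>E \<in> Ob C. \<forall>f \<in> Mor C A B. \<forall>g \<in> Mor C B E.
      fmap F A E (Cmp C A B E g f) =
      Cmp D (fobj F A) (fobj F B) (fobj F E) (fmap F B E g) (fmap F A B f))"

definition id_fctr :: "('o, 'm, 'o, 'm) fctr" where
  "id_fctr = \<lparr>fobj = (\<lambda>A. A), fmap = (\<lambda>A B f. f)\<rparr>"

definition comp_fctr ::
    "('o2, 'm2, 'o3, 'm3) fctr \<Rightarrow> ('o1, 'm1, 'o2, 'm2) fctr \<Rightarrow> ('o1, 'm1, 'o3, 'm3) fctr" where
  "comp_fctr G F = \<lparr>fobj = (\<lambda>A. fobj G (fobj F A)),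
    fmap = (\<lambda>A B f. fmap G (fobj F A) (fobj F B) (fmap F A B f))\<rparr>"

text \<open>Natural transformations are extensional families of components, so that two of them are equal
  iff their components at the objects of \<open>C\<close> are. Functors are not required to be extensional:
  functors that differ only outside \<open>C\<close> are isomorphic via identity components.\<close>

definition nat_trans :: "('o1, 'm1) cat \<Rightarrow> ('o2, 'm2) cat \<Rightarrow>
    ('o1, 'm1, 'o2, 'm2) fctr \<Rightarrow> ('o1, 'm1, 'o2, 'm2) fctr \<Rightarrow> ('o1 \<Rightarrow> 'm2) set" where
  "nat_trans C D F G = {\<eta> \<in> (\<Pi>\<^sub>E A \<in> Ob C. Mor D (fobj F A) (fobj G A)).
    \<forall>A \<in> Ob C. \<forall>B \<in> Ob C. \<forall>f \<in> Mor C A B.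
      Cmp D (fobj F A) (fobj F B) (fobj G B) (\<eta> B) (fmap F A B f) =
      Cmp D (fobj F A) (fobj G A) (fobj G B) (fmap G A B f) (\<eta> A)}"

definition Fun_cat :: "('o1, 'm1) cat \<Rightarrow> ('o2, 'm2) cat \<Rightarrow>
    (('o1, 'm1, 'o2, 'm2) fctr, 'o1 \<Rightarrow> 'm2) cat" where
  "Fun_cat C D = \<lparr>Ob = {F. is_functor C D F},
    Mor = nat_trans C D,
    Idn = (\<lambda>F. \<lambda>A \<in> Ob C. Idn D (fobj F A)),
    Cmp = (\<lambda>F G H \<theta> \<eta>. \<lambda>A \<in> Ob C. Cmp D (fobj F A) (fobj G A) (fobj H A) (\<theta> A) (\<eta> A))\<rparr>"

definition equivalent_cats :: "('o1, 'm1) cat \<Rightarrow> ('o2, 'm2) cat \<Rightarrow> bool" where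
  "equivalent_cats C D \<longleftrightarrow> category C \<and> category D \<and>
    (\<exists>F G. is_functor C D F \<and> is_functor D C G \<and>
      isomorphic_in (Fun_cat C C) id_fctr (comp_fctr G F) \<and>
      isomorphic_in (Fun_cat D D) (comp_fctr F G) id_fctr)"

section \<open>Modules and graded modules\<close>

text \<open>The carriers of all modules are subsets of the type \<open>'a\<close>, which serves as the universe. If
  \<open>'a\<close> is infinite, this universe is closed, up to isomorphism, under countable direct sums. The
  fields \<open>mult\<close> and \<open>one\<close> of the record type \<open>module\<close> are not used.\<close>

definition mod_hom :: "('r, 'e) ring_scheme \<Rightarrow> ('r, 'a, 'b) module_scheme \<Rightarrow>
    ('r, 'a, 'c) module_scheme \<Rightarrow> ('a \<Rightarrow> 'a) set" where
  "mod_hom R M N = {f \<in> hom (add_monoid M) (add_monoid N) \<inter> extensional (carrier M).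
    \<forall>r \<in> carrier R. \<forall>x \<in> carrier M. f (r \<odot>\<^bsub>M\<^esub> x) = r \<odot>\<^bsub>N\<^esub> f x}"

definition Mod_cat :: "('r, 'e) ring_scheme \<Rightarrow> (('r, 'a) module, 'a \<Rightarrow> 'a) cat" where
  "Mod_cat R = \<lparr>Ob = {M. Module.module R M},
    Mor = mod_hom R,
    Idn = (\<lambda>M. \<lambda>x \<in> carrier M. x),
    Cmp = (\<lambda>L M N g f. compose (carrier L) g f)\<rparr>"

definition fin_gen_module :: "('r, 'e) ring_scheme \<Rightarrow> ('r, 'a, 'b) module_scheme \<Rightarrow> bool" where
  "fin_gen_module R M \<longleftrightarrow> (\<exists>S \<subseteq> carrier M. finite S \<and>
    (\<forall>H. submodule H R M \<and> S \<subseteq> H \<longrightarrow> H = carrier M))"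

record ('s, 'a) graded_module = "('s, 'a) module" +
  grade :: "nat \<Rightarrow> 'a set"

text \<open>The degree \<open>i\<close> part of \<open>R[t]\<close> consists of the monomials \<open>r t\<^sup>i\<close> with \<open>r \<in> R\<close>. The third
  conjunct says that \<open>M\<close> is the internal direct sum of its graded pieces.\<close>

definition is_graded_module ::
    "('r, 'e) ring_scheme \<Rightarrow> (nat \<Rightarrow> 'r, 'a) graded_module \<Rightarrow> bool" where
  "is_graded_module R M \<longleftrightarrow> Module.module (UP R) M \<and>
    (\<forall>n. subgroup (grade M n) (add_monoid M)) \<and>
    (\<forall>x \<in> carrier M. \<exists>!c. (\<forall>n. c n \<in> grade M n) \<and> finite {n. c n \<noteq> \<zero>\<^bsub>M\<^esub>} \<and>
      x = (\<Oplus>\<^bsub>M\<^esub>n \<in> {n. c n \<noteq> \<zero>\<^bsub>M\<^esub>}. c n)) \<and>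
    (\<forall>i n. \<forall>r \<in> carrier R. \<forall>x \<in> grade M n. monom (UP R) r i \<odot>\<^bsub>M\<^esub> x \<in> grade M (i + n))"

definition grMod_cat :: "('r, 'e) ring_scheme \<Rightarrow> ((nat \<Rightarrow> 'r, 'a) graded_module, 'a \<Rightarrow> 'a) cat" where
  "grMod_cat R = \<lparr>Ob = {M. is_graded_module R M},
    Mor = (\<lambda>M N. {f \<in> mod_hom (UP R) M N. \<forall>n. f ` grade M n \<subseteq> grade N n}),
    Idn = (\<lambda>M. \<lambda>x \<in> carrier M. x),
    Cmp = (\<lambda>L M N g f. compose (carrier L) g f)\<rparr>"

definition mod_prod :: "'i set \<Rightarrow> ('i \<Rightarrow> ('r, 'a) module) \<Rightarrow> ('r, 'i \<Rightarrow> 'a) module" where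
  "mod_prod I M = \<lparr>carrier = (\<Pi>\<^sub>E i \<in> I. carrier (M i)),
    mult = (\<lambda>x y. \<lambda>i \<in> I. x i \<otimes>\<^bsub>M i\<^esub> y i), one = (\<lambda>i \<in> I. \<one>\<^bsub>M i\<^esub>),
    zero = (\<lambda>i \<in> I. \<zero>\<^bsub>M i\<^esub>), add = (\<lambda>x y. \<lambda>i \<in> I. x i \<oplus>\<^bsub>M i\<^esub> y i),
    smult = (\<lambda>r x. \<lambda>i \<in> I. r \<odot>\<^bsub>M i\<^esub> x i)\<rparr>"

text \<open>The product in graded modules has degree \<open>n\<close> part \<open>\<Prod>\<^sub>i (M\<^sub>i)\<^sub>n\<close>, and its carrier is the direct sum
  of these over all \<open>n\<close>, realised inside the product of the carriers. If \<open>I\<close> is infinite, it is in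
  general smaller than the product of the underlying modules: the degrees occurring in the
  components of one element have a common bound.\<close>

definition gr_prod :: "'i set \<Rightarrow> ('i \<Rightarrow> ('s, 'a) graded_module) \<Rightarrow> ('s, 'i \<Rightarrow> 'a) graded_module" where
  "gr_prod I M = \<lparr>carrier = {(\<lambda>i \<in> I. \<Oplus>\<^bsub>M i\<^esub>n \<in> {..N}. c n i) | c (N :: nat).
      \<forall>n. c n \<in> (\<Pi>\<^sub>E i \<in> I. grade (M i) n)},
    mult = (\<lambda>x y. \<lambda>i \<in> I. x i \<otimes>\<^bsub>M i\<^esub> y i), one = (\<lambda>i \<in> I. \<one>\<^bsub>M i\<^esub>),
    zero = (\<lambda>i \<in> I. \<zero>\<^bsub>M i\<^esub>), add = (\<lambda>x y. \<lambda>i \<in> I. x i \<oplus>\<^bsub>M i\<^esub> y i),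
    smult = (\<lambda>r x. \<lambda>i \<in> I. r \<odot>\<^bsub>M i\<^esub> x i),
    grade = (\<lambda>n. \<Pi>\<^sub>E i \<in> I. grade (M i) n)\<rparr>"

section \<open>Sheaves\<close>

abbreviation opens_op :: "'x topology \<Rightarrow> ('x set, unit) cat" where
  "opens_op X \<equiv> op_cat (poset_cat {U. openin X U} (\<subseteq>))"

text \<open>For \<open>V \<subseteq> U\<close>, the restriction map from \<open>F(U)\<close> to \<open>F(V)\<close> is \<open>fmap F U V ()\<close>. The sheaf condition says
  that \<open>F(U) \<rightarrow> \<Prod>\<^sub>V F(V) \<rightrightarrows> \<Prod>\<^sub>V\<^sub>,\<^sub>W F(V \<inter> W)\<close> is an equalizer for every open cover \<open>\<V>\<close> of \<open>U\<close>,
  where \<open>V, W\<close> range over \<open>\<V>\<close>: the first map is a bijection onto the submodule on which the two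
  others agree. Here \<open>P\<close> is the product of the value category. The empty cover of the empty set is
  included. Covers are sets of open sets, which loses nothing compared with indexed families, since
  the condition at \<open>V = W\<close> identifies the components belonging to repeated members.\<close>

definition is_sheaf :: "'x topology \<Rightarrow> (('a, 'b) partial_object_scheme, 'a \<Rightarrow> 'a) cat \<Rightarrow>
    ('x set set \<Rightarrow> ('x set \<Rightarrow> ('a, 'b) partial_object_scheme) \<Rightarrow>
      ('x set \<Rightarrow> 'a, 'c) partial_object_scheme) \<Rightarrow>
    ('x set, unit, ('a, 'b) partial_object_scheme, 'a \<Rightarrow> 'a) fctr \<Rightarrow> bool" where
  "is_sheaf X C P F \<longleftrightarrow> is_functor (opens_op X) C F \<and>
    (\<forall>\<V>. (\<forall>V \<in> \<V>. openin X V) \<longrightarrow>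
      bij_betw (\<lambda>s. \<lambda>V \<in> \<V>. fmap F (\<Union>\<V>) V () s)
        (carrier (fobj F (\<Union>\<V>)))
        {s \<in> carrier (P \<V> (fobj F)). \<forall>V \<in> \<V>. \<forall>W \<in> \<V>.
          fmap F V (V \<inter> W) () (s V) = fmap F W (V \<inter> W) () (s W)})"

definition Shv_Mod :: "'x topology \<Rightarrow> ('r, 'e) ring_scheme \<Rightarrow>
    (('x set, unit, ('r, 'a) module, 'a \<Rightarrow> 'a) fctr, 'x set \<Rightarrow> 'a \<Rightarrow> 'a) cat" where
  "Shv_Mod X R = full_subcat (Fun_cat (opens_op X) (Mod_cat R)) (is_sheaf X (Mod_cat R) mod_prod)"

definition Shv_grMod :: "'x topology \<Rightarrow> ('r, 'e) ring_scheme \<Rightarrow>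
    (('x set, unit, (nat \<Rightarrow> 'r, 'a) graded_module, 'a \<Rightarrow> 'a) fctr, 'x set \<Rightarrow> 'a \<Rightarrow> 'a) cat" where
  "Shv_grMod X R = full_subcat (Fun_cat (opens_op X) (grMod_cat R)) (is_sheaf X (grMod_cat R) gr_prod)"

definition Shv_grmod_fg :: "'x topology \<Rightarrow> ('r, 'e) ring_scheme \<Rightarrow>
    (('x set, unit, (nat \<Rightarrow> 'r, 'a) graded_module, 'a \<Rightarrow> 'a) fctr, 'x set \<Rightarrow> 'a \<Rightarrow> 'a) cat" where
  "Shv_grmod_fg X R = full_subcat (Shv_grMod X R)
    (\<lambda>F. \<forall>U. openin X U \<longrightarrow> fin_gen_module (UP R) (fobj F U))"

abbreviation nat_cat :: "(nat, unit) cat" where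
  "nat_cat \<equiv> poset_cat UNIV (\<le>)"

definition finite_type :: "'x topology \<Rightarrow> ('r, 'e) ring_scheme \<Rightarrow>
    (nat, unit, ('x set, unit, ('r, 'a) module, 'a \<Rightarrow> 'a) fctr, 'x set \<Rightarrow> 'a \<Rightarrow> 'a) fctr \<Rightarrow> bool" where
  "finite_type X R F \<longleftrightarrow>
    (\<forall>i U. openin X U \<longrightarrow> fin_gen_module R (fobj (fobj F i) U)) \<and>
    (\<exists>m. \<forall>i \<ge> m. is_iso (Shv_Mod X R) (fobj F i) (fobj F (i + 1)) (fmap F i (i + 1) ()))"

end

theory Submission
  imports Defs
begin

text \<open>The degree functor sends a sheaf \<open>G\<close> of graded modules to the sequence of the sheaves
  \<open>U \<mapsto> G(U)\<^sub>i\<close>, with multiplication by \<open>t\<close> as transition maps. It is fully faithful, since graded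
  homomorphisms correspond to the families of \<open>R\<close>-linear maps between the degree parts that commute with
  \<open>t\<close>. It is essentially surjective, since the direct sums \<open>\<Oplus>\<^sub>i F\<^sub>i(U)\<close> form a sheaf: products of graded
  modules are degreewise, so the sheaf condition can be tested in every degree.

  If the \<open>F\<^sub>i(U)\<close> are finitely generated and \<open>t\<close> is surjective from degree \<open>m\<close> on, then generators in degrees
  \<open>\<le> m\<close> generate the direct sum. Conversely, a finitely generated graded module \<open>M\<close> has a finite set of
  homogeneous generators, say of degrees \<open>\<le> d\<close>. Hence its degree parts are finitely generated and \<open>t\<close> is
  surjective from degree \<open>d\<close> on. If \<open>R\<close> is noetherian, the kernels of \<open>t\<^sup>k\<close> on \<open>M\<^sub>d\<close> stabilise, so that \<open>t\<close> is
  eventually bijective, and a finite space has a common bound for all open sets.\<close>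

section \<open>Functor categories and equivalences\<close>

text \<open>Only the degree functor is given by a formula. A functor in the other direction involves
  choices, because all carriers are subsets of the one type \<open>'a\<close> and a direct sum has
  to be encoded in it again. For infinite \<open>'a\<close> this is possible: a finitely supported
  sequence is determined by a finite list, and lists are coded by an injection from pairs. The
  quasi-inverse is then obtained abstractly. Infinite open covers are the delicate point of the
  sheaf condition: the sections of a compatible family might have unbounded degrees, and no element
  of a direct sum could restrict to all of them. Since \<open>gr_prod\<close> admits only families
  with a common degree bound, the sections glued in the single degrees have a finite sum. For the
  second equivalence nothing is constructed anew: under the degree functor finite type corresponds
  to finite generation, and finite type is invariant under isomorphism, so the first equivalence
  restricts.\<close>

lemma Fun_cat_simps [simp]:
  "Ob (Fun_cat C D) = {F. is_functor C D F}"
  "Mor (Fun_cat C D) F G = nat_trans C D F G"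
  "Idn (Fun_cat C D) F = (\<lambda>A \<in> Ob C. Idn D (fobj F A))"
  "Cmp (Fun_cat C D) F G H \<theta> \<eta> =
    (\<lambda>A \<in> Ob C. Cmp D (fobj F A) (fobj G A) (fobj H A) (\<theta> A) (\<eta> A))"
  by (simp_all add: Fun_cat_def)

lemma full_subcat_simps [simp]:
  "Ob (full_subcat C P) = {A \<in> Ob C. P A}"
  "Mor (full_subcat C P) = Mor C"
  "Idn (full_subcat C P) = Idn C"
  "Cmp (full_subcat C P) = Cmp C"
  by (simp_all add: full_subcat_def)

lemma opens_op_simps [simp]:
  "Ob (opens_op X) = {U. openin X U}"
  "u \<in> Mor (opens_op X) U V \<longleftrightarrow> V \<subseteq> U"
  "Idn (opens_op X) U = ()"
  "Cmp (opens_op X) U V W g f = ()"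
  by (auto simp: op_cat_def poset_cat_def)

lemma nat_cat_simps [simp]:
  "Ob nat_cat = UNIV"
  "f \<in> Mor nat_cat i j \<longleftrightarrow> i \<le> j"
  "Idn nat_cat i = ()"
  "Cmp nat_cat i j k g h = ()"
  by (auto simp: poset_cat_def)

lemma fctr_comp_simps [simp]:
  "fobj id_fctr A = A" "fmap id_fctr A B f = f"
  "fobj (comp_fctr G F) A = fobj G (fobj F A)"
  "fmap (comp_fctr G F) A B f = fmap G (fobj F A) (fobj F B) (fmap F A B f)"
  by (simp_all add: id_fctr_def comp_fctr_def)

lemma is_functorI:
  assumes "\<And>A. A \<in> Ob C \<Longrightarrow> fobj F A \<in> Ob D"
    and "\<And>A B f. \<lbrakk>A \<in> Ob C; B \<in> Ob C; f \<in> Mor C A B\<rbrakk> \<Longrightarrow> fmap F A B f \<in> Mor D (fobj F A) (fobj F B)"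
    and "\<And>A. A \<in> Ob C \<Longrightarrow> fmap F A A (Idn C A) = Idn D (fobj F A)"
    and "\<And>A B E f g. \<lbrakk>A \<in> Ob C; B \<in> Ob C; E \<in> Ob C; f \<in> Mor C A B; g \<in> Mor C B E\<rbrakk> \<Longrightarrow>
      fmap F A E (Cmp C A B E g f) =
      Cmp D (fobj F A) (fobj F B) (fobj F E) (fmap F B E g) (fmap F A B f)"
  shows "is_functor C D F"
  using assms by (simp add: is_functor_def)

lemma is_functorD:
  assumes "is_functor C D F"
  shows "A \<in> Ob C \<Longrightarrow> fobj F A \<in> Ob D"
    and "\<lbrakk>A \<in> Ob C; B \<in> Ob C; f \<in> Mor C A B\<rbrakk> \<Longrightarrow> fmap F A B f \<in> Mor D (fobj F A) (fobj F B)"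
    and "A \<in> Ob C \<Longrightarrow> fmap F A A (Idn C A) = Idn D (fobj F A)"
    and "\<lbrakk>A \<in> Ob C; B \<in> Ob C; E \<in> Ob C; f \<in> Mor C A B; g \<in> Mor C B E\<rbrakk> \<Longrightarrow>
      fmap F A E (Cmp C A B E g f) =
      Cmp D (fobj F A) (fobj F B) (fobj F E) (fmap F B E g) (fmap F A B f)"
  using assms by (simp_all add: is_functor_def)

lemma nat_transI:
  assumes "\<And>A. A \<in> Ob C \<Longrightarrow> \<eta> A \<in> Mor D (fobj F A) (fobj G A)"
    and "\<eta> \<in> extensional (Ob C)"
    and "\<And>A B f. \<lbrakk>A \<in> Ob C; B \<in> Ob C; f \<in> Mor C A B\<rbrakk> \<Longrightarrow>
      Cmp D (fobj F A) (fobj F B) (fobj G B) (\<eta> B) (fmap F A B f) =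
      Cmp D (fobj F A) (fobj G A) (fobj G B) (fmap G A B f) (\<eta> A)"
  shows "\<eta> \<in> nat_trans C D F G"
  using assms by (auto simp: nat_trans_def PiE_def)

lemma nat_transD:
  assumes "\<eta> \<in> nat_trans C D F G"
  shows "A \<in> Ob C \<Longrightarrow> \<eta> A \<in> Mor D (fobj F A) (fobj G A)"
    and "\<eta> \<in> extensional (Ob C)"
    and "\<lbrakk>A \<in> Ob C; B \<in> Ob C; f \<in> Mor C A B\<rbrakk> \<Longrightarrow>
      Cmp D (fobj F A) (fobj F B) (fobj G B) (\<eta> B) (fmap F A B f) =
      Cmp D (fobj F A) (fobj G A) (fobj G B) (fmap G A B f) (\<eta> A)"
  using assms by (auto simp: nat_trans_def PiE_def)

text \<open>\<open>is_iso\<close> mentions hom-sets, identities and composition but not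
  \<open>Ob\<close>, so it is the same predicate in a full subcategory, without any membership
  condition.\<close>

lemma is_iso_full_subcat [simp]: "is_iso (full_subcat C P) = is_iso C"
  by (simp add: is_iso_def fun_eq_iff)

lemma isomorphic_in_full_subcat [simp]: "isomorphic_in (full_subcat C P) = isomorphic_in C"
  by (simp add: isomorphic_in_def fun_eq_iff)

lemma category_full_subcat: "category C \<Longrightarrow> category (full_subcat C P)"
  by (auto simp: category_def)

lemma category_Fun_cat:
  assumes "category D"
  shows "category (Fun_cat C D)"
proof -
  interpret category D by fact
  show ?thesis
  proof
    fix F assume "F \<in> Ob (Fun_cat C D)"
    then have F: "is_functor C D F" by simp
    note d = is_functorD[OF F]
    show "Idn (Fun_cat C D) F \<in> Mor (Fun_cat C D) F F"
      by (auto intro!: nat_transI simp: d Idn_in Cmp_Idn_left Cmp_Idn_right)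
  next
    fix F G H \<eta> \<theta>
    assume "F \<in> Ob (Fun_cat C D)" "G \<in> Ob (Fun_cat C D)" "H \<in> Ob (Fun_cat C D)"
      and "\<eta> \<in> Mor (Fun_cat C D) F G" "\<theta> \<in> Mor (Fun_cat C D) G H"
    then have F: "is_functor C D F" and G: "is_functor C D G" and H: "is_functor C D H"
      and \<eta>: "\<eta> \<in> nat_trans C D F G" and \<theta>: "\<theta> \<in> nat_trans C D G H" by simp_all
    note d = is_functorD[OF F] is_functorD[OF G] is_functorD[OF H] nat_transD(1)[OF \<eta>] nat_transD(1)[OF \<theta>]
    \<comment> \<open>The naturality squares of \<eta> and \<theta> are pasted; since
      \<open>Cmp\<close> carries its objects as arguments, every rebracketing is a separate use of
      \<open>Cmp_assoc\<close>.\<close>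
    have "Cmp D (fobj F A) (fobj F B) (fobj H B)
          (Cmp D (fobj F B) (fobj G B) (fobj H B) (\<theta> B) (\<eta> B)) (fmap F A B f) =
        Cmp D (fobj F A) (fobj H A) (fobj H B) (fmap H A B f)
          (Cmp D (fobj F A) (fobj G A) (fobj H A) (\<theta> A) (\<eta> A))"
      if "A \<in> Ob C" "B \<in> Ob C" "f \<in> Mor C A B" for A B f
    proof -
      have "Cmp D (fobj F A) (fobj F B) (fobj H B)
          (Cmp D (fobj F B) (fobj G B) (fobj H B) (\<theta> B) (\<eta> B)) (fmap F A B f) =
          Cmp D (fobj F A) (fobj G B) (fobj H B) (\<theta> B)
            (Cmp D (fobj F A) (fobj F B) (fobj G B) (\<eta> B) (fmap F A B f))"
        using that d by (subst Cmp_assoc) auto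
      also have "\<dots> = Cmp D (fobj F A) (fobj G B) (fobj H B) (\<theta> B)
            (Cmp D (fobj F A) (fobj G A) (fobj G B) (fmap G A B f) (\<eta> A))"
        using that nat_transD(3)[OF \<eta>] by simp
      also have "\<dots> = Cmp D (fobj F A) (fobj G A) (fobj H B)
            (Cmp D (fobj G A) (fobj G B) (fobj H B) (\<theta> B) (fmap G A B f)) (\<eta> A)"
        using that d by (subst Cmp_assoc) auto
      also have "\<dots> = Cmp D (fobj F A) (fobj G A) (fobj H B)
            (Cmp D (fobj G A) (fobj H A) (fobj H B) (fmap H A B f) (\<theta> A)) (\<eta> A)"
        using that nat_transD(3)[OF \<theta>] by simp
      also have "\<dots> = Cmp D (fobj F A) (fobj H A) (fobj H B) (fmap H A B f)
            (Cmp D (fobj F A) (fobj G A) (fobj H A) (\<theta> A) (\<eta> A))"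
        using that d by (subst Cmp_assoc) auto
      finally show ?thesis .
    qed
    then show "Cmp (Fun_cat C D) F G H \<theta> \<eta> \<in> Mor (Fun_cat C D) F H"
      by (auto intro!: nat_transI Cmp_in simp: d)
  next
    fix F G \<eta>
    assume "F \<in> Ob (Fun_cat C D)" "G \<in> Ob (Fun_cat C D)" "\<eta> \<in> Mor (Fun_cat C D) F G"
    then have F: "is_functor C D F" and G: "is_functor C D G" and \<eta>: "\<eta> \<in> nat_trans C D F G"
      by simp_all
    note d = is_functorD[OF F] is_functorD[OF G] nat_transD(1)[OF \<eta>]
    show "Cmp (Fun_cat C D) F F G \<eta> (Idn (Fun_cat C D) F) = \<eta>"
      using nat_transD(2)[OF \<eta>] d Cmp_Idn_right
      by (auto simp: fun_eq_iff restrict_def extensional_def)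
    show "Cmp (Fun_cat C D) F G G (Idn (Fun_cat C D) G) \<eta> = \<eta>"
      using nat_transD(2)[OF \<eta>] d Cmp_Idn_left
      by (auto simp: fun_eq_iff restrict_def extensional_def)
  next
    fix F G H K \<eta> \<theta> \<kappa>
    assume "F \<in> Ob (Fun_cat C D)" "G \<in> Ob (Fun_cat C D)" "H \<in> Ob (Fun_cat C D)"
        "K \<in> Ob (Fun_cat C D)"
      and "\<eta> \<in> Mor (Fun_cat C D) F G" "\<theta> \<in> Mor (Fun_cat C D) G H" "\<kappa> \<in> Mor (Fun_cat C D) H K"
    then show "Cmp (Fun_cat C D) F H K \<kappa> (Cmp (Fun_cat C D) F G H \<theta> \<eta>) =
        Cmp (Fun_cat C D) F G K (Cmp (Fun_cat C D) G H K \<kappa> \<theta>) \<eta>"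
      by (auto simp: fun_eq_iff restrict_def intro!: Cmp_assoc is_functorD nat_transD(1))
  qed
qed

text \<open>Inverses of the components are natural automatically: insert \<open>\<eta> A\<close>
  after \<open>\<theta> A\<close>, move \<eta> across by its own naturality, and cancel
  \<open>\<theta> B\<close> against \<open>\<eta> B\<close>.\<close>

lemma is_iso_Fun_catI:
  assumes "category D" and F: "is_functor C D F" and G: "is_functor C D G"
    and \<eta>: "\<eta> \<in> nat_trans C D F G"
    and iso: "\<And>A. A \<in> Ob C \<Longrightarrow> is_iso D (fobj F A) (fobj G A) (\<eta> A)"
  shows "is_iso (Fun_cat C D) F G \<eta>"
proof -
  interpret category D by fact
  note d = is_functorD[OF F] is_functorD[OF G] nat_transD(1)[OF \<eta>]
  obtain \<theta> where \<theta>: "\<And>A. A \<in> Ob C \<Longrightarrow> \<theta> A \<in> Mor D (fobj G A) (fobj F A)"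
      "\<And>A. A \<in> Ob C \<Longrightarrow> Cmp D (fobj F A) (fobj G A) (fobj F A) (\<theta> A) (\<eta> A) = Idn D (fobj F A)"
      "\<And>A. A \<in> Ob C \<Longrightarrow> Cmp D (fobj G A) (fobj F A) (fobj G A) (\<eta> A) (\<theta> A) = Idn D (fobj G A)"
    using iso unfolding is_iso_def by metis
  have "Cmp D (fobj G A) (fobj G B) (fobj F B) (\<theta> B) (fmap G A B f) =
      Cmp D (fobj G A) (fobj F A) (fobj F B) (fmap F A B f) (\<theta> A)"
    if A: "A \<in> Ob C" and B: "B \<in> Ob C" and f: "f \<in> Mor C A B" for A B f
  proof -
    have "Cmp D (fobj G A) (fobj G B) (fobj F B) (\<theta> B) (fmap G A B f) =
      Cmp D (fobj G A) (fobj G B) (fobj F B) (\<theta> B)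
        (Cmp D (fobj G A) (fobj G A) (fobj G B) (fmap G A B f)
          (Cmp D (fobj G A) (fobj F A) (fobj G A) (\<eta> A) (\<theta> A)))"
      using that d by (simp add: \<theta> Cmp_Idn_right)
    also have "\<dots> = Cmp D (fobj G A) (fobj G B) (fobj F B) (\<theta> B)
        (Cmp D (fobj G A) (fobj F A) (fobj G B)
          (Cmp D (fobj F A) (fobj G A) (fobj G B) (fmap G A B f) (\<eta> A)) (\<theta> A))"
      using that d \<theta>(1) by (subst Cmp_assoc) auto
    also have "\<dots> = Cmp D (fobj G A) (fobj G B) (fobj F B) (\<theta> B)
        (Cmp D (fobj G A) (fobj F A) (fobj G B)
          (Cmp D (fobj F A) (fobj F B) (fobj G B) (\<eta> B) (fmap F A B f)) (\<theta> A))"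
      using that nat_transD(3)[OF \<eta>] by simp
    also have "\<dots> = Cmp D (fobj G A) (fobj G B) (fobj F B) (\<theta> B)
        (Cmp D (fobj G A) (fobj F B) (fobj G B) (\<eta> B)
          (Cmp D (fobj G A) (fobj F A) (fobj F B) (fmap F A B f) (\<theta> A)))"
      using that d \<theta>(1) by (subst Cmp_assoc) auto
    also have "\<dots> = Cmp D (fobj G A) (fobj F B) (fobj F B)
        (Cmp D (fobj F B) (fobj G B) (fobj F B) (\<theta> B) (\<eta> B))
        (Cmp D (fobj G A) (fobj F A) (fobj F B) (fmap F A B f) (\<theta> A))"
      using that d \<theta>(1) by (subst Cmp_assoc) (auto intro!: Cmp_in)
    also have "\<dots> = Cmp D (fobj G A) (fobj F A) (fobj F B) (fmap F A B f) (\<theta> A)"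
      using that d by (simp add: \<theta>, subst Cmp_Idn_left) (auto intro!: Cmp_in \<theta>(1) d)
    finally show ?thesis .
  qed
  \<comment> \<open>The chosen \<theta> is arbitrary outside \<open>Ob C\<close>, whereas a natural
    transformation has to be extensional.\<close>
  then have "restrict \<theta> (Ob C) \<in> nat_trans C D G F"
    by (intro nat_transI) (auto simp: \<theta>)
  with \<eta> \<theta>(2,3) show ?thesis
    unfolding is_iso_def
    by (intro conjI bexI[of _ "restrict \<theta> (Ob C)"]) (auto simp: fun_eq_iff restrict_def)
qed

lemma is_iso_Fun_catD:
  assumes "is_iso (Fun_cat C D) F G \<eta>" and "A \<in> Ob C"
  shows "is_iso D (fobj F A) (fobj G A) (\<eta> A)"
  using assms unfolding is_iso_def
  by (auto dest!: nat_transD(1)[of _ C D _ _ A] fun_cong[of _ _ A])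

section \<open>Inverses, and equivalences from fully faithful, essentially surjective
  functors\<close>

context category
begin

lemma is_iso_inverse:
  assumes "is_iso C A B f"
  shows "\<exists>g. is_iso C B A g \<and> Cmp C A B A g f = Idn C A \<and> Cmp C B A B f g = Idn C B"
  using assms unfolding is_iso_def by blast

lemma Cmp_cancel_left:
  assumes "A \<in> Ob C" "B \<in> Ob C" "D \<in> Ob C" "f \<in> Mor C A B" "g \<in> Mor C B D" "h \<in> Mor C D B"
    and "Cmp C B D B h g = Idn C B"
  shows "Cmp C A D B h (Cmp C A B D g f) = f"
  using assms by (subst Cmp_assoc) (auto simp: Cmp_Idn_left)

lemma Cmp_cancel_right:
  assumes "A \<in> Ob C" "B \<in> Ob C" "D \<in> Ob C" "f \<in> Mor C B D" "g \<in> Mor C A B" "h \<in> Mor C B A"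
    and "Cmp C B A B g h = Idn C B"
  shows "Cmp C B A D (Cmp C A B D f g) h = f"
  using assms by (subst Cmp_assoc[symmetric]) (auto simp: Cmp_Idn_right)

lemma is_iso_Cmp:
  assumes "A \<in> Ob C" "B \<in> Ob C" "D \<in> Ob C" "is_iso C A B f" "is_iso C B D g"
  shows "is_iso C A D (Cmp C A B D g f)"
proof -
  obtain f' g' where f': "f \<in> Mor C A B" "f' \<in> Mor C B A" "Cmp C A B A f' f = Idn C A" "Cmp C B A B f f' = Idn C B"
    and g': "g \<in> Mor C B D" "g' \<in> Mor C D B" "Cmp C B D B g' g = Idn C B" "Cmp C D B D g g' = Idn C D"
    using assms(4,5) unfolding is_iso_def by blast
  have "Cmp C A D A (Cmp C D B A f' g') (Cmp C A B D g f) =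
      Cmp C A B A f' (Cmp C A D B g' (Cmp C A B D g f))"
    using assms f' g' by (subst Cmp_assoc) (auto intro: Cmp_in)
  moreover have "Cmp C D A D (Cmp C A B D g f) (Cmp C D B A f' g') =
      Cmp C D B D g (Cmp C D A B f (Cmp C D B A f' g'))"
    using assms f' g' by (subst Cmp_assoc) (auto intro: Cmp_in)
  ultimately show ?thesis
    unfolding is_iso_def using assms f' g'
    by (intro conjI bexI[of _ "Cmp C D B A f' g'"]) (auto intro: Cmp_in simp: Cmp_cancel_left)
qed

end

text \<open>The quasi-inverse \<open>G\<close> sends \<open>A\<close> to a chosen
  \<open>\<Gamma> A\<close> with an isomorphism \<open>e A\<close> from \<open>A\<close> to
  \<open>fobj P (\<Gamma> A)\<close>, and a morphism to the unique one that \<open>P\<close> maps to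
  its conjugate by \<open>e\<close>. The unit is \<open>e\<close> itself; the counit is the lift of
  its inverse \<open>e'\<close>.\<close>

theorem equivalent_catsI:
  assumes C: "category C" and D: "category D" and P: "is_functor D C P"
    and faithful: "\<And>A B f g. \<lbrakk>A \<in> Ob D; B \<in> Ob D; f \<in> Mor D A B; g \<in> Mor D A B;
      fmap P A B f = fmap P A B g\<rbrakk> \<Longrightarrow> f = g"
    and full: "\<And>A B h. \<lbrakk>A \<in> Ob D; B \<in> Ob D; h \<in> Mor C (fobj P A) (fobj P B)\<rbrakk> \<Longrightarrow>
      \<exists>f \<in> Mor D A B. fmap P A B f = h"
    and ess_surj: "\<And>A. A \<in> Ob C \<Longrightarrow> \<exists>B \<in> Ob D. isomorphic_in C A (fobj P B)"
  shows "equivalent_cats C D"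
proof -
  interpret C: category C by fact
  interpret D: category D by fact
  obtain \<Gamma> where \<Gamma>: "\<And>A. A \<in> Ob C \<Longrightarrow> \<Gamma> A \<in> Ob D"
      "\<And>A. A \<in> Ob C \<Longrightarrow> isomorphic_in C A (fobj P (\<Gamma> A))"
    using ess_surj by metis
  then obtain e e' where
      e: "\<And>A. A \<in> Ob C \<Longrightarrow> e A \<in> Mor C A (fobj P (\<Gamma> A))"
      and e': "\<And>A. A \<in> Ob C \<Longrightarrow> e' A \<in> Mor C (fobj P (\<Gamma> A)) A"
      and e'e: "\<And>A. A \<in> Ob C \<Longrightarrow> Cmp C A (fobj P (\<Gamma> A)) A (e' A) (e A) = Idn C A"
      and ee': "\<And>A. A \<in> Ob C \<Longrightarrow>
        Cmp C (fobj P (\<Gamma> A)) A (fobj P (\<Gamma> A)) (e A) (e' A) = Idn C (fobj P (\<Gamma> A))"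
    unfolding isomorphic_in_def is_iso_def by metis
  note p = is_functorD[OF P]
  \<comment> \<open>Fullness provides a preimage and faithfulness makes it unique, so that the
    choice respects identities and composition.\<close>
  define lift where "lift A B h = (SOME f. f \<in> Mor D A B \<and> fmap P A B f = h)" for A B h
  have lift: "lift A B h \<in> Mor D A B" "fmap P A B (lift A B h) = h"
    if "A \<in> Ob D" "B \<in> Ob D" "h \<in> Mor C (fobj P A) (fobj P B)" for A B h
    using someI_ex[of "\<lambda>f. f \<in> Mor D A B \<and> fmap P A B f = h"] full[OF that]
    unfolding lift_def by blast+
  define conj where "conj A B f = Cmp C (fobj P (\<Gamma> A)) B (fobj P (\<Gamma> B)) (e B)
      (Cmp C (fobj P (\<Gamma> A)) A B f (e' A))" for A B f
  have conj: "conj A B f \<in> Mor C (fobj P (\<Gamma> A)) (fobj P (\<Gamma> B))"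
    if "A \<in> Ob C" "B \<in> Ob C" "f \<in> Mor C A B" for A B f
    unfolding conj_def using that e e' \<Gamma> p(1) by (intro C.Cmp_in) auto
  \<comment> \<open>This is naturality of the unit \<open>e\<close>, since \<open>P\<close> maps
    \<open>fmap G A B f\<close> to \<open>conj A B f\<close>.\<close>
  have conj_e: "Cmp C A (fobj P (\<Gamma> A)) (fobj P (\<Gamma> B)) (conj A B f) (e A) = Cmp C A B (fobj P (\<Gamma> B)) (e B) f"
    if "A \<in> Ob C" "B \<in> Ob C" "f \<in> Mor C A B" for A B f
  proof -
    have "Cmp C A (fobj P (\<Gamma> A)) (fobj P (\<Gamma> B)) (conj A B f) (e A) =
       Cmp C A B (fobj P (\<Gamma> B)) (e B)
        (Cmp C A (fobj P (\<Gamma> A)) B (Cmp C (fobj P (\<Gamma> A)) A B f (e' A)) (e A))"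
      unfolding conj_def using that e e' \<Gamma> p(1)
      by (subst C.Cmp_assoc[symmetric]) (auto intro!: C.Cmp_in)
    with that show ?thesis using e e' e'e \<Gamma> p(1) by (simp add: C.Cmp_cancel_right)
  qed
  \<comment> \<open>The mirror image for \<open>e'\<close>; it yields functoriality of
    \<open>G\<close> and naturality of the counit.\<close>
  have e'_conj: "Cmp C (fobj P (\<Gamma> A)) (fobj P (\<Gamma> B)) B (e' B) (conj A B f) = Cmp C (fobj P (\<Gamma> A)) A B f (e' A)"
    if "A \<in> Ob C" "B \<in> Ob C" "f \<in> Mor C A B" for A B f
    unfolding conj_def using that e e' e'e \<Gamma> p(1)
    by (intro C.Cmp_cancel_left) (auto intro: C.Cmp_in)
  define G where "G = \<lparr>fobj = \<Gamma>, fmap = (\<lambda>A B f. lift (\<Gamma> A) (\<Gamma> B) (conj A B f))\<rparr>"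
  have G_simps [simp]: "fobj G A = \<Gamma> A" "fmap G A B f = lift (\<Gamma> A) (\<Gamma> B) (conj A B f)" for A B f
    by (simp_all add: G_def)
  have G: "is_functor C D G"
  proof (rule is_functorI)
    fix A assume A: "A \<in> Ob C"
    show "fobj G A \<in> Ob D" using A \<Gamma> by simp
    have "conj A A (Idn C A) = Idn C (fobj P (\<Gamma> A))"
      unfolding conj_def using A e' ee' \<Gamma> p(1) by (simp add: C.Cmp_Idn_left)
    then show "fmap G A A (Idn C A) = Idn D (fobj G A)"
      using A \<Gamma> p lift by (intro faithful[of "\<Gamma> A" "\<Gamma> A"]) (auto simp: D.Idn_in C.Idn_in)
  next
    fix A B f assume "A \<in> Ob C" "B \<in> Ob C" "f \<in> Mor C A B"
    then show "fmap G A B f \<in> Mor D (fobj G A) (fobj G B)"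
      using \<Gamma> lift conj by simp
  next
    fix A B E f g assume A: "A \<in> Ob C" and B: "B \<in> Ob C" and E: "E \<in> Ob C"
      and f: "f \<in> Mor C A B" and g: "g \<in> Mor C B E"
    have gf: "Cmp C A B E g f \<in> Mor C A E" using A B E f g by (rule C.Cmp_in)
    have "Cmp C (fobj P (\<Gamma> A)) (fobj P (\<Gamma> B)) (fobj P (\<Gamma> E)) (conj B E g) (conj A B f) =
        Cmp C (fobj P (\<Gamma> A)) E (fobj P (\<Gamma> E)) (e E)
          (Cmp C (fobj P (\<Gamma> A)) (fobj P (\<Gamma> B)) E (Cmp C (fobj P (\<Gamma> B)) B E g (e' B)) (conj A B f))"
      unfolding conj_def[of B] using A B E f g e e' \<Gamma> p(1)
      by (subst C.Cmp_assoc[symmetric]) (auto intro!: C.Cmp_in conj)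
    also have "Cmp C (fobj P (\<Gamma> A)) (fobj P (\<Gamma> B)) E (Cmp C (fobj P (\<Gamma> B)) B E g (e' B)) (conj A B f) =
        Cmp C (fobj P (\<Gamma> A)) B E g (Cmp C (fobj P (\<Gamma> A)) A B f (e' A))"
      using A B E f g e e' \<Gamma> p(1)
      by (subst C.Cmp_assoc[symmetric]) (auto intro!: C.Cmp_in conj simp: e'_conj)
    also have "\<dots> = Cmp C (fobj P (\<Gamma> A)) A E (Cmp C A B E g f) (e' A)"
      using A B E f g e e' \<Gamma> p(1) by (subst C.Cmp_assoc) auto
    finally have "conj A E (Cmp C A B E g f) =
        Cmp C (fobj P (\<Gamma> A)) (fobj P (\<Gamma> B)) (fobj P (\<Gamma> E)) (conj B E g) (conj A B f)"
      by (simp add: conj_def[of A E])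
    then show "fmap G A E (Cmp C A B E g f) =
        Cmp D (fobj G A) (fobj G B) (fobj G E) (fmap G B E g) (fmap G A B f)"
      using A B E \<Gamma> p(1) lift(1)[of "\<Gamma> _" "\<Gamma> _"] lift(2)[of "\<Gamma> _" "\<Gamma> _"]
        conj[OF A B f] conj[OF B E g] conj[OF A E gf]
        p(4)[OF \<Gamma>(1)[OF A] \<Gamma>(1)[OF B] \<Gamma>(1)[OF E] lift(1) lift(1)]
      by (intro faithful[of "\<Gamma> A" "\<Gamma> E"]) (simp_all add: D.Cmp_in)
  qed
  have PG: "is_functor C C (comp_fctr P G)" and GP: "is_functor D D (comp_fctr G P)"
    using P G by (auto simp: is_functor_def)
  have "is_iso (Fun_cat C C) id_fctr (comp_fctr P G) (restrict e (Ob C))"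
  proof (rule is_iso_Fun_catI[OF C _ PG])
    show "is_functor C C id_fctr" by (simp add: is_functor_def)
    show "restrict e (Ob C) \<in> nat_trans C C id_fctr (comp_fctr P G)"
      by (rule nat_transI) (use e \<Gamma> lift conj conj_e in auto)
    show "is_iso C (fobj id_fctr A) (fobj (comp_fctr P G) A) (restrict e (Ob C) A)" if "A \<in> Ob C" for A
      using that e e' ee' e'e by (auto simp: is_iso_def intro!: bexI[of _ "e' A"])
  qed
  moreover
  \<comment> \<open>The counit and its inverse are preimages of \<open>e'\<close> and
    \<open>e\<close>. Equations between them are checked after applying \<open>P\<close> and then
    follow by faithfulness.\<close>
  define d where "d B = lift (\<Gamma> (fobj P B)) B (e' (fobj P B))" for B
  define d' where "d' B = lift B (\<Gamma> (fobj P B)) (e (fobj P B))" for B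
  have d: "d B \<in> Mor D (\<Gamma> (fobj P B)) B" "fmap P (\<Gamma> (fobj P B)) B (d B) = e' (fobj P B)"
    and d': "d' B \<in> Mor D B (\<Gamma> (fobj P B))" "fmap P B (\<Gamma> (fobj P B)) (d' B) = e (fobj P B)"
    if "B \<in> Ob D" for B
    unfolding d_def d'_def using that p(1) \<Gamma> e e' by (auto intro!: lift)
  have "is_iso (Fun_cat D D) (comp_fctr G P) id_fctr (restrict d (Ob D))"
  proof (rule is_iso_Fun_catI[OF D GP])
    show "is_functor D D id_fctr" by (simp add: is_functor_def)
    show "restrict d (Ob D) \<in> nat_trans D D (comp_fctr G P) id_fctr"
    proof (rule nat_transI)
      fix A B f assume A: "A \<in> Ob D" and B: "B \<in> Ob D" and f: "f \<in> Mor D A B"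
      let ?g = "lift (\<Gamma> (fobj P A)) (\<Gamma> (fobj P B)) (conj (fobj P A) (fobj P B) (fmap P A B f))"
      have g: "?g \<in> Mor D (\<Gamma> (fobj P A)) (\<Gamma> (fobj P B))"
          "fmap P (\<Gamma> (fobj P A)) (\<Gamma> (fobj P B)) ?g = conj (fobj P A) (fobj P B) (fmap P A B f)"
        using A B f \<Gamma> p conj by (auto intro!: lift)
      have "Cmp D (\<Gamma> (fobj P A)) (\<Gamma> (fobj P B)) B (d B) ?g = Cmp D (\<Gamma> (fobj P A)) A B f (d A)"
        by (rule faithful[of "\<Gamma> (fobj P A)" B])
          (use A B f g \<Gamma> p d e'_conj in \<open>auto intro!: D.Cmp_in simp: p(4)[OF _ _ _ g(1) d(1)] p(4)[OF _ _ _ d(1) f]\<close>)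
      then show "Cmp D (fobj (comp_fctr G P) A) (fobj (comp_fctr G P) B) (fobj id_fctr B)
          (restrict d (Ob D) B) (fmap (comp_fctr G P) A B f) =
        Cmp D (fobj (comp_fctr G P) A) (fobj id_fctr A) (fobj id_fctr B)
          (fmap id_fctr A B f) (restrict d (Ob D) A)"
        using A B by simp
    qed (use d in auto)
    show "is_iso D (fobj (comp_fctr G P) B) (fobj id_fctr B) (restrict d (Ob D) B)"
      if B: "B \<in> Ob D" for B
    proof -
      note b = B p(1)[OF B] \<Gamma>(1)[OF p(1)[OF B]] d[OF B] d'[OF B]
      have "Cmp D (\<Gamma> (fobj P B)) B (\<Gamma> (fobj P B)) (d' B) (d B) = Idn D (\<Gamma> (fobj P B))"
        using b ee' by (intro faithful[of "\<Gamma> (fobj P B)" "\<Gamma> (fobj P B)"])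
          (auto intro: D.Cmp_in D.Idn_in simp: p(3) p(4)[OF _ _ _ d(1) d'(1)])
      moreover have "Cmp D B (\<Gamma> (fobj P B)) B (d B) (d' B) = Idn D B"
        using b e'e by (intro faithful[of B B])
          (auto intro: D.Cmp_in D.Idn_in simp: p(3) p(4)[OF _ _ _ d'(1) d(1)])
      ultimately show ?thesis using b by (auto simp: is_iso_def)
    qed
  qed
  ultimately show ?thesis
    unfolding equivalent_cats_def isomorphic_in_def using C D P G by blast
qed

text \<open>Hom-sets are unchanged, so only essential surjectivity has to be restricted. If
  \<open>A\<close> satisfies \<open>Q\<close> and is isomorphic to \<open>fobj P B\<close>,
  invariance of \<open>Q\<close> passes it to \<open>fobj P B\<close>, and hence \<open>B\<close>
  satisfies \<open>S\<close>.\<close>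

corollary equivalent_cats_full_subcatsI:
  assumes C: "category C" and D: "category D" and P: "is_functor D C P"
    and faithful: "\<And>A B f g. \<lbrakk>A \<in> Ob D; B \<in> Ob D; f \<in> Mor D A B; g \<in> Mor D A B;
      fmap P A B f = fmap P A B g\<rbrakk> \<Longrightarrow> f = g"
    and full: "\<And>A B h. \<lbrakk>A \<in> Ob D; B \<in> Ob D; h \<in> Mor C (fobj P A) (fobj P B)\<rbrakk> \<Longrightarrow>
      \<exists>f \<in> Mor D A B. fmap P A B f = h"
    and ess_surj: "\<And>A. A \<in> Ob C \<Longrightarrow> \<exists>B \<in> Ob D. isomorphic_in C A (fobj P B)"
    and QS: "\<And>B. B \<in> Ob D \<Longrightarrow> Q (fobj P B) \<longleftrightarrow> S B"
    and Q: "\<And>A B. \<lbrakk>A \<in> Ob C; B \<in> Ob C; isomorphic_in C A B; Q A\<rbrakk> \<Longrightarrow> Q B"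
  shows "equivalent_cats (full_subcat C Q) (full_subcat D S)"
proof (rule equivalent_catsI)
  show "is_functor (full_subcat D S) (full_subcat C Q) P"
    using P QS by (auto simp: is_functor_def)
  show "\<exists>B \<in> Ob (full_subcat D S). isomorphic_in (full_subcat C Q) A (fobj P B)"
    if A: "A \<in> Ob (full_subcat C Q)" for A
  proof -
    obtain B where "B \<in> Ob D" "isomorphic_in C A (fobj P B)"
      using A ess_surj by auto
    with A QS Q[of A "fobj P B"] is_functorD(1)[OF P] show ?thesis by auto
  qed
qed (use assms in \<open>auto simp: category_full_subcat\<close>)

section \<open>Modules\<close>

text \<open>Formulated for additive maps, so that it applies to linear maps over either ring, to
  evaluation of a sequence at an index and to an encoding map alike.\<close>

lemma hom_finsum:
  assumes "abelian_group M" and "abelian_group N" and f: "f \<in> hom (add_monoid M) (add_monoid N)"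
    and "finite A" and "g \<in> A \<rightarrow> carrier M"
  shows "f (finsum M g A) = finsum N (\<lambda>a. f (g a)) A"
proof -
  interpret M: abelian_group M by fact
  interpret N: abelian_group N by fact
  interpret group_hom "add_monoid M" "add_monoid N" f
    using f M.a_group N.a_group by (auto simp: group_hom_def group_hom_axioms_def)
  have closed: "x \<in> carrier M \<Longrightarrow> f x \<in> carrier N" for x using hom_closed by simp
  from \<open>finite A\<close> \<open>g \<in> A \<rightarrow> carrier M\<close> show ?thesis
  proof (induction A)
    case empty then show ?case using hom_one by simp
  next
    case (insert a A)
    then have g: "g a \<in> carrier M" "g \<in> A \<rightarrow> carrier M" by auto
    then have "f (g a \<oplus>\<^bsub>M\<^esub> finsum M g A) = f (g a) \<oplus>\<^bsub>N\<^esub> f (finsum M g A)"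
      using hom_mult[of "g a" "finsum M g A"] by simp
    with insert g show ?case by (simp add: M.finsum_insert N.finsum_insert Pi_def closed)
  qed
qed

lemma mod_homD:
  assumes "f \<in> mod_hom R M N"
  shows "x \<in> carrier M \<Longrightarrow> f x \<in> carrier N"
    and "\<lbrakk>x \<in> carrier M; y \<in> carrier M\<rbrakk> \<Longrightarrow> f (x \<oplus>\<^bsub>M\<^esub> y) = f x \<oplus>\<^bsub>N\<^esub> f y"
    and "\<lbrakk>r \<in> carrier R; x \<in> carrier M\<rbrakk> \<Longrightarrow> f (r \<odot>\<^bsub>M\<^esub> x) = r \<odot>\<^bsub>N\<^esub> f x"
    and "f \<in> hom (add_monoid M) (add_monoid N)"
    and "f \<in> extensional (carrier M)"
  using assms by (auto simp: mod_hom_def hom_def)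

lemma mod_homI:
  assumes "\<And>x. x \<in> carrier M \<Longrightarrow> f x \<in> carrier N"
    and "\<And>x y. \<lbrakk>x \<in> carrier M; y \<in> carrier M\<rbrakk> \<Longrightarrow> f (x \<oplus>\<^bsub>M\<^esub> y) = f x \<oplus>\<^bsub>N\<^esub> f y"
    and "\<And>r x. \<lbrakk>r \<in> carrier R; x \<in> carrier M\<rbrakk> \<Longrightarrow> f (r \<odot>\<^bsub>M\<^esub> x) = r \<odot>\<^bsub>N\<^esub> f x"
    and "f \<in> extensional (carrier M)"
  shows "f \<in> mod_hom R M N"
  using assms by (auto simp: mod_hom_def hom_def)

lemma mod_hom_zero:
  assumes "abelian_group M" and "abelian_group N" and "f \<in> mod_hom R M N"
  shows "f \<zero>\<^bsub>M\<^esub> = \<zero>\<^bsub>N\<^esub>"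
proof -
  interpret group_hom "add_monoid M" "add_monoid N" f
    using assms(1,2)[THEN abelian_group.a_group] mod_homD(4)[OF assms(3)]
    by (simp add: group_hom_def group_hom_axioms_def)
  show ?thesis using hom_one by simp
qed

lemma mod_hom_eqI:
  assumes "f \<in> mod_hom R M N" "g \<in> mod_hom R M N" "\<And>x. x \<in> carrier M \<Longrightarrow> f x = g x"
  shows "f = g"
  using mod_homD(5)[OF assms(1)] mod_homD(5)[OF assms(2)] assms(3) by (rule extensionalityI)

lemma mod_hom_ident:
  assumes "Module.module R M"
  shows "(\<lambda>x \<in> carrier M. x) \<in> mod_hom R M M"
proof -
  interpret Module.module R M by fact
  show ?thesis by (rule mod_homI) auto
qed

lemma mod_hom_compose:
  assumes "Module.module R L" and "f \<in> mod_hom R L M" and "g \<in> mod_hom R M N"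
  shows "compose (carrier L) g f \<in> mod_hom R L N"
proof -
  interpret Module.module R L by fact
  show ?thesis
    by (rule mod_homI) (auto simp: compose_def mod_homD[OF assms(2)] mod_homD[OF assms(3)])
qed

lemma Mod_cat_simps [simp]:
  "Ob (Mod_cat R) = {M. Module.module R M}"
  "Mor (Mod_cat R) = mod_hom R"
  "Idn (Mod_cat R) M = (\<lambda>x \<in> carrier M. x)"
  "Cmp (Mod_cat R) L M N g f = compose (carrier L) g f"
  by (simp_all add: Mod_cat_def)

lemma grMod_cat_simps [simp]:
  "Ob (grMod_cat R) = {M. is_graded_module R M}"
  "Mor (grMod_cat R) M N = {f \<in> mod_hom (UP R) M N. \<forall>n. f ` grade M n \<subseteq> grade N n}"
  "Idn (grMod_cat R) M = (\<lambda>x \<in> carrier M. x)"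
  "Cmp (grMod_cat R) L M N g f = compose (carrier L) g f"
  by (simp_all add: grMod_cat_def)

lemma compose_ident_right: "f \<in> extensional A \<Longrightarrow> compose A f (\<lambda>x \<in> A. x) = f"
  by (auto simp: compose_def fun_eq_iff extensional_def)

lemma compose_ident_left:
  "f \<in> extensional A \<Longrightarrow> (\<And>x. x \<in> A \<Longrightarrow> f x \<in> B) \<Longrightarrow> compose A (\<lambda>x \<in> B. x) f = f"
  by (auto simp: compose_def fun_eq_iff extensional_def)

lemma category_Mod_cat: "category (Mod_cat R)"
  by (rule category.intro)
    (auto simp: mod_hom_ident mod_hom_compose compose_ident_right compose_ident_left mod_homD
      intro!: compose_assoc)

text \<open>The set-theoretic inverse of a bijective homomorphism is linear, because both sides of
  each linearity equation have the same image under the injective \<open>f\<close>. It is restricted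
  to the carrier because homomorphisms are extensional.\<close>

lemma is_iso_Mod_cat_iff:
  assumes "Module.module R M" and "Module.module R N"
  shows "is_iso (Mod_cat R) M N f \<longleftrightarrow> f \<in> mod_hom R M N \<and> bij_betw f (carrier M) (carrier N)"
proof -
  interpret M: Module.module R M by fact
  interpret N: Module.module R N by fact
  show ?thesis
  proof (intro iffI conjI)
    assume iso: "is_iso (Mod_cat R) M N f"
    then obtain g where f: "f \<in> mod_hom R M N" and g: "g \<in> mod_hom R N M"
      and gf: "compose (carrier M) g f = (\<lambda>x \<in> carrier M. x)"
      and fg: "compose (carrier N) f g = (\<lambda>x \<in> carrier N. x)"
      by (auto simp: is_iso_def)
    show "f \<in> mod_hom R M N" by fact
    have "g (f x) = x" if "x \<in> carrier M" for x using that fun_cong[OF gf, of x] by (simp add: compose_def)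
    moreover have "f (g x) = x" if "x \<in> carrier N" for x using that fun_cong[OF fg, of x] by (simp add: compose_def)
    ultimately show "bij_betw f (carrier M) (carrier N)"
      by (intro bij_betw_byWitness[of _ g]) (auto simp: mod_homD[OF f] mod_homD[OF g])
  next
    assume "f \<in> mod_hom R M N \<and> bij_betw f (carrier M) (carrier N)"
    then have f: "f \<in> mod_hom R M N" and bij: "bij_betw f (carrier M) (carrier N)" by auto
    define g where "g = restrict (inv_into (carrier M) f) (carrier N)"
    have g: "g y \<in> carrier M" "f (g y) = y" if "y \<in> carrier N" for y
      using that bij by (auto simp: g_def bij_betw_def inv_into_into f_inv_into_f)
    have gf: "g (f x) = x" if "x \<in> carrier M" for x
      using that bij by (auto simp: g_def bij_betw_def)
    have inj: "x = y" if "f x = f y" "x \<in> carrier M" "y \<in> carrier M" for x y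
      using that gf by metis
    have "g \<in> mod_hom R N M"
    proof (rule mod_homI)
      show "g (x \<oplus>\<^bsub>N\<^esub> y) = g x \<oplus>\<^bsub>M\<^esub> g y" if "x \<in> carrier N" "y \<in> carrier N" for x y
        using that g by - (rule inj, auto simp: mod_homD[OF f])
      show "g (r \<odot>\<^bsub>N\<^esub> x) = r \<odot>\<^bsub>M\<^esub> g x" if "r \<in> carrier R" "x \<in> carrier N" for r x
        using that g by - (rule inj, auto simp: mod_homD[OF f])
    qed (use g in \<open>auto simp: g_def\<close>)
    moreover have "compose (carrier M) g f = (\<lambda>x \<in> carrier M. x)"
      "compose (carrier N) f g = (\<lambda>x \<in> carrier N. x)"
      using g gf by (auto simp: compose_def fun_eq_iff)
    ultimately show "is_iso (Mod_cat R) M N f"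
      using f by (auto simp: is_iso_def intro!: bexI[of _ g])
  qed
qed

section \<open>Graded modules\<close>

text \<open>The sequence of homogeneous components of \<open>x\<close>. The description is
  meaningful for \<open>x\<close> in the carrier of a graded module, where exactly one such sequence
  exists.\<close>

definition gcomp :: "('s, 'a) graded_module \<Rightarrow> 'a \<Rightarrow> nat \<Rightarrow> 'a" where
  "gcomp M x = (THE c. (\<forall>n. c n \<in> grade M n) \<and> finite {n. c n \<noteq> \<zero>\<^bsub>M\<^esub>} \<and>
      x = (\<Oplus>\<^bsub>M\<^esub>n \<in> {n. c n \<noteq> \<zero>\<^bsub>M\<^esub>}. c n))"

locale gr_module =
  fixes R :: "('r, 'e) ring_scheme" and M :: "(nat \<Rightarrow> 'r, 'a) graded_module"
  assumes R_cring: "cring R" and is_graded: "is_graded_module R M"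

sublocale gr_module \<subseteq> U: UP_cring R "UP R"
  using R_cring by (simp add: UP_cring_def)

sublocale gr_module \<subseteq> Module.module "UP R" M
  using is_graded by (simp add: is_graded_module_def)

context gr_module
begin

abbreviation mon :: "'r \<Rightarrow> nat \<Rightarrow> nat \<Rightarrow> 'r" where "mon \<equiv> monom (UP R)"

lemma grade_subgroup: "subgroup (grade M n) (add_monoid M)"
  using is_graded by (simp add: is_graded_module_def)

lemma grade_closed: "x \<in> grade M n \<Longrightarrow> x \<in> carrier M"
  using subgroup.subset[OF grade_subgroup] by auto

lemma grade_zero [simp]: "\<zero>\<^bsub>M\<^esub> \<in> grade M n"
  using subgroup.one_closed[OF grade_subgroup] by simp

lemma grade_add: "x \<in> grade M n \<Longrightarrow> y \<in> grade M n \<Longrightarrow> x \<oplus>\<^bsub>M\<^esub> y \<in> grade M n"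
  using subgroup.m_closed[OF grade_subgroup] by simp

lemma grade_inv: "x \<in> grade M n \<Longrightarrow> \<ominus>\<^bsub>M\<^esub> x \<in> grade M n"
  using subgroup.m_inv_closed[OF grade_subgroup] by (simp add: a_inv_def)

lemma grade_smult: "r \<in> carrier R \<Longrightarrow> x \<in> grade M n \<Longrightarrow> mon r i \<odot>\<^bsub>M\<^esub> x \<in> grade M (i + n)"
  using is_graded by (simp add: is_graded_module_def)

lemma gcomp_ex1: "x \<in> carrier M \<Longrightarrow> \<exists>!c. (\<forall>n. c n \<in> grade M n) \<and> finite {n. c n \<noteq> \<zero>\<^bsub>M\<^esub>} \<and>
      x = (\<Oplus>\<^bsub>M\<^esub>n \<in> {n. c n \<noteq> \<zero>\<^bsub>M\<^esub>}. c n)"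
  using is_graded by (simp add: is_graded_module_def)

lemma gcomp_props:
  assumes "x \<in> carrier M"
  shows gcomp_in: "gcomp M x n \<in> grade M n"
    and finite_gcomp: "finite {n. gcomp M x n \<noteq> \<zero>\<^bsub>M\<^esub>}"
    and gcomp_finsum: "(\<Oplus>\<^bsub>M\<^esub>n \<in> {n. gcomp M x n \<noteq> \<zero>\<^bsub>M\<^esub>}. gcomp M x n) = x"
  using theI'[OF gcomp_ex1[OF assms]] unfolding gcomp_def by auto

lemma gcomp_closed: "x \<in> carrier M \<Longrightarrow> gcomp M x n \<in> carrier M"
  by (rule grade_closed[OF gcomp_in])

text \<open>Uniqueness of the decomposition in a usable form: the sum may run over any finite set
  that contains the support.\<close>

lemma gcomp_eqI:
  assumes c: "\<And>n. c n \<in> grade M n" and "finite A" and "\<And>n. n \<notin> A \<Longrightarrow> c n = \<zero>\<^bsub>M\<^esub>"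
    and x: "x = (\<Oplus>\<^bsub>M\<^esub>n \<in> A. c n)"
  shows "gcomp M x = c"
proof -
  have sub: "{n. c n \<noteq> \<zero>\<^bsub>M\<^esub>} \<subseteq> A" using assms(3) by auto
  then have fin: "finite {n. c n \<noteq> \<zero>\<^bsub>M\<^esub>}" using \<open>finite A\<close> finite_subset by blast
  have x': "x = (\<Oplus>\<^bsub>M\<^esub>n \<in> {n. c n \<noteq> \<zero>\<^bsub>M\<^esub>}. c n)"
    unfolding x using sub \<open>finite A\<close> grade_closed[OF c]
    by (intro add.finprod_mono_neutral_cong_right) auto
  have xM: "x \<in> carrier M" unfolding x using grade_closed[OF c] by (intro finsum_closed) auto
  show ?thesis
    unfolding gcomp_def by (rule the1_equality[OF gcomp_ex1[OF xM]]) (use c fin x' in auto)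
qed

lemma gcomp_finsum_superset:
  assumes "x \<in> carrier M" "finite A" "{n. gcomp M x n \<noteq> \<zero>\<^bsub>M\<^esub>} \<subseteq> A"
  shows "x = (\<Oplus>\<^bsub>M\<^esub>n \<in> A. gcomp M x n)"
proof -
  have "(\<Oplus>\<^bsub>M\<^esub>n \<in> {n. gcomp M x n \<noteq> \<zero>\<^bsub>M\<^esub>}. gcomp M x n) = (\<Oplus>\<^bsub>M\<^esub>n \<in> A. gcomp M x n)"
    using assms gcomp_closed by (intro add.finprod_mono_neutral_cong_left) auto
  then show ?thesis using gcomp_finsum[OF assms(1)] by simp
qed

lemma gcomp_boundE:
  assumes "x \<in> carrier M"
  obtains N where "\<And>n. n > N \<Longrightarrow> gcomp M x n = \<zero>\<^bsub>M\<^esub>" "x = (\<Oplus>\<^bsub>M\<^esub>n \<in> {..N}. gcomp M x n)"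
proof -
  obtain N where N: "{n. gcomp M x n \<noteq> \<zero>\<^bsub>M\<^esub>} \<subseteq> {..N}"
    using finite_gcomp[OF assms] finite_nat_set_iff_bounded_le by (auto simp: subset_iff)
  show thesis
  proof (rule that)
    show "gcomp M x n = \<zero>\<^bsub>M\<^esub>" if "n > N" for n using that N by force
    show "x = (\<Oplus>\<^bsub>M\<^esub>n \<in> {..N}. gcomp M x n)" by (rule gcomp_finsum_superset[OF assms _ N]) simp
  qed
qed

text \<open>An element is the sum of its components. Equations between sections and between values
  of homomorphisms are later proved by this test in single degrees.\<close>

lemma gcomp_ext:
  assumes "x \<in> carrier M" "y \<in> carrier M" "\<And>n. gcomp M x n = gcomp M y n"
  shows "x = y"
proof -
  have "gcomp M x = gcomp M y" using assms(3) by auto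
  then show ?thesis using gcomp_finsum[OF assms(1)] gcomp_finsum[OF assms(2)] by metis
qed

lemma gcomp_homogeneous:
  assumes "x \<in> grade M n"
  shows "gcomp M x = (\<lambda>k. if k = n then x else \<zero>\<^bsub>M\<^esub>)"
  by (rule gcomp_eqI[of _ "{n}"]) (use assms grade_closed in auto)

lemma gcomp_zero [simp]: "gcomp M \<zero>\<^bsub>M\<^esub> n = \<zero>\<^bsub>M\<^esub>"
  using gcomp_homogeneous[of "\<zero>\<^bsub>M\<^esub>" n] by simp

lemma gcomp_add:
  assumes x: "x \<in> carrier M" and y: "y \<in> carrier M"
  shows "gcomp M (x \<oplus>\<^bsub>M\<^esub> y) n = gcomp M x n \<oplus>\<^bsub>M\<^esub> gcomp M y n"
proof -
  let ?A = "{n. gcomp M x n \<noteq> \<zero>\<^bsub>M\<^esub>} \<union> {n. gcomp M y n \<noteq> \<zero>\<^bsub>M\<^esub>}"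
  have A: "finite ?A" using finite_gcomp x y by simp
  have "gcomp M (x \<oplus>\<^bsub>M\<^esub> y) = (\<lambda>n. gcomp M x n \<oplus>\<^bsub>M\<^esub> gcomp M y n)"
  proof (rule gcomp_eqI[OF _ A])
    have "x \<oplus>\<^bsub>M\<^esub> y = (\<Oplus>\<^bsub>M\<^esub>n \<in> ?A. gcomp M x n) \<oplus>\<^bsub>M\<^esub> (\<Oplus>\<^bsub>M\<^esub>n \<in> ?A. gcomp M y n)"
      by (intro arg_cong2[where f = "add M"] gcomp_finsum_superset x y A) auto
    then show "x \<oplus>\<^bsub>M\<^esub> y = (\<Oplus>\<^bsub>M\<^esub>n \<in> ?A. gcomp M x n \<oplus>\<^bsub>M\<^esub> gcomp M y n)"
      using gcomp_closed x y by (simp add: finsum_addf Pi_def)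
  qed (use x y gcomp_in grade_add in auto)
  then show ?thesis by simp
qed

lemma gcomp_finsum_grade:
  assumes "\<And>n. c n \<in> grade M n" "finite A"
  shows "gcomp M (\<Oplus>\<^bsub>M\<^esub>n \<in> A. c n) k = (if k \<in> A then c k else \<zero>\<^bsub>M\<^esub>)"
proof -
  have "gcomp M (\<Oplus>\<^bsub>M\<^esub>n \<in> A. c n) = (\<lambda>k. if k \<in> A then c k else \<zero>\<^bsub>M\<^esub>)"
    by (rule gcomp_eqI[of _ A])
      (use assms grade_closed[OF assms(1)] in \<open>auto intro!: finsum_cong'\<close>)
  then show ?thesis by simp
qed

lemma monom_smult_monom:
  assumes "r \<in> carrier R" "s \<in> carrier R" "x \<in> carrier M"
  shows "mon r i \<odot>\<^bsub>M\<^esub> (mon s j \<odot>\<^bsub>M\<^esub> x) = mon (r \<otimes>\<^bsub>R\<^esub> s) (i + j) \<odot>\<^bsub>M\<^esub> x"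
  using assms by (simp add: smult_assoc1[symmetric])

text \<open>A polynomial is the sum of its monomials, so the action of \<open>R[t]\<close> is
  controlled by that of the monomials, which shift degrees.\<close>

lemma smult_expand:
  assumes "p \<in> carrier (UP R)" "x \<in> carrier M"
  shows "p \<odot>\<^bsub>M\<^esub> x = (\<Oplus>\<^bsub>M\<^esub>i \<in> {..deg R p}. mon (coeff (UP R) p i) i \<odot>\<^bsub>M\<^esub> x)"
proof -
  have "(\<Oplus>\<^bsub>UP R\<^esub>i \<in> A. mon (coeff (UP R) p i) i) \<odot>\<^bsub>M\<^esub> x =
      (\<Oplus>\<^bsub>M\<^esub>i \<in> A. mon (coeff (UP R) p i) i \<odot>\<^bsub>M\<^esub> x)" if "finite A" for A
    using that assms by (induction A) (auto simp: smult_l_distr Pi_def)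
  from this[of "{..deg R p}"] show ?thesis using U.up_repr[OF assms(1)] by simp
qed

end

text \<open>The images of the components of \<open>x\<close> are homogeneous of the right degrees
  and sum to \<open>f x\<close>; by uniqueness they are its components.\<close>

lemma gr_hom_gcomp:
  assumes R: "cring R" and M: "is_graded_module R M" and N: "is_graded_module R N"
    and f: "f \<in> Mor (grMod_cat R) M N" and x: "x \<in> carrier M"
  shows "gcomp N (f x) n = f (gcomp M x n)"
proof -
  interpret M: gr_module R M using R M by (rule gr_module.intro)
  interpret N: gr_module R N using R N by (rule gr_module.intro)
  have fm: "f \<in> mod_hom (UP R) M N" and fg: "f ` grade M n \<subseteq> grade N n" for n using f by auto
  have "f x = (\<Oplus>\<^bsub>N\<^esub>n \<in> {n. gcomp M x n \<noteq> \<zero>\<^bsub>M\<^esub>}. f (gcomp M x n))"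
    by (subst M.gcomp_finsum[OF x, symmetric], rule hom_finsum)
      (use x fm in \<open>auto simp: mod_homD M.gcomp_closed M.finite_gcomp M.abelian_group_axioms N.abelian_group_axioms\<close>)
  then have "gcomp N (f x) = (\<lambda>n. f (gcomp M x n))"
    using fg M.gcomp_in[OF x] M.finite_gcomp[OF x] mod_hom_zero[OF M.abelian_group_axioms N.abelian_group_axioms fm]
    by (intro N.gcomp_eqI) auto
  then show ?thesis by simp
qed

lemma category_grMod_cat: "category (grMod_cat R)"
proof (rule category.intro)
  fix A B D f g assume "A \<in> Ob (grMod_cat R)" "f \<in> Mor (grMod_cat R) A B" "g \<in> Mor (grMod_cat R) B D"
  then have A: "is_graded_module R A" and f: "f \<in> mod_hom (UP R) A B" "\<And>n. f ` grade A n \<subseteq> grade B n"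
    and g: "g \<in> mod_hom (UP R) B D" "\<And>n. g ` grade B n \<subseteq> grade D n" by auto
  have "grade A n \<subseteq> carrier A" for n
    using A subgroup.subset[of "grade A n" "add_monoid A"] by (simp add: is_graded_module_def)
  then have "compose (carrier A) g f ` grade A n \<subseteq> grade D n" for n
    using f(2)[of n] g(2)[of n] by (fastforce simp: compose_def)
  moreover have "Module.module (UP R) A" using A by (simp add: is_graded_module_def)
  ultimately show "Cmp (grMod_cat R) A B D g f \<in> Mor (grMod_cat R) A D"
    using mod_hom_compose[OF _ f(1) g(1)] by simp
next
  fix A assume "A \<in> Ob (grMod_cat R)"
  then have A: "is_graded_module R A" by simp
  have "x \<in> carrier A" if "x \<in> grade A n" for n x
    using that A subgroup.subset[of "grade A n" "add_monoid A"] by (auto simp: is_graded_module_def)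
  then show "Idn (grMod_cat R) A \<in> Mor (grMod_cat R) A A"
    using A mod_hom_ident[of "UP R" A] by (auto simp: is_graded_module_def)
qed (auto simp: compose_ident_right compose_ident_left mod_homD intro!: compose_assoc)

section \<open>Degree parts, with scalars restricted along the inclusion of the constants\<close>

definition deg_part :: "('r, 'e) ring_scheme \<Rightarrow> (nat \<Rightarrow> 'r, 'a) graded_module \<Rightarrow> nat \<Rightarrow> ('r, 'a) module" where
  "deg_part R M i = \<lparr>carrier = grade M i, mult = mult M, one = one M, zero = zero M, add = add M,
    smult = (\<lambda>r x. monom (UP R) r 0 \<odot>\<^bsub>M\<^esub> x)\<rparr>"

lemma deg_part_simps [simp]:
  "carrier (deg_part R M i) = grade M i"
  "zero (deg_part R M i) = zero M"
  "add (deg_part R M i) = add M"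
  "smult (deg_part R M i) r x = monom (UP R) r 0 \<odot>\<^bsub>M\<^esub> x"
  by (simp_all add: deg_part_def)

lemma (in gr_module) module_deg_part: "Module.module R (deg_part R M i)"
proof (rule Module.moduleI[OF R_cring])
  show "abelian_group (deg_part R M i)"
  proof (rule abelian_groupI)
    fix x assume x: "x \<in> carrier (deg_part R M i)"
    then show "\<exists>y \<in> carrier (deg_part R M i). y \<oplus>\<^bsub>deg_part R M i\<^esub> x = \<zero>\<^bsub>deg_part R M i\<^esub>"
      using grade_closed by (auto intro!: bexI[of _ "\<ominus>\<^bsub>M\<^esub> x"] simp: grade_inv l_neg)
  qed (auto simp: grade_add grade_closed a_ac)
next
  fix r s x y assume "r \<in> carrier R" "x \<in> carrier (deg_part R M i)" 
  then show "r \<odot>\<^bsub>deg_part R M i\<^esub> x \<in> carrier (deg_part R M i)"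
    using grade_smult[of r x i 0] by simp
qed (auto simp: grade_closed smult_l_distr smult_r_distr monom_smult_monom)

section \<open>Graded homomorphisms\<close>

text \<open>A graded homomorphism commutes with taking components and is therefore determined on
  homogeneous elements. Faithfulness of the degree functor rests on this.\<close>

lemma gr_hom_eqI:
  assumes R: "cring R" and M: "is_graded_module R M" and N: "is_graded_module R N"
    and f: "f \<in> Mor (grMod_cat R) M N" and g: "g \<in> Mor (grMod_cat R) M N"
    and eq: "\<And>n x. x \<in> grade M n \<Longrightarrow> f x = g x"
  shows "f = g"
proof (rule mod_hom_eqI)
  interpret M: gr_module R M using R M by (rule gr_module.intro)
  interpret N: gr_module R N using R N by (rule gr_module.intro)
  show fm: "f \<in> mod_hom (UP R) M N" and gm: "g \<in> mod_hom (UP R) M N" using f g by auto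
  show "f x = g x" if "x \<in> carrier M" for x
    using that by - (rule N.gcomp_ext,
      auto simp: mod_homD[OF fm] mod_homD[OF gm] gr_hom_gcomp[OF R M N f] gr_hom_gcomp[OF R M N g]
        intro: eq M.gcomp_in)
qed

lemma restrict_deg_part_hom:
  assumes R: "cring R" and M: "is_graded_module R M"
    and f: "f \<in> Mor (grMod_cat R) M N"
  shows "restrict f (grade M i) \<in> mod_hom R (deg_part R M i) (deg_part R N i)"
proof -
  interpret M: gr_module R M using R M by (rule gr_module.intro)
  have "r \<in> carrier R \<Longrightarrow> x \<in> grade M i \<Longrightarrow> M.mon r 0 \<odot>\<^bsub>M\<^esub> x \<in> grade M i" for r x
    using M.grade_smult[of r x i 0] by simp
  moreover have "x \<in> grade M i \<Longrightarrow> f x \<in> grade N i" for x using f by auto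
  ultimately show ?thesis
    using f by (intro mod_homI) (auto simp: mod_homD M.grade_add M.grade_closed)
qed

text \<open>Multiplication by a power of t commutes with the constants. The exponent is written
  \<open>j - i\<close> to match the transition maps of \<open>deg_seq\<close>, which are indexed by
  pairs of degrees.\<close>

lemma (in gr_module) shift_hom:
  assumes "i \<le> j"
  shows "(\<lambda>x \<in> grade M i. mon \<one>\<^bsub>R\<^esub> (j - i) \<odot>\<^bsub>M\<^esub> x) \<in> mod_hom R (deg_part R M i) (deg_part R M j)"
proof -
  have "r \<in> carrier R \<Longrightarrow> x \<in> grade M i \<Longrightarrow> mon r 0 \<odot>\<^bsub>M\<^esub> x \<in> grade M i" for r x
    using grade_smult[of r x i 0] by simp
  moreover have "x \<in> grade M i \<Longrightarrow> mon \<one>\<^bsub>R\<^esub> (j - i) \<odot>\<^bsub>M\<^esub> x \<in> grade M j" for x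
    using grade_smult[of "\<one>\<^bsub>R\<^esub>" x i "j - i"] assms by simp
  ultimately show ?thesis
    by (intro mod_homI) (auto simp: grade_add grade_closed smult_r_distr monom_smult_monom)
qed

text \<open>The extension sends \<open>x\<close> to the sum of all \<open>g n (gcomp M x n)\<close>.
  It is linear over \<open>R[t]\<close> because the \<open>g n\<close> respect constants and powers
  of t, and every polynomial is a sum of products of these. Fullness of the degree functor rests on
  this.\<close>

lemma gr_hom_extend:
  assumes R: "cring R" and M: "is_graded_module R M" and N: "is_graded_module R N"
    and g: "\<And>n. g n \<in> mod_hom R (deg_part R M n) (deg_part R N n)"
    and shift: "\<And>k n x. x \<in> grade M n \<Longrightarrow>
      g (k + n) (monom (UP R) \<one>\<^bsub>R\<^esub> k \<odot>\<^bsub>M\<^esub> x) = monom (UP R) \<one>\<^bsub>R\<^esub> k \<odot>\<^bsub>N\<^esub> g n x"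
  shows "\<exists>f \<in> Mor (grMod_cat R) M N. \<forall>n. \<forall>x \<in> grade M n. f x = g n x"
proof -
  interpret M: gr_module R M using R M by (rule gr_module.intro)
  interpret N: gr_module R N using R N by (rule gr_module.intro)
  have g_in: "g n x \<in> grade N n" if "x \<in> grade M n" for n x
    using mod_homD(1)[OF g] that by simp
  have g_add: "g n (x \<oplus>\<^bsub>M\<^esub> y) = g n x \<oplus>\<^bsub>N\<^esub> g n y" if "x \<in> grade M n" "y \<in> grade M n" for n x y
    using mod_homD(2)[OF g] that by simp
  have g_smult: "g n (M.mon r 0 \<odot>\<^bsub>M\<^esub> x) = M.mon r 0 \<odot>\<^bsub>N\<^esub> g n x" if "x \<in> grade M n" "r \<in> carrier R" for n x r
    using mod_homD(3)[OF g] that by simp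
  have g_zero: "g n \<zero>\<^bsub>M\<^esub> = \<zero>\<^bsub>N\<^esub>" for n
    using mod_hom_zero[OF Module.module.axioms(2)[OF M.module_deg_part]
        Module.module.axioms(2)[OF N.module_deg_part] g[of n]] by simp
  \<comment> \<open>A monomial is a power of t times a constant, so \<open>shift\<close> and
    linearity over \<open>R\<close> suffice.\<close>
  have g_monom: "g (i + n) (M.mon r i \<odot>\<^bsub>M\<^esub> x) = M.mon r i \<odot>\<^bsub>N\<^esub> g n x"
    if x: "x \<in> grade M n" and r: "r \<in> carrier R" for i n x r
  proof -
    have rx: "M.mon r 0 \<odot>\<^bsub>M\<^esub> x \<in> grade M n" using M.grade_smult[OF r x, of 0] by simp
    have "M.mon r i \<odot>\<^bsub>M\<^esub> x = M.mon \<one>\<^bsub>R\<^esub> i \<odot>\<^bsub>M\<^esub> (M.mon r 0 \<odot>\<^bsub>M\<^esub> x)"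
      using x r by (simp add: M.monom_smult_monom M.grade_closed)
    moreover have "M.mon r i \<odot>\<^bsub>N\<^esub> g n x = M.mon \<one>\<^bsub>R\<^esub> i \<odot>\<^bsub>N\<^esub> (M.mon r 0 \<odot>\<^bsub>N\<^esub> g n x)"
      using x r by (simp add: N.monom_smult_monom N.grade_closed[OF g_in])
    ultimately show ?thesis using shift[OF rx] g_smult[OF x r] by simp
  qed
  define f where "f = (\<lambda>x \<in> carrier M. \<Oplus>\<^bsub>N\<^esub>n \<in> {n. gcomp M x n \<noteq> \<zero>\<^bsub>M\<^esub>}. g n (gcomp M x n))"
  have gc: "g n (gcomp M x n) \<in> carrier N" if "x \<in> carrier M" for x n
    using that g_in M.gcomp_in N.grade_closed by blast
  have f_closed: "f x \<in> carrier N" if "x \<in> carrier M" for x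
    using that gc by (auto simp: f_def intro!: N.finsum_closed)
  \<comment> \<open>With the components of \<open>f x\<close> at hand, additivity and the extension
    property become statements in single degrees.\<close>
  have f_gcomp: "gcomp N (f x) n = g n (gcomp M x n)" if "x \<in> carrier M" for x n
    using that M.finite_gcomp[OF that]
    by (simp add: f_def N.gcomp_finsum_grade g_in M.gcomp_in g_zero)
  have f_ext: "f \<in> extensional (carrier M)" by (simp add: f_def)
  have f_hom: "f x = g n x" if "x \<in> grade M n" for x n
    using that M.grade_closed[OF that]
    by - (rule N.gcomp_ext,
      auto simp: f_closed f_gcomp M.gcomp_homogeneous N.gcomp_homogeneous[OF g_in] g_zero
        intro!: N.grade_closed[OF g_in])
  have f_add: "f (x \<oplus>\<^bsub>M\<^esub> y) = f x \<oplus>\<^bsub>N\<^esub> f y" if "x \<in> carrier M" "y \<in> carrier M" for x y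
    using that by - (rule N.gcomp_ext,
      auto simp: f_closed f_gcomp M.gcomp_add N.gcomp_add g_add M.gcomp_in)
  have f_ab: "f \<in> hom (add_monoid M) (add_monoid N)"
    using f_closed f_add by (auto simp: hom_def)
  note f_sum = hom_finsum[OF M.abelian_group_axioms N.abelian_group_axioms f_ab]
  \<comment> \<open>For homogeneous \<open>x\<close> the polynomial is expanded into monomials; a
    general \<open>x\<close> is afterwards expanded into its components.\<close>
  have f_smult_hom: "f (p \<odot>\<^bsub>M\<^esub> x) = p \<odot>\<^bsub>N\<^esub> f x" if p: "p \<in> carrier (UP R)" and x: "x \<in> grade M n" for p x n
  proof -
    have "f (p \<odot>\<^bsub>M\<^esub> x) = (\<Oplus>\<^bsub>N\<^esub>i \<in> {..deg R p}. f (M.mon (coeff (UP R) p i) i \<odot>\<^bsub>M\<^esub> x))"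
      using p x by (subst M.smult_expand) (auto simp: M.grade_closed intro!: f_sum)
    also have "\<dots> = (\<Oplus>\<^bsub>N\<^esub>i \<in> {..deg R p}. M.mon (coeff (UP R) p i) i \<odot>\<^bsub>N\<^esub> f x)"
      using p x by (intro N.finsum_cong')
        (auto simp: f_hom[OF x] f_hom[OF M.grade_smult[OF _ x]] g_monom N.grade_closed[OF g_in])
    also have "\<dots> = p \<odot>\<^bsub>N\<^esub> f x"
      using p x by (intro N.smult_expand[symmetric]) (auto simp: f_closed M.grade_closed)
    finally show ?thesis .
  qed
  have f_smult: "f (p \<odot>\<^bsub>M\<^esub> x) = p \<odot>\<^bsub>N\<^esub> f x" if p: "p \<in> carrier (UP R)" and x: "x \<in> carrier M" for p x
  proof -
    let ?A = "{n. gcomp M x n \<noteq> \<zero>\<^bsub>M\<^esub>}"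
    note fin = M.finite_gcomp[OF x]
    have eq: "x = (\<Oplus>\<^bsub>M\<^esub>n \<in> ?A. gcomp M x n)" by (simp add: M.gcomp_finsum[OF x])
    have "f (p \<odot>\<^bsub>M\<^esub> x) = f (\<Oplus>\<^bsub>M\<^esub>n \<in> ?A. p \<odot>\<^bsub>M\<^esub> gcomp M x n)"
      using p x fin M.gcomp_closed by (subst eq, subst M.finsum_smult_ldistr) auto
    also have "\<dots> = (\<Oplus>\<^bsub>N\<^esub>n \<in> ?A. f (p \<odot>\<^bsub>M\<^esub> gcomp M x n))"
      using p x fin by (intro f_sum) (auto simp: M.gcomp_closed)
    also have "\<dots> = (\<Oplus>\<^bsub>N\<^esub>n \<in> ?A. p \<odot>\<^bsub>N\<^esub> f (gcomp M x n))"
      using p x by (intro N.finsum_cong') (auto simp: f_smult_hom[OF p M.gcomp_in] f_closed M.gcomp_closed)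
    also have "\<dots> = p \<odot>\<^bsub>N\<^esub> (\<Oplus>\<^bsub>N\<^esub>n \<in> ?A. f (gcomp M x n))"
      using p x fin by (intro N.finsum_smult_ldistr[symmetric]) (auto simp: f_closed M.gcomp_closed)
    also have "(\<Oplus>\<^bsub>N\<^esub>n \<in> ?A. f (gcomp M x n)) = f (\<Oplus>\<^bsub>M\<^esub>n \<in> ?A. gcomp M x n)"
      using x fin by (intro f_sum[symmetric]) (auto simp: M.gcomp_closed)
    finally show ?thesis using M.gcomp_finsum[OF x] by simp
  qed
  have "f \<in> Mor (grMod_cat R) M N"
    using f_closed f_add f_smult f_hom g_in
    by (auto intro!: mod_homI simp: f_ext)
  then show ?thesis using f_hom by blast
qed

section \<open>Sheaves in terms of sections\<close>

definition compatible :: "'x set set \<Rightarrow> ('x set \<Rightarrow> 'x set \<Rightarrow> 'a \<Rightarrow> 'a) \<Rightarrow> ('x set \<Rightarrow> 'a) \<Rightarrow> bool" where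
  "compatible \<V> r s \<longleftrightarrow> (\<forall>V \<in> \<V>. \<forall>W \<in> \<V>. r V (V \<inter> W) (s V) = r W (V \<inter> W) (s W))"

text \<open>The sheaf condition, split into separatedness and gluing. \<open>S\<close> is the set of
  admissible families, which depends on the value category: all families for modules, those of
  bounded degree for graded modules.\<close>

definition glues :: "'x set set \<Rightarrow> ('x set \<Rightarrow> 'a) set \<Rightarrow> 'a set \<Rightarrow> ('x set \<Rightarrow> 'x set \<Rightarrow> 'a \<Rightarrow> 'a) \<Rightarrow> bool" where
  "glues \<V> S A r \<longleftrightarrow>
    (\<forall>x \<in> A. \<forall>y \<in> A. (\<forall>V \<in> \<V>. r (\<Union>\<V>) V x = r (\<Union>\<V>) V y) \<longrightarrow> x = y) \<and>
    (\<forall>s \<in> S. compatible \<V> r s \<longrightarrow> (\<exists>x \<in> A. \<forall>V \<in> \<V>. r (\<Union>\<V>) V x = s V))"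

lemma glues_separatedD:
  "\<lbrakk>glues \<V> S A r; x \<in> A; y \<in> A; \<And>V. V \<in> \<V> \<Longrightarrow> r (\<Union>\<V>) V x = r (\<Union>\<V>) V y\<rbrakk> \<Longrightarrow> x = y"
  by (auto simp: glues_def)

lemma glues_glueE:
  assumes "glues \<V> S A r" "s \<in> S" "compatible \<V> r s"
  obtains x where "x \<in> A" "\<And>V. V \<in> \<V> \<Longrightarrow> r (\<Union>\<V>) V x = s V"
  using assms by (auto simp: glues_def)

text \<open>Members of \<open>S\<close> are extensional, so equality of families is equality on the
  cover. As the restrictions of one element form a compatible member of \<open>S\<close>,
  bijectivity amounts to the two halves of \<open>glues\<close>.\<close>

lemma bij_betw_glues_iff:
  assumes "S \<subseteq> extensional \<V>"
    and "\<And>x. x \<in> A \<Longrightarrow> (\<lambda>V \<in> \<V>. r (\<Union>\<V>) V x) \<in> S"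
    and "\<And>x. x \<in> A \<Longrightarrow> compatible \<V> r (\<lambda>V \<in> \<V>. r (\<Union>\<V>) V x)"
  shows "bij_betw (\<lambda>x. \<lambda>V \<in> \<V>. r (\<Union>\<V>) V x) A {s \<in> S. compatible \<V> r s} \<longleftrightarrow> glues \<V> S A r"
proof -
  have eq: "(\<lambda>V \<in> \<V>. r (\<Union>\<V>) V x) = s \<longleftrightarrow> (\<forall>V \<in> \<V>. r (\<Union>\<V>) V x = s V)"
    if "s \<in> extensional \<V>" for x s
    using that by (auto simp: fun_eq_iff extensional_def restrict_def)
  have "inj_on (\<lambda>x. \<lambda>V \<in> \<V>. r (\<Union>\<V>) V x) A \<longleftrightarrow>
      (\<forall>x \<in> A. \<forall>y \<in> A. (\<forall>V \<in> \<V>. r (\<Union>\<V>) V x = r (\<Union>\<V>) V y) \<longrightarrow> x = y)"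
    by (simp add: inj_on_def eq)
  moreover have "(\<lambda>x. \<lambda>V \<in> \<V>. r (\<Union>\<V>) V x) ` A = {s \<in> S. compatible \<V> r s} \<longleftrightarrow>
      (\<forall>s \<in> S. compatible \<V> r s \<longrightarrow> (\<exists>x \<in> A. \<forall>V \<in> \<V>. r (\<Union>\<V>) V x = s V))" (is "?L \<longleftrightarrow> ?Rhs")
  proof
    assume ?L
    show ?Rhs
    proof (intro ballI impI)
      fix s assume s: "s \<in> S" "compatible \<V> r s"
      then have "s \<in> (\<lambda>x. \<lambda>V \<in> \<V>. r (\<Union>\<V>) V x) ` A" using \<open>?L\<close> by simp
      then show "\<exists>x \<in> A. \<forall>V \<in> \<V>. r (\<Union>\<V>) V x = s V" by auto
    qed
  next
    assume r: ?Rhs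
    have "s \<in> (\<lambda>x. \<lambda>V \<in> \<V>. r (\<Union>\<V>) V x) ` A" if s: "s \<in> S" "compatible \<V> r s" for s
    proof -
      obtain x where "x \<in> A" "\<forall>V \<in> \<V>. r (\<Union>\<V>) V x = s V" using r s by blast
      with eq[of s x] s assms(1) show ?thesis by blast
    qed
    with assms(2,3) show ?L by blast
  qed
  ultimately show ?thesis by (auto simp: bij_betw_def glues_def)
qed

text \<open>One statement for both value categories. Composition in \<open>C\<close> is abstract
  here, so functoriality of the restrictions enters as the equation \<open>comp\<close> on
  elements.\<close>

lemma is_sheaf_glues_iff:
  fixes F :: "('x set, unit, ('a, 'b) partial_object_scheme, 'a \<Rightarrow> 'a) fctr"
  assumes F: "is_functor (opens_op X) C F"
    and comp: "\<And>U V W x. \<lbrakk>openin X U; openin X V; openin X W; V \<subseteq> U; W \<subseteq> V; x \<in> carrier (fobj F U)\<rbrakk> \<Longrightarrow>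
      fmap F V W () (fmap F U V () x) = fmap F U W () x"
    and "\<And>\<V>. carrier (P \<V> (fobj F)) \<subseteq> extensional \<V>"
    and "\<And>\<V> x. \<lbrakk>\<forall>V \<in> \<V>. openin X V; x \<in> carrier (fobj F (\<Union>\<V>))\<rbrakk> \<Longrightarrow>
      (\<lambda>V \<in> \<V>. fmap F (\<Union>\<V>) V () x) \<in> carrier (P \<V> (fobj F))"
  shows "is_sheaf X C P F \<longleftrightarrow> (\<forall>\<V>. (\<forall>V \<in> \<V>. openin X V) \<longrightarrow>
    glues \<V> (carrier (P \<V> (fobj F))) (carrier (fobj F (\<Union>\<V>))) (\<lambda>U V. fmap F U V ()))"
proof -
  have "bij_betw (\<lambda>s. \<lambda>V \<in> \<V>. fmap F (\<Union>\<V>) V () s) (carrier (fobj F (\<Union>\<V>)))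
        {s \<in> carrier (P \<V> (fobj F)). compatible \<V> (\<lambda>U V. fmap F U V ()) s} \<longleftrightarrow>
      glues \<V> (carrier (P \<V> (fobj F))) (carrier (fobj F (\<Union>\<V>))) (\<lambda>U V. fmap F U V ())"
    if \<V>: "\<forall>V \<in> \<V>. openin X V" for \<V>
  proof (rule bij_betw_glues_iff)
    fix x assume x: "x \<in> carrier (fobj F (\<Union>\<V>))"
    have "fmap F V (V \<inter> W) () (fmap F (\<Union>\<V>) V () x) = fmap F (\<Union>\<V>) (V \<inter> W) () x"
        "fmap F W (V \<inter> W) () (fmap F (\<Union>\<V>) W () x) = fmap F (\<Union>\<V>) (V \<inter> W) () x"
      if "V \<in> \<V>" "W \<in> \<V>" for V W
      using that \<V> x by (auto intro!: comp)
    then show "compatible \<V> (\<lambda>U V. fmap F U V ()) (\<lambda>V \<in> \<V>. fmap F (\<Union>\<V>) V () x)"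
      by (auto simp: compatible_def)
  qed (use assms \<V> in auto)
  then show ?thesis using F unfolding is_sheaf_def compatible_def by auto
qed

locale mod_presheaf =
  fixes X :: "'x topology" and R :: "('r, 'e) ring_scheme"
    and F :: "('x set, unit, ('r, 'a) module, 'a \<Rightarrow> 'a) fctr"
  assumes presheaf: "is_functor (opens_op X) (Mod_cat R) F"
begin

lemma module_obj: "openin X U \<Longrightarrow> Module.module R (fobj F U)"
  using is_functorD(1)[OF presheaf, of U] by simp

lemma res_hom:
  "\<lbrakk>openin X U; openin X V; V \<subseteq> U\<rbrakk> \<Longrightarrow> fmap F U V u \<in> mod_hom R (fobj F U) (fobj F V)"
  using is_functorD(2)[OF presheaf, of U V u] by simp

lemma res_comp:
  assumes "openin X U" "openin X V" "openin X W" "V \<subseteq> U" "W \<subseteq> V" "x \<in> carrier (fobj F U)"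
  shows "fmap F V W u (fmap F U V v x) = fmap F U W w x"
  using is_functorD(4)[OF presheaf, of U V W v u] assms by (simp add: compose_def)

lemma is_sheaf_iff:
  "is_sheaf X (Mod_cat R) mod_prod F \<longleftrightarrow> (\<forall>\<V>. (\<forall>V \<in> \<V>. openin X V) \<longrightarrow>
    glues \<V> (\<Pi>\<^sub>E V \<in> \<V>. carrier (fobj F V)) (carrier (fobj F (\<Union>\<V>))) (\<lambda>U V. fmap F U V ()))"
proof -
  have [simp]: "carrier (mod_prod \<V> (fobj F)) = (\<Pi>\<^sub>E V \<in> \<V>. carrier (fobj F V))" for \<V>
    by (simp add: mod_prod_def)
  show ?thesis
    by (subst is_sheaf_glues_iff[OF presheaf])
      (auto simp: res_comp PiE_def intro!: mod_homD(1)[OF res_hom])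
qed

end

text \<open>Sections move between \<open>F\<close> and \<open>G\<close> through the bijections
  \<open>\<eta> U\<close>. The inverses \<open>\<theta> U\<close> serve as mere functions: equations
  about them are verified after applying the injective and natural \<eta>.\<close>

lemma is_sheaf_iso:
  assumes F: "is_functor (opens_op X) (Mod_cat R) F" and G: "is_functor (opens_op X) (Mod_cat R) G"
    and \<eta>: "\<eta> \<in> nat_trans (opens_op X) (Mod_cat R) F G"
    and bij: "\<And>U. openin X U \<Longrightarrow> bij_betw (\<eta> U) (carrier (fobj F U)) (carrier (fobj G U))"
    and sheaf: "is_sheaf X (Mod_cat R) mod_prod F"
  shows "is_sheaf X (Mod_cat R) mod_prod G"
proof -
  interpret F: mod_presheaf X R F using F by unfold_locales
  interpret G: mod_presheaf X R G using G by unfold_locales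
  have nat: "\<eta> V (fmap F U V u x) = fmap G U V u (\<eta> U x)"
    if "openin X U" "openin X V" "V \<subseteq> U" "x \<in> carrier (fobj F U)" for U V u x
    using nat_transD(3)[OF \<eta>, of U V u] that by (auto simp: compose_def dest!: fun_cong[of _ _ x])
  have inj: "x = y" if "openin X U" "x \<in> carrier (fobj F U)" "y \<in> carrier (fobj F U)" "\<eta> U x = \<eta> U y" for U x y
    using bij[OF that(1)] that(2-) by (auto simp: bij_betw_def inj_on_def)
  define \<theta> where "\<theta> U = inv_into (carrier (fobj F U)) (\<eta> U)" for U
  have \<theta>: "\<theta> U y \<in> carrier (fobj F U)" "\<eta> U (\<theta> U y) = y" if "openin X U" "y \<in> carrier (fobj G U)" for U y
    using bij[OF that(1)] that(2) by (auto simp: \<theta>_def bij_betw_def inv_into_into f_inv_into_f)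
  have \<eta>_in: "\<eta> U x \<in> carrier (fobj G U)" if "openin X U" "x \<in> carrier (fobj F U)" for U x
    using bij[OF that(1)] that(2) by (auto simp: bij_betw_def)
  show ?thesis
    unfolding G.is_sheaf_iff
  proof (intro allI impI)
    fix \<V> assume \<V>: "\<forall>V \<in> \<V>. openin X V"
    then have op: "openin X V" "V \<subseteq> \<Union>\<V>" if "V \<in> \<V>" for V using that by auto
    have U: "openin X (\<Union>\<V>)" using \<V> by auto
    have gl: "glues \<V> (\<Pi>\<^sub>E V \<in> \<V>. carrier (fobj F V)) (carrier (fobj F (\<Union>\<V>))) (\<lambda>U V. fmap F U V ())"
      using sheaf \<V> unfolding F.is_sheaf_iff by blast
    show "glues \<V> (\<Pi>\<^sub>E V \<in> \<V>. carrier (fobj G V)) (carrier (fobj G (\<Union>\<V>))) (\<lambda>U V. fmap G U V ())"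
      unfolding glues_def
    proof (intro conjI ballI impI)
      fix x y assume x: "x \<in> carrier (fobj G (\<Union>\<V>))" and y: "y \<in> carrier (fobj G (\<Union>\<V>))"
        and eq: "\<forall>V \<in> \<V>. fmap G (\<Union>\<V>) V () x = fmap G (\<Union>\<V>) V () y"
      have "fmap F (\<Union>\<V>) V () (\<theta> (\<Union>\<V>) x) = fmap F (\<Union>\<V>) V () (\<theta> (\<Union>\<V>) y)" if "V \<in> \<V>" for V
        using eq that x y by - (rule inj[OF op(1)[OF that]],
          auto simp: nat[OF U op[OF that]] \<theta>[OF U] mod_homD(1)[OF F.res_hom[OF U op[OF that]]])
      then have "\<theta> (\<Union>\<V>) x = \<theta> (\<Union>\<V>) y"
        by (rule glues_separatedD[OF gl \<theta>(1)[OF U x] \<theta>(1)[OF U y]])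
      then show "x = y" using \<theta>(2)[OF U x] \<theta>(2)[OF U y] by metis
    next
      fix s assume s: "s \<in> (\<Pi>\<^sub>E V \<in> \<V>. carrier (fobj G V))" and comp: "compatible \<V> (\<lambda>U V. fmap G U V ()) s"
      have sV: "s V \<in> carrier (fobj G V)" if "V \<in> \<V>" for V using s that by auto
      let ?t = "\<lambda>V \<in> \<V>. \<theta> V (s V)"
      have t: "?t \<in> (\<Pi>\<^sub>E V \<in> \<V>. carrier (fobj F V))" 
        using \<theta>(1)[OF op(1) sV] by (simp add: restrict_PiE_iff)
      have "fmap F V (V \<inter> W) () (\<theta> V (s V)) = fmap F W (V \<inter> W) () (\<theta> W (s W))"
        if V: "V \<in> \<V>" and W: "W \<in> \<V>" for V W
      proof (rule inj[of "V \<inter> W"])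
        show VW: "openin X (V \<inter> W)" using op V W by auto
        show "fmap F V (V \<inter> W) () (\<theta> V (s V)) \<in> carrier (fobj F (V \<inter> W))"
          "fmap F W (V \<inter> W) () (\<theta> W (s W)) \<in> carrier (fobj F (V \<inter> W))"
          using V W VW op \<theta> sV by (auto intro!: mod_homD(1)[OF F.res_hom])
        show "\<eta> (V \<inter> W) (fmap F V (V \<inter> W) () (\<theta> V (s V))) = \<eta> (V \<inter> W) (fmap F W (V \<inter> W) () (\<theta> W (s W)))"
          using V W VW op \<theta> sV comp[unfolded compatible_def, rule_format, OF V W] by (simp add: nat)
      qed
      then have "compatible \<V> (\<lambda>U V. fmap F U V ()) ?t" by (auto simp: compatible_def)
      from gl t this obtain x
        where x: "x \<in> carrier (fobj F (\<Union>\<V>))" "\<And>V. V \<in> \<V> \<Longrightarrow> fmap F (\<Union>\<V>) V () x = ?t V"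
        by (rule glues_glueE) (rule that)
      have "fmap G (\<Union>\<V>) V () (\<eta> (\<Union>\<V>) x) = s V" if "V \<in> \<V>" for V
        using nat[OF U op[OF that] x(1), symmetric] x(2) that \<theta>(2)[OF op(1)[OF that] sV[OF that]] by simp
      then show "\<exists>x \<in> carrier (fobj G (\<Union>\<V>)). \<forall>V \<in> \<V>. fmap G (\<Union>\<V>) V () x = s V"
        using \<eta>_in[OF U x(1)] by blast
    qed
  qed
qed

section \<open>The degree functor\<close>

definition deg_psh :: "('r, 'e) ring_scheme \<Rightarrow> ('x set, unit, (nat \<Rightarrow> 'r, 'a) graded_module, 'a \<Rightarrow> 'a) fctr
    \<Rightarrow> nat \<Rightarrow> ('x set, unit, ('r, 'a) module, 'a \<Rightarrow> 'a) fctr" where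
  "deg_psh R G i = \<lparr>fobj = (\<lambda>U. deg_part R (fobj G U) i),
    fmap = (\<lambda>U V u. restrict (fmap G U V u) (grade (fobj G U) i))\<rparr>"

text \<open>The transition maps are given in closed form by powers of t instead of as iterates. The
  two restrictions make them extensional, as required of natural transformations and of
  homomorphisms.\<close>

definition deg_seq :: "'x topology \<Rightarrow> ('r, 'e) ring_scheme \<Rightarrow>
    ('x set, unit, (nat \<Rightarrow> 'r, 'a) graded_module, 'a \<Rightarrow> 'a) fctr \<Rightarrow>
    (nat, unit, ('x set, unit, ('r, 'a) module, 'a \<Rightarrow> 'a) fctr, 'x set \<Rightarrow> 'a \<Rightarrow> 'a) fctr" where
  "deg_seq X R G = \<lparr>fobj = deg_psh R G,
    fmap = (\<lambda>i j u. \<lambda>U \<in> {U. openin X U}. \<lambda>x \<in> grade (fobj G U) i.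
      monom (UP R) \<one>\<^bsub>R\<^esub> (j - i) \<odot>\<^bsub>fobj G U\<^esub> x)\<rparr>"

definition deg_fctr :: "'x topology \<Rightarrow> ('r, 'e) ring_scheme \<Rightarrow>
    (('x set, unit, (nat \<Rightarrow> 'r, 'a) graded_module, 'a \<Rightarrow> 'a) fctr, 'x set \<Rightarrow> 'a \<Rightarrow> 'a,
     (nat, unit, ('x set, unit, ('r, 'a) module, 'a \<Rightarrow> 'a) fctr, 'x set \<Rightarrow> 'a \<Rightarrow> 'a) fctr,
     nat \<Rightarrow> 'x set \<Rightarrow> 'a \<Rightarrow> 'a) fctr" where
  "deg_fctr X R = \<lparr>fobj = deg_seq X R,
    fmap = (\<lambda>G H \<eta> i. \<lambda>U \<in> {U. openin X U}. restrict (\<eta> U) (grade (fobj G U) i))\<rparr>"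

lemma deg_simps [simp]:
  "fobj (deg_psh R G i) U = deg_part R (fobj G U) i"
  "fmap (deg_psh R G i) U V u = restrict (fmap G U V u) (grade (fobj G U) i)"
  "fobj (deg_seq X R G) = deg_psh R G"
  "fmap (deg_seq X R G) i j v = (\<lambda>U \<in> {U. openin X U}. \<lambda>x \<in> grade (fobj G U) i.
      monom (UP R) \<one>\<^bsub>R\<^esub> (j - i) \<odot>\<^bsub>fobj G U\<^esub> x)"
  "fobj (deg_fctr X R) = deg_seq X R"
  "fmap (deg_fctr X R) G H \<eta> i = (\<lambda>U \<in> {U. openin X U}. restrict (\<eta> U) (grade (fobj G U) i))"
  by (simp_all add: deg_psh_def deg_seq_def deg_fctr_def)

locale gr_presheaf =
  fixes X :: "'x topology" and R :: "('r, 'e) ring_scheme"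
    and G :: "('x set, unit, (nat \<Rightarrow> 'r, 'a) graded_module, 'a \<Rightarrow> 'a) fctr"
  assumes R: "cring R" and presheaf: "is_functor (opens_op X) (grMod_cat R) G"
begin

lemma graded_obj: "openin X U \<Longrightarrow> is_graded_module R (fobj G U)"
  using is_functorD(1)[OF presheaf, of U] by simp

lemma gr_module_obj: "openin X U \<Longrightarrow> gr_module R (fobj G U)"
  using graded_obj R by (simp add: gr_module.intro)

lemma res_gr_hom:
  "\<lbrakk>openin X U; openin X V; V \<subseteq> U\<rbrakk> \<Longrightarrow> fmap G U V u \<in> Mor (grMod_cat R) (fobj G U) (fobj G V)"
  using is_functorD(2)[OF presheaf, of U V u] by simp

lemma res_hom:
  "\<lbrakk>openin X U; openin X V; V \<subseteq> U\<rbrakk> \<Longrightarrow> fmap G U V u \<in> mod_hom (UP R) (fobj G U) (fobj G V)"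
  using res_gr_hom by simp

lemma res_grade:
  assumes "openin X U" "openin X V" "V \<subseteq> U" "x \<in> grade (fobj G U) n"
  shows "fmap G U V u x \<in> grade (fobj G V) n"
  using res_gr_hom[OF assms(1-3), of u] assms(4) by auto

lemma res_gcomp:
  assumes "openin X U" "openin X V" "V \<subseteq> U" "x \<in> carrier (fobj G U)"
  shows "gcomp (fobj G V) (fmap G U V u x) n = fmap G U V u (gcomp (fobj G U) x n)"
  using assms by (intro gr_hom_gcomp[OF R] graded_obj res_gr_hom)

lemma res_comp:
  assumes "openin X U" "openin X V" "openin X W" "V \<subseteq> U" "W \<subseteq> V" "x \<in> carrier (fobj G U)"
  shows "fmap G V W u (fmap G U V v x) = fmap G U W w x"
  using is_functorD(4)[OF presheaf, of U V W v u] assms by (simp add: compose_def)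

lemma res_zero:
  assumes "openin X U" "openin X V" "V \<subseteq> U"
  shows "fmap G U V u \<zero>\<^bsub>fobj G U\<^esub> = \<zero>\<^bsub>fobj G V\<^esub>"
proof -
  interpret U: gr_module R "fobj G U" using assms by (intro gr_module_obj)
  interpret V: gr_module R "fobj G V" using assms by (intro gr_module_obj)
  show ?thesis by (rule mod_hom_zero[OF U.abelian_group_axioms V.abelian_group_axioms res_hom[OF assms]])
qed

lemma functor_deg_psh: "is_functor (opens_op X) (Mod_cat R) (deg_psh R G i)"
proof (rule is_functorI)
  fix U assume "U \<in> Ob (opens_op X)"
  then have U: "openin X U" by simp
  interpret U: gr_module R "fobj G U" using U by (rule gr_module_obj)
  show "fobj (deg_psh R G i) U \<in> Ob (Mod_cat R)" using U.module_deg_part by simp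
  show "fmap (deg_psh R G i) U U (Idn (opens_op X) U) = Idn (Mod_cat R) (fobj (deg_psh R G i) U)"
    using is_functorD(3)[OF presheaf, of U] U U.grade_closed by (auto simp: fun_eq_iff restrict_def)
next
  fix U V u assume "U \<in> Ob (opens_op X)" "V \<in> Ob (opens_op X)" "u \<in> Mor (opens_op X) U V"
  then show "fmap (deg_psh R G i) U V u \<in> Mor (Mod_cat R) (fobj (deg_psh R G i) U) (fobj (deg_psh R G i) V)"
    using restrict_deg_part_hom[OF R graded_obj[of U] res_gr_hom[of U V u], of i] by simp
next
  fix U V W u v assume "U \<in> Ob (opens_op X)" "V \<in> Ob (opens_op X)" "W \<in> Ob (opens_op X)"
    "u \<in> Mor (opens_op X) U V" "v \<in> Mor (opens_op X) V W"
  then have *: "openin X U" "openin X V" "openin X W" "V \<subseteq> U" "W \<subseteq> V" by auto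
  interpret U: gr_module R "fobj G U" using *(1) by (rule gr_module_obj)
  show "fmap (deg_psh R G i) U W (Cmp (opens_op X) U V W v u) =
      Cmp (Mod_cat R) (fobj (deg_psh R G i) U) (fobj (deg_psh R G i) V) (fobj (deg_psh R G i) W)
        (fmap (deg_psh R G i) V W v) (fmap (deg_psh R G i) U V u)"
    using * by (auto simp: fun_eq_iff compose_def res_grade res_comp[of U V W, symmetric] U.grade_closed)
qed

text \<open>What a family of sections has to satisfy is the common degree bound \<open>N\<close>;
  the summands \<open>c n\<close> in the definition of \<open>gr_prod\<close> are recovered as the
  homogeneous components.\<close>

lemma gr_prod_carrier_iff:
  assumes \<V>: "\<forall>V \<in> \<V>. openin X V"
  shows "s \<in> carrier (gr_prod \<V> (fobj G)) \<longleftrightarrow> s \<in> (\<Pi>\<^sub>E V \<in> \<V>. carrier (fobj G V)) \<and>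
    (\<exists>N. \<forall>V \<in> \<V>. \<forall>n > N. gcomp (fobj G V) (s V) n = \<zero>\<^bsub>fobj G V\<^esub>)"
proof
  assume "s \<in> carrier (gr_prod \<V> (fobj G))"
  then obtain c N where s: "s = (\<lambda>V \<in> \<V>. \<Oplus>\<^bsub>fobj G V\<^esub>n \<in> {..N}. c n V)"
    and c: "\<forall>n. c n \<in> (\<Pi>\<^sub>E V \<in> \<V>. grade (fobj G V) n)"
    by (auto simp: gr_prod_def)
  have "s V \<in> carrier (fobj G V) \<and> (\<forall>n > N. gcomp (fobj G V) (s V) n = \<zero>\<^bsub>fobj G V\<^esub>)" if V: "V \<in> \<V>" for V
  proof -
    interpret gr_module R "fobj G V" using \<V> V by (auto intro: gr_module_obj)
    have cV: "c n V \<in> grade (fobj G V) n" for n using c V by auto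
    then show ?thesis
      using V gcomp_finsum_grade[of "\<lambda>n. c n V" "{..N}"] grade_closed[OF cV]
      by (auto simp: s intro!: finsum_closed)
  qed
  then show "s \<in> (\<Pi>\<^sub>E V \<in> \<V>. carrier (fobj G V)) \<and>
    (\<exists>N. \<forall>V \<in> \<V>. \<forall>n > N. gcomp (fobj G V) (s V) n = \<zero>\<^bsub>fobj G V\<^esub>)"
    using s by auto
next
  assume "s \<in> (\<Pi>\<^sub>E V \<in> \<V>. carrier (fobj G V)) \<and>
    (\<exists>N. \<forall>V \<in> \<V>. \<forall>n > N. gcomp (fobj G V) (s V) n = \<zero>\<^bsub>fobj G V\<^esub>)"
  then obtain N where s: "s \<in> (\<Pi>\<^sub>E V \<in> \<V>. carrier (fobj G V))"
    and N: "\<And>V n. V \<in> \<V> \<Longrightarrow> n > N \<Longrightarrow> gcomp (fobj G V) (s V) n = \<zero>\<^bsub>fobj G V\<^esub>" by blast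
  define c where "c n = (\<lambda>V \<in> \<V>. gcomp (fobj G V) (s V) n)" for n
  have *: "gcomp (fobj G V) (s V) n \<in> grade (fobj G V) n"
      "s V = (\<Oplus>\<^bsub>fobj G V\<^esub>n \<in> {..N}. gcomp (fobj G V) (s V) n)" if V: "V \<in> \<V>" for V n
  proof -
    interpret gr_module R "fobj G V" using \<V> V by (auto intro: gr_module_obj)
    have sV: "s V \<in> carrier (fobj G V)" using s V by auto
    show "gcomp (fobj G V) (s V) n \<in> grade (fobj G V) n" by (rule gcomp_in[OF sV])
    show "s V = (\<Oplus>\<^bsub>fobj G V\<^esub>n \<in> {..N}. gcomp (fobj G V) (s V) n)"
      using N[OF V] by (intro gcomp_finsum_superset[OF sV]) (auto simp: not_le[symmetric])
  qed
  have "s = (\<lambda>V \<in> \<V>. \<Oplus>\<^bsub>fobj G V\<^esub>n \<in> {..N}. c n V)"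
  proof (rule extensionalityI[of _ \<V>])
    show "s V = (\<lambda>V \<in> \<V>. \<Oplus>\<^bsub>fobj G V\<^esub>n \<in> {..N}. c n V) V" if "V \<in> \<V>" for V
      using *(2)[OF that] that by (simp add: c_def)
  qed (use s in \<open>auto simp: PiE_iff\<close>)
  moreover have "\<forall>n. c n \<in> (\<Pi>\<^sub>E V \<in> \<V>. grade (fobj G V) n)"
    using *(1) by (auto simp: c_def)
  ultimately show "s \<in> carrier (gr_prod \<V> (fobj G))" unfolding gr_prod_def by auto
qed

text \<open>Restriction preserves degrees, so a degree bound for a section holds for all its
  restrictions; hence the restrictions form an element of \<open>gr_prod\<close>.\<close>

lemma is_sheaf_iff:
  "is_sheaf X (grMod_cat R) gr_prod G \<longleftrightarrow> (\<forall>\<V>. (\<forall>V \<in> \<V>. openin X V) \<longrightarrow>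
    glues \<V> (carrier (gr_prod \<V> (fobj G))) (carrier (fobj G (\<Union>\<V>))) (\<lambda>U V. fmap G U V ()))"
proof (rule is_sheaf_glues_iff[OF presheaf res_comp])
  show "carrier (gr_prod \<V> (fobj G)) \<subseteq> extensional \<V>" for \<V> by (auto simp: gr_prod_def)
  fix \<V> x assume \<V>: "\<forall>V \<in> \<V>. openin X V" and x: "x \<in> carrier (fobj G (\<Union>\<V>))"
  then have U: "openin X (\<Union>\<V>)" and op: "\<And>V. V \<in> \<V> \<Longrightarrow> openin X V" by auto
  interpret U: gr_module R "fobj G (\<Union>\<V>)" using U by (rule gr_module_obj)
  obtain N where "\<And>n. n > N \<Longrightarrow> gcomp (fobj G (\<Union>\<V>)) x n = \<zero>\<^bsub>fobj G (\<Union>\<V>)\<^esub>"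
    using U.gcomp_boundE[OF x] by blast
  then have "\<forall>V \<in> \<V>. \<forall>n > N. gcomp (fobj G V) (fmap G (\<Union>\<V>) V () x) n = \<zero>\<^bsub>fobj G V\<^esub>"
    using U op x by (auto simp: res_gcomp Union_upper intro!: res_zero)
  then show "(\<lambda>V \<in> \<V>. fmap G (\<Union>\<V>) V () x) \<in> carrier (gr_prod \<V> (fobj G))"
    using U op x by (auto simp: gr_prod_carrier_iff intro!: mod_homD(1)[OF res_hom])
qed auto

text \<open>A family of sections of one degree is bounded and can be glued in \<open>G\<close>;
  conversely a bounded family is glued in each degree and the results are added. Separatedness
  passes both ways since restriction commutes with \<open>gcomp\<close>.\<close>

theorem is_sheaf_iff_deg:
  "is_sheaf X (grMod_cat R) gr_prod G \<longleftrightarrow> (\<forall>i. is_sheaf X (Mod_cat R) mod_prod (deg_psh R G i))"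
proof -
  interpret deg: mod_presheaf X R "deg_psh R G i" for i
    using functor_deg_psh by unfold_locales
  have main: "glues \<V> (carrier (gr_prod \<V> (fobj G))) (carrier (fobj G (\<Union>\<V>))) (\<lambda>U V. fmap G U V ()) \<longleftrightarrow>
      (\<forall>i. glues \<V> (\<Pi>\<^sub>E V \<in> \<V>. grade (fobj G V) i) (grade (fobj G (\<Union>\<V>)) i)
        (\<lambda>U V. restrict (fmap G U V ()) (grade (fobj G U) i)))"
    (is "?gr \<longleftrightarrow> (\<forall>i. ?deg i)") if \<V>: "\<forall>V \<in> \<V>. openin X V" for \<V>
  proof
    have U: "openin X (\<Union>\<V>)" using \<V> by auto
    have op: "openin X V" "V \<subseteq> \<Union>\<V>" if "V \<in> \<V>" for V using that \<V> by auto
    interpret U: gr_module R "fobj G (\<Union>\<V>)" using U by (rule gr_module_obj)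
    note gm = gr_module_obj[OF op(1)]
    {
      assume gr: ?gr
      show "\<forall>i. ?deg i"
        unfolding glues_def
      proof (intro allI conjI ballI impI)
        fix i x y assume x: "x \<in> grade (fobj G (\<Union>\<V>)) i" and y: "y \<in> grade (fobj G (\<Union>\<V>)) i"
          and eq: "\<forall>V \<in> \<V>. restrict (fmap G (\<Union>\<V>) V ()) (grade (fobj G (\<Union>\<V>)) i) x =
            restrict (fmap G (\<Union>\<V>) V ()) (grade (fobj G (\<Union>\<V>)) i) y"
        show "x = y"
          by (rule glues_separatedD[OF gr U.grade_closed[OF x] U.grade_closed[OF y]]) (use eq x y in simp)
      next
        fix i s assume s: "s \<in> (\<Pi>\<^sub>E V \<in> \<V>. grade (fobj G V) i)"
          and comp: "compatible \<V> (\<lambda>U V. restrict (fmap G U V ()) (grade (fobj G U) i)) s"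
        have sV: "s V \<in> grade (fobj G V) i" if "V \<in> \<V>" for V using s that by auto
        have "s \<in> carrier (gr_prod \<V> (fobj G))"
          unfolding gr_prod_carrier_iff[OF \<V>]
          using s sV gr_module.grade_closed[OF gm sV] gr_module.gcomp_homogeneous[OF gm sV]
          by (auto simp: PiE_iff intro!: exI[of _ i])
        moreover have "compatible \<V> (\<lambda>U V. fmap G U V ()) s"
          using comp sV by (simp add: compatible_def)
        ultimately obtain x where x: "x \<in> carrier (fobj G (\<Union>\<V>))"
            and xV: "\<And>V. V \<in> \<V> \<Longrightarrow> fmap G (\<Union>\<V>) V () x = s V"
          using glues_glueE[OF gr] by blast
        \<comment> \<open>The glued section is homogeneous: its components of degree other than
          \<open>i\<close> restrict to components of the \<open>s V\<close> that vanish, so they are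
          zero by separatedness.\<close>
        have "gcomp (fobj G (\<Union>\<V>)) x i = x"
        proof (rule U.gcomp_ext[OF U.gcomp_closed[OF x] x])
          fix n
          have "gcomp (fobj G (\<Union>\<V>)) x n = \<zero>\<^bsub>fobj G (\<Union>\<V>)\<^esub>" if n: "n \<noteq> i"
          proof (rule glues_separatedD[OF gr])
            fix V assume V: "V \<in> \<V>"
            have "fmap G (\<Union>\<V>) V () (gcomp (fobj G (\<Union>\<V>)) x n) = gcomp (fobj G V) (s V) n"
              using res_gcomp[OF U op[OF V] x] xV[OF V] by simp
            also have "\<dots> = \<zero>\<^bsub>fobj G V\<^esub>"
              using gr_module.gcomp_homogeneous[OF gm[OF V] sV[OF V]] n by simp
            finally show "fmap G (\<Union>\<V>) V () (gcomp (fobj G (\<Union>\<V>)) x n) =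
                fmap G (\<Union>\<V>) V () \<zero>\<^bsub>fobj G (\<Union>\<V>)\<^esub>"
              using res_zero[OF U op[OF V]] by simp
          qed (use x U.gcomp_closed in auto)
          then show "gcomp (fobj G (\<Union>\<V>)) (gcomp (fobj G (\<Union>\<V>)) x i) n = gcomp (fobj G (\<Union>\<V>)) x n"
            by (auto simp: U.gcomp_homogeneous[OF U.gcomp_in[OF x]])
        qed
        then have xi: "x \<in> grade (fobj G (\<Union>\<V>)) i" using U.gcomp_in[OF x, of i] by simp
        with xV show "\<exists>x \<in> grade (fobj G (\<Union>\<V>)) i. \<forall>V \<in> \<V>.
            restrict (fmap G (\<Union>\<V>) V ()) (grade (fobj G (\<Union>\<V>)) i) x = s V"
          by (intro bexI[of _ x]) auto
      qed
    next
      assume deg: "\<forall>i. ?deg i"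
      show ?gr
        unfolding glues_def
      proof (intro allI conjI ballI impI)
        fix x y assume x: "x \<in> carrier (fobj G (\<Union>\<V>))" and y: "y \<in> carrier (fobj G (\<Union>\<V>))"
          and eq: "\<forall>V \<in> \<V>. fmap G (\<Union>\<V>) V () x = fmap G (\<Union>\<V>) V () y"
        show "x = y"
        proof (rule U.gcomp_ext[OF x y])
          fix n
          show "gcomp (fobj G (\<Union>\<V>)) x n = gcomp (fobj G (\<Union>\<V>)) y n"
            by (rule glues_separatedD[OF deg[rule_format, of n] U.gcomp_in[OF x] U.gcomp_in[OF y]])
              (use eq x y in \<open>simp add: U.gcomp_in res_gcomp[OF U op, symmetric]\<close>)
        qed
      next
        fix s assume s: "s \<in> carrier (gr_prod \<V> (fobj G))" and comp: "compatible \<V> (\<lambda>U V. fmap G U V ()) s"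
        obtain N where sE: "s \<in> (\<Pi>\<^sub>E V \<in> \<V>. carrier (fobj G V))"
          and N: "\<And>V n. V \<in> \<V> \<Longrightarrow> n > N \<Longrightarrow> gcomp (fobj G V) (s V) n = \<zero>\<^bsub>fobj G V\<^esub>"
          using s unfolding gr_prod_carrier_iff[OF \<V>] by blast
        have sV: "s V \<in> carrier (fobj G V)" if "V \<in> \<V>" for V using sE that by auto
        \<comment> \<open>The components of degree \<open>n\<close> of a compatible family are again
          compatible, since restrictions commute with taking components.\<close>
        have "\<exists>x \<in> grade (fobj G (\<Union>\<V>)) n. \<forall>V \<in> \<V>. fmap G (\<Union>\<V>) V () x = gcomp (fobj G V) (s V) n" for n
        proof -
          let ?t = "\<lambda>V \<in> \<V>. gcomp (fobj G V) (s V) n"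
          have t: "?t \<in> (\<Pi>\<^sub>E V \<in> \<V>. grade (fobj G V) n)"
            using gr_module.gcomp_in[OF gm sV] by simp
          have "fmap G V (V \<inter> W) () (gcomp (fobj G V) (s V) n) = fmap G W (V \<inter> W) () (gcomp (fobj G W) (s W) n)"
            if V: "V \<in> \<V>" and W: "W \<in> \<V>" for V W
            using comp[unfolded compatible_def, rule_format, OF V W] op[OF V] op[OF W]
            by (simp add: res_gcomp[symmetric] sV V W openin_Int)
          note eq = this
          have "compatible \<V> (\<lambda>U V. restrict (fmap G U V ()) (grade (fobj G U) n)) ?t"
            unfolding compatible_def
          proof (intro ballI)
            fix V W assume "V \<in> \<V>" "W \<in> \<V>"
            then show "restrict (fmap G V (V \<inter> W) ()) (grade (fobj G V) n) (?t V) =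
                restrict (fmap G W (V \<inter> W) ()) (grade (fobj G W) n) (?t W)"
              using eq[of V W] gr_module.gcomp_in[OF gm sV] by simp
          qed
          from deg[rule_format, of n] t this obtain x where x: "x \<in> grade (fobj G (\<Union>\<V>)) n"
            "\<And>V. V \<in> \<V> \<Longrightarrow> restrict (fmap G (\<Union>\<V>) V ()) (grade (fobj G (\<Union>\<V>)) n) x = ?t V"
            by (rule glues_glueE) (rule that)
          then show ?thesis by (intro bexI[of _ x]) auto
        qed
        then obtain c where c: "\<And>n. c n \<in> grade (fobj G (\<Union>\<V>)) n"
          and cV: "\<And>n V. V \<in> \<V> \<Longrightarrow> fmap G (\<Union>\<V>) V () (c n) = gcomp (fobj G V) (s V) n"
          by metis
        \<comment> \<open>\<open>N\<close> bounds the degrees over all members of the cover at once,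
          so that a finite sum suffices.\<close>
        define x where "x = (\<Oplus>\<^bsub>fobj G (\<Union>\<V>)\<^esub>n \<in> {..N}. c n)"
        have x: "x \<in> carrier (fobj G (\<Union>\<V>))"
          unfolding x_def using U.grade_closed[OF c] by (intro U.finsum_closed) auto
        have "fmap G (\<Union>\<V>) V () x = s V" if V: "V \<in> \<V>" for V
        proof -
          interpret V: gr_module R "fobj G V" by (rule gm[OF V])
          show ?thesis
          proof (rule V.gcomp_ext)
            show "gcomp (fobj G V) (fmap G (\<Union>\<V>) V () x) n = gcomp (fobj G V) (s V) n" for n
              unfolding res_gcomp[OF U op[OF V] x]
              using N[OF V, of n] cV[OF V] res_zero[OF U op[OF V]]
              by (auto simp: x_def U.gcomp_finsum_grade[OF c])
          qed (use V sV in \<open>auto intro!: mod_homD(1)[OF res_hom[OF U op[OF V]]] x\<close>)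
        qed
        with x show "\<exists>x \<in> carrier (fobj G (\<Union>\<V>)). \<forall>V \<in> \<V>. fmap G (\<Union>\<V>) V () x = s V" by blast
      qed
    }
  qed
  show ?thesis
    unfolding is_sheaf_iff deg.is_sheaf_iff deg_simps deg_part_simps using main by blast
qed

end

section \<open>The degree functor between the sheaf categories\<close>

lemma category_Shv_Mod: "category (Shv_Mod X R)"
  unfolding Shv_Mod_def by (intro category_full_subcat category_Fun_cat category_Mod_cat)

lemma category_Shv_grMod: "category (Shv_grMod X R)"
  unfolding Shv_grMod_def by (intro category_full_subcat category_Fun_cat category_grMod_cat)

lemma Shv_Mod_simps [simp]:
  "Ob (Shv_Mod X R) = {F. is_functor (opens_op X) (Mod_cat R) F \<and> is_sheaf X (Mod_cat R) mod_prod F}"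
  "Mor (Shv_Mod X R) F G = nat_trans (opens_op X) (Mod_cat R) F G"
  "Idn (Shv_Mod X R) = Idn (Fun_cat (opens_op X) (Mod_cat R))"
  "Cmp (Shv_Mod X R) = Cmp (Fun_cat (opens_op X) (Mod_cat R))"
  by (simp_all add: Shv_Mod_def)

lemma Shv_grMod_simps [simp]:
  "Ob (Shv_grMod X R) = {G. is_functor (opens_op X) (grMod_cat R) G \<and> is_sheaf X (grMod_cat R) gr_prod G}"
  "Mor (Shv_grMod X R) G H = nat_trans (opens_op X) (grMod_cat R) G H"
  "Idn (Shv_grMod X R) = Idn (Fun_cat (opens_op X) (grMod_cat R))"
  "Cmp (Shv_grMod X R) = Cmp (Fun_cat (opens_op X) (grMod_cat R))"
  by (simp_all add: Shv_grMod_def)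

text \<open>Naturality in the open set is linearity of the restrictions over \<open>R[t]\<close>;
  functoriality in the degree is the law of exponents for t.\<close>

lemma (in gr_presheaf) functor_deg_seq:
  assumes "is_sheaf X (grMod_cat R) gr_prod G"
  shows "is_functor nat_cat (Shv_Mod X R) (deg_seq X R G)"
proof (rule is_functorI)
  fix i
  show "fobj (deg_seq X R G) i \<in> Ob (Shv_Mod X R)"
    using assms functor_deg_psh is_sheaf_iff_deg by simp
next
  fix i j f assume "f \<in> Mor nat_cat i j"
  then have ij: "i \<le> j" by simp
  show "fmap (deg_seq X R G) i j f \<in> Mor (Shv_Mod X R) (fobj (deg_seq X R G) i) (fobj (deg_seq X R G) j)"
    unfolding Shv_Mod_simps deg_simps
  proof (rule nat_transI)
    fix U assume "U \<in> Ob (opens_op X)"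
    then show "(\<lambda>U \<in> {U. openin X U}. \<lambda>x \<in> grade (fobj G U) i. monom (UP R) \<one>\<^bsub>R\<^esub> (j - i) \<odot>\<^bsub>fobj G U\<^esub> x) U
        \<in> Mor (Mod_cat R) (fobj (deg_psh R G i) U) (fobj (deg_psh R G j) U)"
      using gr_module.shift_hom[OF gr_module_obj ij, of U] by simp
  next
    fix U V u assume "U \<in> Ob (opens_op X)" "V \<in> Ob (opens_op X)" "u \<in> Mor (opens_op X) U V"
    then have *: "openin X U" "openin X V" "V \<subseteq> U" by auto
    interpret U: gr_module R "fobj G U" using *(1) by (rule gr_module_obj)
    have "monom (UP R) \<one>\<^bsub>R\<^esub> (j - i) \<odot>\<^bsub>fobj G U\<^esub> x \<in> grade (fobj G U) j" if "x \<in> grade (fobj G U) i" for x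
      using U.grade_smult[of "\<one>\<^bsub>R\<^esub>" x i "j - i"] that ij by simp
    then show "Cmp (Mod_cat R) (fobj (deg_psh R G i) U) (fobj (deg_psh R G i) V) (fobj (deg_psh R G j) V)
        ((\<lambda>U \<in> {U. openin X U}. \<lambda>x \<in> grade (fobj G U) i. monom (UP R) \<one>\<^bsub>R\<^esub> (j - i) \<odot>\<^bsub>fobj G U\<^esub> x) V)
        (fmap (deg_psh R G i) U V u) =
      Cmp (Mod_cat R) (fobj (deg_psh R G i) U) (fobj (deg_psh R G j) U) (fobj (deg_psh R G j) V)
        (fmap (deg_psh R G j) U V u)
        ((\<lambda>U \<in> {U. openin X U}. \<lambda>x \<in> grade (fobj G U) i. monom (UP R) \<one>\<^bsub>R\<^esub> (j - i) \<odot>\<^bsub>fobj G U\<^esub> x) U)"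
      using * by (auto simp: fun_eq_iff compose_def res_grade U.grade_closed mod_homD(3)[OF res_hom])
  qed simp
next
  fix i
  show "fmap (deg_seq X R G) i i (Idn nat_cat i) = Idn (Shv_Mod X R) (fobj (deg_seq X R G) i)"
  proof -
    have "monom (UP R) \<one>\<^bsub>R\<^esub> 0 \<odot>\<^bsub>fobj G U\<^esub> x = x" if U: "openin X U" and x: "x \<in> grade (fobj G U) i" for U x
    proof -
      interpret U: gr_module R "fobj G U" using U by (rule gr_module_obj)
      show ?thesis using x by (simp add: U.grade_closed)
    qed
    then show ?thesis by (auto simp: fun_eq_iff restrict_def)
  qed
next
  fix i j k f g assume "f \<in> Mor nat_cat i j" "g \<in> Mor nat_cat j k"
  then have ij: "i \<le> j" "j \<le> k" by auto
  have "monom (UP R) \<one>\<^bsub>R\<^esub> (j - i) \<odot>\<^bsub>fobj G U\<^esub> x \<in> grade (fobj G U) j \<and>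
      monom (UP R) \<one>\<^bsub>R\<^esub> (k - i) \<odot>\<^bsub>fobj G U\<^esub> x =
      monom (UP R) \<one>\<^bsub>R\<^esub> (k - j) \<odot>\<^bsub>fobj G U\<^esub> (monom (UP R) \<one>\<^bsub>R\<^esub> (j - i) \<odot>\<^bsub>fobj G U\<^esub> x)"
    if U: "openin X U" and x: "x \<in> grade (fobj G U) i" for U x
  proof -
    interpret U: gr_module R "fobj G U" using U by (rule gr_module_obj)
    show ?thesis
      using x ij U.grade_smult[of "\<one>\<^bsub>R\<^esub>" x i "j - i"] by (simp add: U.grade_closed U.monom_smult_monom)
  qed
  then show "fmap (deg_seq X R G) i k (Cmp nat_cat i j k g f) =
      Cmp (Shv_Mod X R) (fobj (deg_seq X R G) i) (fobj (deg_seq X R G) j) (fobj (deg_seq X R G) k)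
        (fmap (deg_seq X R G) j k g) (fmap (deg_seq X R G) i j f)"
    by (auto simp: fun_eq_iff compose_def)
qed

lemma Shv_grMod_presheaf:
  "cring R \<Longrightarrow> G \<in> Ob (Shv_grMod X R) \<Longrightarrow> gr_presheaf X R G"
  by (simp add: gr_presheaf_def)

text \<open>A morphism \<eta> is cut down to each degree. The result is natural in the degree
  because \<open>\<eta> U\<close> commutes with powers of t, and natural in the open set because
  \<eta> is.\<close>

lemma functor_deg_fctr:
  assumes R: "cring R"
  shows "is_functor (Shv_grMod X R) (Fun_cat nat_cat (Shv_Mod X R)) (deg_fctr X R)"
proof (rule is_functorI)
  fix G assume G: "G \<in> Ob (Shv_grMod X R)"
  interpret gr_presheaf X R G using R G by (rule Shv_grMod_presheaf)
  show "fobj (deg_fctr X R) G \<in> Ob (Fun_cat nat_cat (Shv_Mod X R))"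
    using functor_deg_seq G by simp
  have "restrict (\<lambda>x \<in> carrier (fobj G U). x) (grade (fobj G U) i) = (\<lambda>x \<in> grade (fobj G U) i. x)"
    if U: "openin X U" for i U
    using gr_module.grade_closed[OF gr_module_obj[OF U]] by (auto simp: fun_eq_iff restrict_def)
  then show "fmap (deg_fctr X R) G G (Idn (Shv_grMod X R) G) =
      Idn (Fun_cat nat_cat (Shv_Mod X R)) (fobj (deg_fctr X R) G)"
    by (auto simp: fun_eq_iff restrict_def)
next
  fix G H \<eta> assume G: "G \<in> Ob (Shv_grMod X R)" and H: "H \<in> Ob (Shv_grMod X R)"
    and "\<eta> \<in> Mor (Shv_grMod X R) G H"
  then have \<eta>: "\<eta> \<in> nat_trans (opens_op X) (grMod_cat R) G H" by simp
  interpret G: gr_presheaf X R G using R G by (rule Shv_grMod_presheaf)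
  interpret H: gr_presheaf X R H using R H by (rule Shv_grMod_presheaf)
  have \<eta>_hom: "\<eta> U \<in> Mor (grMod_cat R) (fobj G U) (fobj H U)" if "openin X U" for U
    using nat_transD(1)[OF \<eta>, of U] that by simp
  have \<eta>_grade: "\<eta> U x \<in> grade (fobj H U) i" if "openin X U" "x \<in> grade (fobj G U) i" for U x i
    using \<eta>_hom[OF that(1)] that(2) by auto
  have nat: "\<eta> V (fmap G U V u x) = fmap H U V u (\<eta> U x)"
    if "openin X U" "openin X V" "V \<subseteq> U" "x \<in> carrier (fobj G U)" for U V u x
    using nat_transD(3)[OF \<eta>, of U V u] that by (auto simp: compose_def dest!: fun_cong[of _ _ x])
  have gc: "x \<in> carrier (fobj G U)" if "openin X U" "x \<in> grade (fobj G U) i" for U x i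
    using gr_module.grade_closed[OF G.gr_module_obj that(2)] that(1) by simp
  show "fmap (deg_fctr X R) G H \<eta> \<in>
      Mor (Fun_cat nat_cat (Shv_Mod X R)) (fobj (deg_fctr X R) G) (fobj (deg_fctr X R) H)"
    unfolding Fun_cat_simps
  proof (rule nat_transI)
    fix i
    have "(\<lambda>U \<in> {U. openin X U}. restrict (\<eta> U) (grade (fobj G U) i))
        \<in> nat_trans (opens_op X) (Mod_cat R) (deg_psh R G i) (deg_psh R H i)"
    proof (rule nat_transI)
      fix U assume "U \<in> Ob (opens_op X)"
      then show "(\<lambda>U \<in> {U. openin X U}. restrict (\<eta> U) (grade (fobj G U) i)) U
          \<in> Mor (Mod_cat R) (fobj (deg_psh R G i) U) (fobj (deg_psh R H i) U)"
        using restrict_deg_part_hom[OF R G.graded_obj[of U] \<eta>_hom[of U], of i] by simp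
    next
      fix U V u assume "U \<in> Ob (opens_op X)" "V \<in> Ob (opens_op X)" "u \<in> Mor (opens_op X) U V"
      then have *: "openin X U" "openin X V" "V \<subseteq> U" by auto
      then show "Cmp (Mod_cat R) (fobj (deg_psh R G i) U) (fobj (deg_psh R G i) V) (fobj (deg_psh R H i) V)
          ((\<lambda>U \<in> {U. openin X U}. restrict (\<eta> U) (grade (fobj G U) i)) V) (fmap (deg_psh R G i) U V u) =
        Cmp (Mod_cat R) (fobj (deg_psh R G i) U) (fobj (deg_psh R H i) U) (fobj (deg_psh R H i) V)
          (fmap (deg_psh R H i) U V u) ((\<lambda>U \<in> {U. openin X U}. restrict (\<eta> U) (grade (fobj G U) i)) U)"
        using gc[OF *(1)] by (auto simp: fun_eq_iff compose_def G.res_grade \<eta>_grade nat)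
    qed simp
    then show "fmap (deg_fctr X R) G H \<eta> i \<in>
        Mor (Shv_Mod X R) (fobj (fobj (deg_fctr X R) G) i) (fobj (fobj (deg_fctr X R) H) i)"
      by simp
  next
    fix i j f assume "f \<in> Mor nat_cat i j"
    then have ij: "i \<le> j" by simp
    have "\<eta> U (monom (UP R) \<one>\<^bsub>R\<^esub> (j - i) \<odot>\<^bsub>fobj G U\<^esub> x) = monom (UP R) \<one>\<^bsub>R\<^esub> (j - i) \<odot>\<^bsub>fobj H U\<^esub> \<eta> U x \<and>
        monom (UP R) \<one>\<^bsub>R\<^esub> (j - i) \<odot>\<^bsub>fobj G U\<^esub> x \<in> grade (fobj G U) j"
      if U: "openin X U" and x: "x \<in> grade (fobj G U) i" for U x
    proof -
      interpret U: gr_module R "fobj G U" using U by (rule G.gr_module_obj)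
      have "\<eta> U \<in> mod_hom (UP R) (fobj G U) (fobj H U)" using \<eta>_hom[OF U] by simp
      then show ?thesis
        using x ij U.grade_smult[of "\<one>\<^bsub>R\<^esub>" x i "j - i"] by (simp add: mod_homD U.grade_closed)
    qed
    then show "Cmp (Shv_Mod X R) (fobj (fobj (deg_fctr X R) G) i) (fobj (fobj (deg_fctr X R) G) j)
        (fobj (fobj (deg_fctr X R) H) j) (fmap (deg_fctr X R) G H \<eta> j) (fmap (fobj (deg_fctr X R) G) i j f) =
      Cmp (Shv_Mod X R) (fobj (fobj (deg_fctr X R) G) i) (fobj (fobj (deg_fctr X R) H) i)
        (fobj (fobj (deg_fctr X R) H) j) (fmap (fobj (deg_fctr X R) H) i j f) (fmap (deg_fctr X R) G H \<eta> i)"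
      using \<eta>_grade by (auto simp: fun_eq_iff compose_def)
  qed simp
next
  fix G H K \<eta> \<theta> assume G: "G \<in> Ob (Shv_grMod X R)" and H: "H \<in> Ob (Shv_grMod X R)"
    and \<eta>: "\<eta> \<in> Mor (Shv_grMod X R) G H"
  interpret G: gr_presheaf X R G using R G by (rule Shv_grMod_presheaf)
  have \<eta>_grade: "\<eta> U x \<in> grade (fobj H U) i" if "openin X U" "x \<in> grade (fobj G U) i" for U x i
    using nat_transD(1)[of \<eta> "opens_op X" "grMod_cat R" G H U] \<eta> that by auto
  have gc: "x \<in> carrier (fobj G U)" if "openin X U" "x \<in> grade (fobj G U) i" for U x i
    using gr_module.grade_closed[OF G.gr_module_obj that(2)] that(1) by simp
  show "fmap (deg_fctr X R) G K (Cmp (Shv_grMod X R) G H K \<theta> \<eta>) =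
      Cmp (Fun_cat nat_cat (Shv_Mod X R)) (fobj (deg_fctr X R) G) (fobj (deg_fctr X R) H)
        (fobj (deg_fctr X R) K) (fmap (deg_fctr X R) H K \<theta>) (fmap (deg_fctr X R) G H \<eta>)"
    using \<eta>_grade gc by (auto simp: fun_eq_iff compose_def)
qed

section \<open>Full faithfulness of the degree functor\<close>

lemma deg_fctr_faithful:
  assumes R: "cring R" and G: "G \<in> Ob (Shv_grMod X R)" and H: "H \<in> Ob (Shv_grMod X R)"
    and \<eta>: "\<eta> \<in> Mor (Shv_grMod X R) G H" and \<theta>: "\<theta> \<in> Mor (Shv_grMod X R) G H"
    and eq: "fmap (deg_fctr X R) G H \<eta> = fmap (deg_fctr X R) G H \<theta>"
  shows "\<eta> = \<theta>"
proof (rule extensionalityI[of _ "{U. openin X U}"])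
  interpret G: gr_presheaf X R G using R G by (rule Shv_grMod_presheaf)
  interpret H: gr_presheaf X R H using R H by (rule Shv_grMod_presheaf)
  have nt: "\<eta> \<in> nat_trans (opens_op X) (grMod_cat R) G H" "\<theta> \<in> nat_trans (opens_op X) (grMod_cat R) G H"
    using \<eta> \<theta> by simp_all
  show "\<eta> \<in> extensional {U. openin X U}" "\<theta> \<in> extensional {U. openin X U}"
    using nt[THEN nat_transD(2)] by simp_all
  fix U assume "U \<in> {U. openin X U}"
  then have U: "openin X U" by simp
  show "\<eta> U = \<theta> U"
  proof (rule gr_hom_eqI[OF R G.graded_obj[OF U] H.graded_obj[OF U]])
    show "\<eta> U \<in> Mor (grMod_cat R) (fobj G U) (fobj H U)" "\<theta> U \<in> Mor (grMod_cat R) (fobj G U) (fobj H U)"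
      using nt[THEN nat_transD(1), of U] U by simp_all
    show "\<eta> U x = \<theta> U x" if "x \<in> grade (fobj G U) n" for n x
      using fun_cong[OF fun_cong[OF fun_cong[OF eq, of n], of U], of x] U that by simp
  qed
qed

text \<open>The family \<open>h\<close> is natural in two directions. Over the degrees this means
  commuting with powers of t, so that \<open>gr_hom_extend\<close> assembles the maps over
  \<open>U\<close>; over the open sets it makes the assembled maps natural.\<close>

lemma deg_fctr_full:
  assumes R: "cring R" and G: "G \<in> Ob (Shv_grMod X R)" and H: "H \<in> Ob (Shv_grMod X R)"
    and "h \<in> Mor (Fun_cat nat_cat (Shv_Mod X R)) (fobj (deg_fctr X R) G) (fobj (deg_fctr X R) H)"
  shows "\<exists>\<eta> \<in> Mor (Shv_grMod X R) G H. fmap (deg_fctr X R) G H \<eta> = h"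
proof -
  interpret G: gr_presheaf X R G using R G by (rule Shv_grMod_presheaf)
  interpret H: gr_presheaf X R H using R H by (rule Shv_grMod_presheaf)
  have h: "h \<in> nat_trans nat_cat (Shv_Mod X R) (deg_seq X R G) (deg_seq X R H)" using assms(4) by simp
  have hi: "h i \<in> nat_trans (opens_op X) (Mod_cat R) (deg_psh R G i) (deg_psh R H i)" for i
    using nat_transD(1)[OF h, of i] by simp
  have h_hom: "h i U \<in> mod_hom R (deg_part R (fobj G U) i) (deg_part R (fobj H U) i)" if "openin X U" for i U
    using nat_transD(1)[OF hi, of U i] that by simp
  have h_grade: "h i U x \<in> grade (fobj H U) i" if "openin X U" "x \<in> grade (fobj G U) i" for i U x
    using mod_homD(1)[OF h_hom[OF that(1)], of x i] that(2) by simp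
  have h_nat: "h i V (fmap G U V u x) = fmap H U V u (h i U x)"
    if "openin X U" "openin X V" "V \<subseteq> U" "x \<in> grade (fobj G U) i" for i U V u x
    using nat_transD(3)[OF hi, of U V u i] that
    by (auto simp: compose_def h_grade dest!: fun_cong[of _ _ x])
  have h_shift: "h (k + n) U (monom (UP R) \<one>\<^bsub>R\<^esub> k \<odot>\<^bsub>fobj G U\<^esub> x) = monom (UP R) \<one>\<^bsub>R\<^esub> k \<odot>\<^bsub>fobj H U\<^esub> h n U x"
    if "openin X U" "x \<in> grade (fobj G U) n" for U x k n
  proof -
    have "Cmp (Shv_Mod X R) (deg_psh R G n) (deg_psh R G (k + n)) (deg_psh R H (k + n)) (h (k + n))
         (fmap (deg_seq X R G) n (k + n) ()) =
        Cmp (Shv_Mod X R) (deg_psh R G n) (deg_psh R H n) (deg_psh R H (k + n))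
         (fmap (deg_seq X R H) n (k + n) ()) (h n)"
      using nat_transD(3)[OF h, of n "k + n" "()"] by simp
    from fun_cong[OF fun_cong[OF this, of U], of x] show ?thesis
      using that h_grade by (simp add: compose_def)
  qed
  have "\<exists>f \<in> Mor (grMod_cat R) (fobj G U) (fobj H U). \<forall>n. \<forall>x \<in> grade (fobj G U) n. f x = h n U x"
    if U: "openin X U" for U
    by (rule gr_hom_extend[OF R G.graded_obj[OF U] H.graded_obj[OF U] h_hom[OF U] h_shift[OF U]])
  then obtain \<eta> where \<eta>: "\<And>U. openin X U \<Longrightarrow> \<eta> U \<in> Mor (grMod_cat R) (fobj G U) (fobj H U)"
    and \<eta>_eq: "\<And>U n x. openin X U \<Longrightarrow> x \<in> grade (fobj G U) n \<Longrightarrow> \<eta> U x = h n U x"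
    by metis
  interpret Gr: category "grMod_cat R" by (rule category_grMod_cat)
  have "restrict \<eta> {U. openin X U} \<in> nat_trans (opens_op X) (grMod_cat R) G H"
  proof (rule nat_transI)
    fix U V u assume "U \<in> Ob (opens_op X)" "V \<in> Ob (opens_op X)" "u \<in> Mor (opens_op X) U V"
    then have *: "openin X U" "openin X V" "V \<subseteq> U" by auto
    interpret U: gr_module R "fobj G U" using *(1) by (rule G.gr_module_obj)
    \<comment> \<open>Both composites are graded homomorphisms, so they are compared on homogeneous
      elements, where \<eta> is given by \<open>h\<close>.\<close>
    have "Cmp (grMod_cat R) (fobj G U) (fobj G V) (fobj H V) (\<eta> V) (fmap G U V u) =
        Cmp (grMod_cat R) (fobj G U) (fobj H U) (fobj H V) (fmap H U V u) (\<eta> U)"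
    proof (rule gr_hom_eqI[OF R G.graded_obj[OF *(1)] H.graded_obj[OF *(2)]])
      show "Cmp (grMod_cat R) (fobj G U) (fobj G V) (fobj H V) (\<eta> V) (fmap G U V u)
          \<in> Mor (grMod_cat R) (fobj G U) (fobj H V)"
        using * G.graded_obj H.graded_obj
        by (intro Gr.Cmp_in \<eta> G.res_gr_hom) (simp_all only: grMod_cat_simps mem_Collect_eq)
      show "Cmp (grMod_cat R) (fobj G U) (fobj H U) (fobj H V) (fmap H U V u) (\<eta> U)
          \<in> Mor (grMod_cat R) (fobj G U) (fobj H V)"
        using * G.graded_obj H.graded_obj
        by (intro Gr.Cmp_in \<eta> H.res_gr_hom) (simp_all only: grMod_cat_simps mem_Collect_eq)
      show "Cmp (grMod_cat R) (fobj G U) (fobj G V) (fobj H V) (\<eta> V) (fmap G U V u) x =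
          Cmp (grMod_cat R) (fobj G U) (fobj H U) (fobj H V) (fmap H U V u) (\<eta> U) x"
        if x: "x \<in> grade (fobj G U) n" for n x
        using * x by (simp add: compose_def U.grade_closed \<eta>_eq[OF _ x]
            \<eta>_eq[OF _ G.res_grade[OF * x]] h_nat)
    qed
    with * show "Cmp (grMod_cat R) (fobj G U) (fobj G V) (fobj H V) (restrict \<eta> {U. openin X U} V) (fmap G U V u) =
        Cmp (grMod_cat R) (fobj G U) (fobj H U) (fobj H V) (fmap H U V u) (restrict \<eta> {U. openin X U} U)"
      by simp
  qed (use \<eta> in auto)
  \<comment> \<open>Off the open sets, and outside the part of degree \<open>i\<close>, both sides
    are \<open>undefined\<close>, by extensionality of \<open>h i\<close> and of
    \<open>h i U\<close>.\<close>
  moreover have "fmap (deg_fctr X R) G H (restrict \<eta> {U. openin X U}) = h"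
  proof (intro ext)
    fix i U x
    show "fmap (deg_fctr X R) G H (restrict \<eta> {U. openin X U}) i U x = h i U x"
      using nat_transD(2)[OF hi, of i] \<eta>_eq[of U x i] mod_homD(5)[OF h_hom, of U i]
      by (auto simp: extensional_def restrict_def)
  qed
  ultimately show ?thesis by (intro bexI) auto
qed

section \<open>The graded module of a sequence of modules\<close>

text \<open>Both sides add up \<open>h i j\<close> over the pairs with i + j \<le> n, grouped by i +
  j and by i respectively. This gives associativity of the action on \<open>dsum\<close>, where the
  product of polynomials is a convolution.\<close>

lemma (in abelian_monoid) finsum_triangle:
  assumes h: "\<And>i j. h i j \<in> carrier G"
  shows "(\<Oplus>k \<in> {..n::nat}. \<Oplus>i \<in> {..k}. h i (k - i)) = (\<Oplus>i \<in> {..n}. \<Oplus>j \<in> {..n - i}. h i j)"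
proof (induction n)
  case 0
  show ?case using h by simp
next
  case (Suc n)
  have "(\<Oplus>i \<in> {..n}. \<Oplus>j \<in> {..Suc n - i}. h i j) =
      (\<Oplus>i \<in> {..n}. h i (Suc n - i) \<oplus> (\<Oplus>j \<in> {..n - i}. h i j))"
    using h by (intro finsum_cong') (auto simp: Suc_diff_le)
  also have "\<dots> = (\<Oplus>i \<in> {..n}. h i (Suc n - i)) \<oplus> (\<Oplus>i \<in> {..n}. \<Oplus>j \<in> {..n - i}. h i j)"
    using h by (intro finsum_addf) auto
  finally show ?case
    using h Suc.IH by (simp add: a_ac)
qed

text \<open>The values over one open set of a sequence of sheaves: a functor on the ordered set of
  degrees, unpacked into modules and maps.\<close>

locale mod_seq =
  fixes R :: "('r, 'e) ring_scheme" and N :: "nat \<Rightarrow> ('r, 'a) module" and \<tau> :: "nat \<Rightarrow> nat \<Rightarrow> 'a \<Rightarrow> 'a"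
  assumes R_cring: "cring R"
    and N_module: "\<And>i. Module.module R (N i)"
    and \<tau>_hom: "\<And>i j. i \<le> j \<Longrightarrow> \<tau> i j \<in> mod_hom R (N i) (N j)"
    and \<tau>_id: "\<And>i x. x \<in> carrier (N i) \<Longrightarrow> \<tau> i i x = x"
    and \<tau>_comp: "\<And>i j k x. \<lbrakk>i \<le> j; j \<le> k; x \<in> carrier (N i)\<rbrakk> \<Longrightarrow> \<tau> j k (\<tau> i j x) = \<tau> i k x"

sublocale mod_seq \<subseteq> U: UP_cring R "UP R"
  using R_cring by (simp add: UP_cring_def)

sublocale mod_seq \<subseteq> N: Module.module R "N i" for i
  by (rule N_module)

context mod_seq
begin

text \<open>The direct sum of the \<open>N n\<close>, on which t acts by the transition maps: in
  degree \<open>n\<close> the term of exponent \<open>i\<close> of a polynomial contributes its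
  coefficient times the image of \<open>c (n - i)\<close>. Summing over all \<open>i\<close> up to
  \<open>n\<close> avoids any reference to the degree of the polynomial.\<close>

definition dsum :: "(nat \<Rightarrow> 'r, nat \<Rightarrow> 'a) graded_module" where
  "dsum = \<lparr>carrier = {c. (\<forall>n. c n \<in> carrier (N n)) \<and> finite {n. c n \<noteq> \<zero>\<^bsub>N n\<^esub>}},
    mult = (\<lambda>c d. c), one = (\<lambda>n. \<zero>\<^bsub>N n\<^esub>), zero = (\<lambda>n. \<zero>\<^bsub>N n\<^esub>),
    add = (\<lambda>c d n. c n \<oplus>\<^bsub>N n\<^esub> d n),
    smult = (\<lambda>p c n. \<Oplus>\<^bsub>N n\<^esub>i \<in> {..n}. coeff (UP R) p i \<odot>\<^bsub>N n\<^esub> \<tau> (n - i) n (c (n - i))),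
    grade = (\<lambda>n. {c. c n \<in> carrier (N n) \<and> (\<forall>m. m \<noteq> n \<longrightarrow> c m = \<zero>\<^bsub>N m\<^esub>)})\<rparr>"

definition single :: "nat \<Rightarrow> 'a \<Rightarrow> nat \<Rightarrow> 'a" where
  "single n x = (\<lambda>m. if m = n then x else \<zero>\<^bsub>N m\<^esub>)"

lemma dsum_simps [simp]:
  "zero dsum = (\<lambda>n. \<zero>\<^bsub>N n\<^esub>)"
  "add dsum c d = (\<lambda>n. c n \<oplus>\<^bsub>N n\<^esub> d n)"
  "smult dsum p c = (\<lambda>n. \<Oplus>\<^bsub>N n\<^esub>i \<in> {..n}. coeff (UP R) p i \<odot>\<^bsub>N n\<^esub> \<tau> (n - i) n (c (n - i)))"
  by (simp_all add: dsum_def)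

lemma dsum_carrier_iff: "c \<in> carrier dsum \<longleftrightarrow> (\<forall>n. c n \<in> carrier (N n)) \<and> finite {n. c n \<noteq> \<zero>\<^bsub>N n\<^esub>}"
  by (simp add: dsum_def)

lemma dsum_grade_iff: "c \<in> grade dsum n \<longleftrightarrow> c n \<in> carrier (N n) \<and> (\<forall>m. m \<noteq> n \<longrightarrow> c m = \<zero>\<^bsub>N m\<^esub>)"
  by (simp add: dsum_def)

lemma dsum_in: "c \<in> carrier dsum \<Longrightarrow> c n \<in> carrier (N n)"
  by (simp add: dsum_carrier_iff)

lemma dsum_grade_closed: "c \<in> grade dsum n \<Longrightarrow> c \<in> carrier dsum"
proof -
  assume c: "c \<in> grade dsum n"
  then have "{m. c m \<noteq> \<zero>\<^bsub>N m\<^esub>} \<subseteq> {n}" by (auto simp: dsum_grade_iff)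
  then have "finite {m. c m \<noteq> \<zero>\<^bsub>N m\<^esub>}" using finite_subset by blast
  moreover have "c m \<in> carrier (N m)" for m
    using c by (cases "m = n") (auto simp: dsum_grade_iff)
  ultimately show ?thesis by (simp add: dsum_carrier_iff)
qed

lemma single_in_grade: "x \<in> carrier (N n) \<Longrightarrow> single n x \<in> grade dsum n"
  by (auto simp: dsum_grade_iff single_def)

lemma grade_single: "c \<in> grade dsum n \<Longrightarrow> c = single n (c n)"
  by (auto simp: dsum_grade_iff single_def fun_eq_iff)

lemma \<tau>_closed [simp]: "i \<le> j \<Longrightarrow> x \<in> carrier (N i) \<Longrightarrow> \<tau> i j x \<in> carrier (N j)"
  using mod_homD(1)[OF \<tau>_hom] .

lemma \<tau>_zero [simp]: "i \<le> j \<Longrightarrow> \<tau> i j \<zero>\<^bsub>N i\<^esub> = \<zero>\<^bsub>N j\<^esub>"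
  by (rule mod_hom_zero[OF N.abelian_group_axioms N.abelian_group_axioms \<tau>_hom])

lemma dsum_term_closed:
  "\<lbrakk>p \<in> carrier (UP R); c \<in> carrier dsum\<rbrakk> \<Longrightarrow>
    coeff (UP R) p i \<odot>\<^bsub>N n\<^esub> \<tau> (n - j) n (c (n - j)) \<in> carrier (N n)"
  by (simp add: dsum_in)

lemma dsum_smult_closed:
  assumes p: "p \<in> carrier (UP R)" and c: "c \<in> carrier dsum"
  shows "p \<odot>\<^bsub>dsum\<^esub> c \<in> carrier dsum"
proof -
  obtain K where K: "{n. c n \<noteq> \<zero>\<^bsub>N n\<^esub>} \<subseteq> {..K}"
    using c finite_nat_set_iff_bounded_le by (auto simp: dsum_carrier_iff subset_iff)
  \<comment> \<open>Beyond \<open>deg R p + K\<close> every term vanishes: either \<open>i\<close>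
    exceeds the degree of \<open>p\<close> and the coefficient is zero, or \<open>n - i\<close>
    exceeds \<open>K\<close> and the component of \<open>c\<close> is zero.\<close>
  have "(p \<odot>\<^bsub>dsum\<^esub> c) n = \<zero>\<^bsub>N n\<^esub>" if n: "n > deg R p + K" for n
    unfolding dsum_simps
  proof (rule N.add.finprod_one_eqI)
    fix i assume "i \<in> {..n}"
    show "coeff (UP R) p i \<odot>\<^bsub>N n\<^esub> \<tau> (n - i) n (c (n - i)) = \<zero>\<^bsub>N n\<^esub>"
    proof (cases "i > deg R p")
      case True
      then show ?thesis using p c by (simp add: U.deg_aboveD dsum_in)
    next
      case False
      then have "n - i \<notin> {..K}" using n by auto
      then have "c (n - i) = \<zero>\<^bsub>N (n - i)\<^esub>" using K by blast
      then show ?thesis using p by simp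
    qed
  qed
  then have "{n. (p \<odot>\<^bsub>dsum\<^esub> c) n \<noteq> \<zero>\<^bsub>N n\<^esub>} \<subseteq> {..deg R p + K}" by (auto simp: not_le[symmetric] simp del: dsum_simps)
  then have "finite {n. (p \<odot>\<^bsub>dsum\<^esub> c) n \<noteq> \<zero>\<^bsub>N n\<^esub>}" using finite_subset by blast
  moreover have "(p \<odot>\<^bsub>dsum\<^esub> c) n \<in> carrier (N n)" for n
    unfolding dsum_simps using dsum_term_closed[OF p c] by (intro N.finsum_closed) auto
  ultimately show ?thesis by (simp add: dsum_carrier_iff del: dsum_simps)
qed

lemma dsum_monom_smult:
  assumes r: "r \<in> carrier R" and c: "c \<in> carrier dsum"
  shows "(monom (UP R) r i \<odot>\<^bsub>dsum\<^esub> c) n =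
    (if i \<le> n then r \<odot>\<^bsub>N n\<^esub> \<tau> (n - i) n (c (n - i)) else \<zero>\<^bsub>N n\<^esub>)"
proof (cases "i \<le> n")
  case True
  have "(monom (UP R) r i \<odot>\<^bsub>dsum\<^esub> c) n =
      (\<Oplus>\<^bsub>N n\<^esub>j \<in> {..n}. if j = i then r \<odot>\<^bsub>N n\<^esub> \<tau> (n - j) n (c (n - j)) else \<zero>\<^bsub>N n\<^esub>)"
    unfolding dsum_simps using r c by (intro N.finsum_cong') (auto simp: dsum_in)
  also have "\<dots> = r \<odot>\<^bsub>N n\<^esub> \<tau> (n - i) n (c (n - i))"
    using True r c by (subst N.add.finprod_singleton_swap) (auto simp: dsum_in)
  finally show ?thesis using True by simp
next
  case False
  then show ?thesis
    unfolding dsum_simps using r c by (simp, intro N.add.finprod_one_eqI) (auto simp: dsum_in)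
qed

lemma module_dsum: "Module.module (UP R) dsum"
proof (rule Module.moduleI[OF U.UP_cring])
  have add_closed: "c \<oplus>\<^bsub>dsum\<^esub> d \<in> carrier dsum" if c: "c \<in> carrier dsum" and d: "d \<in> carrier dsum" for c d
  proof -
    have "{n. (c \<oplus>\<^bsub>dsum\<^esub> d) n \<noteq> \<zero>\<^bsub>N n\<^esub>} \<subseteq> {n. c n \<noteq> \<zero>\<^bsub>N n\<^esub>} \<union> {n. d n \<noteq> \<zero>\<^bsub>N n\<^esub>}" by auto
    then have "finite {n. (c \<oplus>\<^bsub>dsum\<^esub> d) n \<noteq> \<zero>\<^bsub>N n\<^esub>}"
      using c d finite_subset by (auto simp: dsum_carrier_iff)
    then show ?thesis using c d by (simp add: dsum_carrier_iff)
  qed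
  show "abelian_group dsum"
  proof (rule abelian_groupI)
    fix c assume c: "c \<in> carrier dsum"
    have "{n. \<ominus>\<^bsub>N n\<^esub> c n \<noteq> \<zero>\<^bsub>N n\<^esub>} \<subseteq> {n. c n \<noteq> \<zero>\<^bsub>N n\<^esub>}" by auto
    then have "(\<lambda>n. \<ominus>\<^bsub>N n\<^esub> c n) \<in> carrier dsum"
      using c finite_subset by (auto simp: dsum_carrier_iff)
    then show "\<exists>d \<in> carrier dsum. d \<oplus>\<^bsub>dsum\<^esub> c = \<zero>\<^bsub>dsum\<^esub>"
      using c by (intro bexI) (auto simp: N.l_neg dsum_in)
  next
    show "\<zero>\<^bsub>dsum\<^esub> \<in> carrier dsum" by (simp add: dsum_carrier_iff)
  qed (use add_closed in \<open>auto simp: dsum_in N.a_ac\<close>)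
next
  fix p c assume "p \<in> carrier (UP R)" "c \<in> carrier dsum"
  then show "p \<odot>\<^bsub>dsum\<^esub> c \<in> carrier dsum" by (rule dsum_smult_closed)
next
  fix p q c assume p: "p \<in> carrier (UP R)" and q: "q \<in> carrier (UP R)" and c: "c \<in> carrier dsum"
  show "(p \<oplus>\<^bsub>UP R\<^esub> q) \<odot>\<^bsub>dsum\<^esub> c = p \<odot>\<^bsub>dsum\<^esub> c \<oplus>\<^bsub>dsum\<^esub> q \<odot>\<^bsub>dsum\<^esub> c"
  proof
    fix n
    have "(\<Oplus>\<^bsub>N n\<^esub>i \<in> {..n}. coeff (UP R) (p \<oplus>\<^bsub>UP R\<^esub> q) i \<odot>\<^bsub>N n\<^esub> \<tau> (n - i) n (c (n - i))) =
        (\<Oplus>\<^bsub>N n\<^esub>i \<in> {..n}. coeff (UP R) p i \<odot>\<^bsub>N n\<^esub> \<tau> (n - i) n (c (n - i)) \<oplus>\<^bsub>N n\<^esub>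
          coeff (UP R) q i \<odot>\<^bsub>N n\<^esub> \<tau> (n - i) n (c (n - i)))"
      using p q c by (intro N.finsum_cong') (auto simp: N.smult_l_distr dsum_in)
    then show "((p \<oplus>\<^bsub>UP R\<^esub> q) \<odot>\<^bsub>dsum\<^esub> c) n = (p \<odot>\<^bsub>dsum\<^esub> c \<oplus>\<^bsub>dsum\<^esub> q \<odot>\<^bsub>dsum\<^esub> c) n"
      unfolding dsum_simps using dsum_term_closed p q c by (simp add: N.finsum_addf)
  qed
  \<comment> \<open>Both sides are the double sum of \<open>h i j\<close> over i + j \<le> n. On the
    left it comes from the convolution of coefficients; on the right the map
    \<open>\<tau> (n - i) n\<close> is moved into the inner sum and merged with the inner transition
    map by \<open>\<tau>_comp\<close>.\<close>
  show "(p \<otimes>\<^bsub>UP R\<^esub> q) \<odot>\<^bsub>dsum\<^esub> c = p \<odot>\<^bsub>dsum\<^esub> (q \<odot>\<^bsub>dsum\<^esub> c)"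
  proof
    fix n
    define h where "h i j = (coeff (UP R) p i \<otimes>\<^bsub>R\<^esub> coeff (UP R) q j) \<odot>\<^bsub>N n\<^esub> \<tau> (n - i - j) n (c (n - i - j))" for i j
    have h: "h i j \<in> carrier (N n)" for i j using p q c by (auto simp: h_def dsum_in)
    have "((p \<otimes>\<^bsub>UP R\<^esub> q) \<odot>\<^bsub>dsum\<^esub> c) n = (\<Oplus>\<^bsub>N n\<^esub>k \<in> {..n}. \<Oplus>\<^bsub>N n\<^esub>i \<in> {..k}. h i (k - i))"
      unfolding dsum_simps
    proof (intro N.finsum_cong')
      fix k assume "k \<in> {..n}"
      let ?x = "\<tau> (n - k) n (c (n - k))"
      have x: "?x \<in> carrier (N n)" using c by (simp add: dsum_in)
      have "(\<Oplus>\<^bsub>R\<^esub>i \<in> A. f i) \<odot>\<^bsub>N n\<^esub> ?x = (\<Oplus>\<^bsub>N n\<^esub>i \<in> A. f i \<odot>\<^bsub>N n\<^esub> ?x)"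
        if "finite A" "f \<in> A \<rightarrow> carrier R" for f and A :: "nat set"
        using that x by (induction A) (auto simp: N.smult_l_distr Pi_def)
      then show "coeff (UP R) (p \<otimes>\<^bsub>UP R\<^esub> q) k \<odot>\<^bsub>N n\<^esub> ?x = (\<Oplus>\<^bsub>N n\<^esub>i \<in> {..k}. h i (k - i))"
        using p q x by (auto simp: h_def intro!: N.finsum_cong')
    qed (use h in auto)
    also have "\<dots> = (\<Oplus>\<^bsub>N n\<^esub>i \<in> {..n}. \<Oplus>\<^bsub>N n\<^esub>j \<in> {..n - i}. h i j)"
      by (rule N.finsum_triangle[OF h])
    also have "\<dots> = (p \<odot>\<^bsub>dsum\<^esub> (q \<odot>\<^bsub>dsum\<^esub> c)) n"
      unfolding dsum_simps
    proof (intro N.finsum_cong' refl)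
      show "(\<lambda>i. coeff (UP R) p i \<odot>\<^bsub>N n\<^esub> \<tau> (n - i) n (\<Oplus>\<^bsub>N (n - i)\<^esub>j \<in> {..n - i}.
          coeff (UP R) q j \<odot>\<^bsub>N (n - i)\<^esub> \<tau> (n - i - j) (n - i) (c (n - i - j)))) \<in> {..n} \<rightarrow> carrier (N n)"
        using p q c by (auto simp: dsum_in intro!: N.smult_closed \<tau>_closed N.finsum_closed)
    next
      fix i assume "i \<in> {..n}"
      have "\<tau> (n - i) n (\<Oplus>\<^bsub>N (n - i)\<^esub>j \<in> {..n - i}. coeff (UP R) q j \<odot>\<^bsub>N (n - i)\<^esub> \<tau> (n - i - j) (n - i) (c (n - i - j))) =
          (\<Oplus>\<^bsub>N n\<^esub>j \<in> {..n - i}. \<tau> (n - i) n (coeff (UP R) q j \<odot>\<^bsub>N (n - i)\<^esub> \<tau> (n - i - j) (n - i) (c (n - i - j))))"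
        using q c N.abelian_group_axioms
        by (intro hom_finsum mod_homD(4)[OF \<tau>_hom]) (auto simp: dsum_in)
      also have "\<dots> = (\<Oplus>\<^bsub>N n\<^esub>j \<in> {..n - i}. coeff (UP R) q j \<odot>\<^bsub>N n\<^esub> \<tau> (n - i - j) n (c (n - i - j)))"
        using q c by (intro N.finsum_cong') (auto simp: mod_homD(3)[OF \<tau>_hom] \<tau>_comp dsum_in)
      finally show "(\<Oplus>\<^bsub>N n\<^esub>j \<in> {..n - i}. h i j) = coeff (UP R) p i \<odot>\<^bsub>N n\<^esub> \<tau> (n - i) n
          (\<Oplus>\<^bsub>N (n - i)\<^esub>j \<in> {..n - i}. coeff (UP R) q j \<odot>\<^bsub>N (n - i)\<^esub> \<tau> (n - i - j) (n - i) (c (n - i - j)))"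
        using p q c by (auto simp: N.finsum_smult_ldistr h_def N.smult_assoc1 dsum_in intro!: N.finsum_cong')
    qed
    finally show "((p \<otimes>\<^bsub>UP R\<^esub> q) \<odot>\<^bsub>dsum\<^esub> c) n = (p \<odot>\<^bsub>dsum\<^esub> (q \<odot>\<^bsub>dsum\<^esub> c)) n" .
  qed
next
  fix p c d assume p: "p \<in> carrier (UP R)" and c: "c \<in> carrier dsum" and d: "d \<in> carrier dsum"
  show "p \<odot>\<^bsub>dsum\<^esub> (c \<oplus>\<^bsub>dsum\<^esub> d) = p \<odot>\<^bsub>dsum\<^esub> c \<oplus>\<^bsub>dsum\<^esub> p \<odot>\<^bsub>dsum\<^esub> d"
  proof
    fix n
    have "(\<Oplus>\<^bsub>N n\<^esub>i \<in> {..n}. coeff (UP R) p i \<odot>\<^bsub>N n\<^esub> \<tau> (n - i) n (c (n - i) \<oplus>\<^bsub>N (n - i)\<^esub> d (n - i))) =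
        (\<Oplus>\<^bsub>N n\<^esub>i \<in> {..n}. coeff (UP R) p i \<odot>\<^bsub>N n\<^esub> \<tau> (n - i) n (c (n - i)) \<oplus>\<^bsub>N n\<^esub>
          coeff (UP R) p i \<odot>\<^bsub>N n\<^esub> \<tau> (n - i) n (d (n - i)))"
      using p c d by (intro N.finsum_cong') (auto simp: N.smult_r_distr mod_homD(2)[OF \<tau>_hom] dsum_in)
    then show "(p \<odot>\<^bsub>dsum\<^esub> (c \<oplus>\<^bsub>dsum\<^esub> d)) n = (p \<odot>\<^bsub>dsum\<^esub> c \<oplus>\<^bsub>dsum\<^esub> p \<odot>\<^bsub>dsum\<^esub> d) n"
      unfolding dsum_simps using dsum_term_closed p c d by (simp add: N.finsum_addf)
  qed
next
  fix c assume c: "c \<in> carrier dsum"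
  show "\<one>\<^bsub>UP R\<^esub> \<odot>\<^bsub>dsum\<^esub> c = c"
  proof
    fix n
    show "(\<one>\<^bsub>UP R\<^esub> \<odot>\<^bsub>dsum\<^esub> c) n = c n"
      using dsum_monom_smult[OF U.R.one_closed c, of 0 n] c
      by (simp add: U.monom_one \<tau>_id dsum_in del: dsum_simps)
  qed
qed

text \<open>Evaluation at \<open>n\<close> is additive, so that sums are computed
  componentwise.\<close>

lemma dsum_finsum:
  assumes "finite A" and "\<And>a. a \<in> A \<Longrightarrow> g a \<in> carrier dsum"
  shows "finsum dsum g A n = (\<Oplus>\<^bsub>N n\<^esub>a \<in> A. g a n)"
  by (rule hom_finsum[where f = "\<lambda>c. c n" and M = dsum])
    (use assms in \<open>auto simp: Module.module.axioms(2)[OF module_dsum] N.abelian_group_axioms hom_def dsum_in\<close>)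

lemma graded_dsum: "is_graded_module R dsum"
  unfolding is_graded_module_def
proof (intro conjI allI ballI)
  show "Module.module (UP R) dsum" by (rule module_dsum)
  interpret D: Module.module "UP R" dsum by (rule module_dsum)
  show "subgroup (grade dsum n) (add_monoid dsum)" for n
  proof (rule D.add.subgroupI)
    show "grade dsum n \<noteq> {}" using single_in_grade[OF N.zero_closed] by blast
    fix c assume c: "c \<in> grade dsum n"
    have neg: "(\<lambda>m. \<ominus>\<^bsub>N m\<^esub> c m) \<in> grade dsum n" using c by (auto simp: dsum_grade_iff)
    have "\<ominus>\<^bsub>dsum\<^esub> c = (\<lambda>m. \<ominus>\<^bsub>N m\<^esub> c m)"
      using dsum_grade_closed[OF c] dsum_grade_closed[OF neg]
      by (intro D.minus_equality) (auto simp: N.l_neg dsum_in)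
    with neg show "\<ominus>\<^bsub>dsum\<^esub> c \<in> grade dsum n" by simp
  next
    fix c d assume "c \<in> grade dsum n" "d \<in> grade dsum n"
    then show "c \<oplus>\<^bsub>dsum\<^esub> d \<in> grade dsum n" by (auto simp: dsum_grade_iff)
  qed (use dsum_grade_closed in auto)
next
  fix i n r c assume r: "r \<in> carrier R" and c: "c \<in> grade dsum n"
  note cc = dsum_grade_closed[OF c]
  have "(monom (UP R) r i \<odot>\<^bsub>dsum\<^esub> c) m = \<zero>\<^bsub>N m\<^esub>" if "m \<noteq> i + n" for m
  proof (cases "i \<le> m")
    case True
    then have "c (m - i) = \<zero>\<^bsub>N (m - i)\<^esub>" using c that by (auto simp: dsum_grade_iff)
    then show ?thesis using r cc by (simp add: dsum_monom_smult del: dsum_simps)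
  qed (use r cc in \<open>simp add: dsum_monom_smult del: dsum_simps\<close>)
  then show "monom (UP R) r i \<odot>\<^bsub>dsum\<^esub> c \<in> grade dsum (i + n)"
    using dsum_in[OF dsum_smult_closed[OF U.monom_closed[OF r] cc]]
    by (simp add: dsum_grade_iff del: dsum_simps)
next
  fix c assume c: "c \<in> carrier dsum"
  let ?P = "\<lambda>d. (\<forall>n. d n \<in> grade dsum n) \<and> finite {n. d n \<noteq> \<zero>\<^bsub>dsum\<^esub>} \<and>
      c = (\<Oplus>\<^bsub>dsum\<^esub>n \<in> {n. d n \<noteq> \<zero>\<^bsub>dsum\<^esub>}. d n)"
  have single_c: "single n (c n) \<in> grade dsum n" for n using dsum_in[OF c] by (rule single_in_grade)
  \<comment> \<open>Each \<open>d n\<close> is concentrated in degree \<open>n\<close>, so at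
    position \<open>m\<close> only the term with index \<open>m\<close> survives.\<close>
  have sum_eval: "(\<Oplus>\<^bsub>dsum\<^esub>n \<in> A. d n) m = (if m \<in> A then d m m else \<zero>\<^bsub>N m\<^esub>)"
    if "finite A" "\<And>n. d n \<in> grade dsum n" for A d m
  proof -
    have "(\<Oplus>\<^bsub>dsum\<^esub>n \<in> A. d n) m = (\<Oplus>\<^bsub>N m\<^esub>n \<in> A. d n m)"
      using that dsum_grade_closed by (intro dsum_finsum) auto
    also have "\<dots> = (\<Oplus>\<^bsub>N m\<^esub>n \<in> A. if n = m then d n m else \<zero>\<^bsub>N m\<^esub>)"
      using that dsum_in[OF dsum_grade_closed[OF that(2)]]
      by (intro N.finsum_cong') (auto simp: dsum_grade_iff)
    also have "\<dots> = (if m \<in> A then d m m else \<zero>\<^bsub>N m\<^esub>)"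
      using that dsum_in[OF dsum_grade_closed[OF that(2)]]
      by (cases "m \<in> A") (auto simp: N.add.finprod_singleton_swap intro!: N.add.finprod_one_eqI)
    finally show ?thesis .
  qed
  show "\<exists>!d. ?P d"
  proof (rule ex1I)
    have supp: "{n. single n (c n) \<noteq> \<zero>\<^bsub>dsum\<^esub>} = {n. c n \<noteq> \<zero>\<^bsub>N n\<^esub>}"
      by (auto simp: single_def fun_eq_iff)
    have fin: "finite {n. c n \<noteq> \<zero>\<^bsub>N n\<^esub>}" using c by (simp add: dsum_carrier_iff)
    have sum_c: "c = (\<Oplus>\<^bsub>dsum\<^esub>n \<in> {n. c n \<noteq> \<zero>\<^bsub>N n\<^esub>}. single n (c n))"
    proof
      show "c m = (\<Oplus>\<^bsub>dsum\<^esub>n \<in> {n. c n \<noteq> \<zero>\<^bsub>N n\<^esub>}. single n (c n)) m" for m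
        using sum_eval[OF fin single_c, of m] by (auto simp: single_def)
    qed
    show "?P (\<lambda>n. single n (c n))"
      unfolding supp by (intro conjI allI single_c fin sum_c)
    \<comment> \<open>Evaluating the sum at \<open>n\<close> identifies \<open>d n n\<close> with
      \<open>c n\<close>, and a homogeneous element is determined by that one entry.\<close>
    fix d assume d: "?P d"
    have "d n n = c n" for n
    proof -
      have "c n = (if n \<in> {n. d n \<noteq> \<zero>\<^bsub>dsum\<^esub>} then d n n else \<zero>\<^bsub>N n\<^esub>)"
        using sum_eval[of "{n. d n \<noteq> \<zero>\<^bsub>dsum\<^esub>}" d n] d by metis
      then show ?thesis by (auto simp: fun_eq_iff split: if_splits)
    qed
    then show "d = (\<lambda>n. single n (c n))"
      using d grade_single by (metis (no_types, lifting) ext)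
  qed
qed

end

section \<open>Transport of structure\<close>

text \<open>Direct sums have elements of type \<open>nat \<Rightarrow> 'a\<close>, while the
  sections sought are elements of \<open>'a\<close>. The map \<open>e\<close> is meant to be
  injective on the carrier, with inverse \<open>d\<close>.\<close>

definition transport :: "('b \<Rightarrow> 'a) \<Rightarrow> ('s, 'b) graded_module \<Rightarrow> ('s, 'a) graded_module" where
  "transport e M = (let d = inv_into (carrier M) e in
    \<lparr>carrier = e ` carrier M, mult = (\<lambda>x y. x), one = e \<zero>\<^bsub>M\<^esub>, zero = e \<zero>\<^bsub>M\<^esub>,
      add = (\<lambda>x y. e (d x \<oplus>\<^bsub>M\<^esub> d y)), smult = (\<lambda>r x. e (r \<odot>\<^bsub>M\<^esub> d x)),
      grade = (\<lambda>n. e ` grade M n)\<rparr>)"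

lemma transport_simps:
  assumes "inj_on e (carrier M)"
  shows "carrier (transport e M) = e ` carrier M"
    and "zero (transport e M) = e \<zero>\<^bsub>M\<^esub>"
    and "grade (transport e M) n = e ` grade M n"
    and "\<lbrakk>x \<in> carrier M; y \<in> carrier M\<rbrakk> \<Longrightarrow> add (transport e M) (e x) (e y) = e (x \<oplus>\<^bsub>M\<^esub> y)"
    and "x \<in> carrier M \<Longrightarrow> smult (transport e M) r (e x) = e (r \<odot>\<^bsub>M\<^esub> x)"
  using assms by (simp_all add: transport_def Let_def)

text \<open>\<open>e\<close> is an additive bijection onto the new carrier that respects scalars and
  degrees. A decomposition there is pulled back along \<open>e\<close>, and its uniqueness comes
  from uniqueness in \<open>M\<close>.\<close>

lemma graded_transport:
  assumes R: "cring R" and M: "is_graded_module R M" and e: "inj_on e (carrier M)"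
  shows "is_graded_module R (transport e M)"
proof -
  interpret gr_module R M using R M by (rule gr_module.intro)
  let ?T = "transport e M"
  note t = transport_simps[OF e]
  have mod: "Module.module (UP R) ?T"
  proof (rule Module.moduleI[OF U.UP_cring])
    show "abelian_group ?T"
    proof (rule abelian_groupI)
      fix x assume "x \<in> carrier ?T"
      then obtain a where a: "a \<in> carrier M" "x = e a" by (auto simp: t)
      then show "\<exists>y \<in> carrier ?T. y \<oplus>\<^bsub>?T\<^esub> x = \<zero>\<^bsub>?T\<^esub>"
        by (intro bexI[of _ "e (\<ominus>\<^bsub>M\<^esub> a)"]) (auto simp: t l_neg)
    qed (auto simp: t a_ac)
  qed (auto simp: t smult_l_distr smult_r_distr smult_assoc1)
  have hom: "e \<in> hom (add_monoid M) (add_monoid ?T)" by (auto simp: hom_def t)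
  interpret T: Module.module "UP R" ?T by (rule mod)
  interpret e: group_hom "add_monoid M" "add_monoid ?T" e
    using a_group T.a_group hom by (simp add: group_hom_def group_hom_axioms_def)
  note e_sum = hom_finsum[OF abelian_group_axioms T.abelian_group_axioms hom]
  have "\<exists>!c. (\<forall>n. c n \<in> grade ?T n) \<and> finite {n. c n \<noteq> \<zero>\<^bsub>?T\<^esub>} \<and> x = (\<Oplus>\<^bsub>?T\<^esub>n \<in> {n. c n \<noteq> \<zero>\<^bsub>?T\<^esub>}. c n)"
    if xT: "x \<in> carrier ?T" for x
  proof -
    obtain a where a: "a \<in> carrier M" and x: "x = e a" using xT by (auto simp: t)
    have nz: "e b \<noteq> \<zero>\<^bsub>?T\<^esub> \<longleftrightarrow> b \<noteq> \<zero>\<^bsub>M\<^esub>" if "b \<in> carrier M" for b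
      using that e by (auto simp: t inj_on_def)
    show ?thesis
    proof (rule ex1I)
      have supp: "{n. e (gcomp M a n) \<noteq> \<zero>\<^bsub>?T\<^esub>} = {n. gcomp M a n \<noteq> \<zero>\<^bsub>M\<^esub>}"
        using nz gcomp_closed[OF a] by auto
      have "x = (\<Oplus>\<^bsub>?T\<^esub>n \<in> {n. gcomp M a n \<noteq> \<zero>\<^bsub>M\<^esub>}. e (gcomp M a n))"
        unfolding x using a gcomp_closed[OF a] finite_gcomp[OF a]
        by (subst gcomp_finsum[OF a, symmetric], intro e_sum) auto
      then show "(\<forall>n. e (gcomp M a n) \<in> grade ?T n) \<and> finite {n. e (gcomp M a n) \<noteq> \<zero>\<^bsub>?T\<^esub>} \<and>
          x = (\<Oplus>\<^bsub>?T\<^esub>n \<in> {n. e (gcomp M a n) \<noteq> \<zero>\<^bsub>?T\<^esub>}. e (gcomp M a n))"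
        unfolding supp using gcomp_in[OF a] finite_gcomp[OF a] by (auto simp: t)
      fix c assume c: "(\<forall>n. c n \<in> grade ?T n) \<and> finite {n. c n \<noteq> \<zero>\<^bsub>?T\<^esub>} \<and>
        x = (\<Oplus>\<^bsub>?T\<^esub>n \<in> {n. c n \<noteq> \<zero>\<^bsub>?T\<^esub>}. c n)"
      then have "\<forall>n. \<exists>b. b \<in> grade M n \<and> c n = e b" by (auto simp: t)
      then obtain b where b: "\<And>n. b n \<in> grade M n" "\<And>n. c n = e (b n)" by metis
      have cb: "c = (\<lambda>n. e (b n))" using b(2) by auto
      have supp': "{n. e (b n) \<noteq> \<zero>\<^bsub>?T\<^esub>} = {n. b n \<noteq> \<zero>\<^bsub>M\<^esub>}"
        using nz grade_closed[OF b(1)] by auto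
      have fin: "finite {n. b n \<noteq> \<zero>\<^bsub>M\<^esub>}" using c unfolding cb supp' by blast
      have "e a = (\<Oplus>\<^bsub>?T\<^esub>n \<in> {n. b n \<noteq> \<zero>\<^bsub>M\<^esub>}. e (b n))" using c unfolding cb supp' x by blast
      also have "\<dots> = e (\<Oplus>\<^bsub>M\<^esub>n \<in> {n. b n \<noteq> \<zero>\<^bsub>M\<^esub>}. b n)"
        using fin grade_closed[OF b(1)] by (intro e_sum[symmetric]) auto
      finally have "a = (\<Oplus>\<^bsub>M\<^esub>n \<in> {n. b n \<noteq> \<zero>\<^bsub>M\<^esub>}. b n)"
        using e a grade_closed[OF b(1)] by (auto simp: inj_on_def intro!: finsum_closed)
      then have "gcomp M a = b" using b(1) fin by (intro gcomp_eqI) auto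
      then show "c = (\<lambda>n. e (gcomp M a n))" using cb by simp
    qed
  qed
  moreover have "subgroup (grade ?T n) (add_monoid ?T)" for n
    using e.subgroup_img_is_subgroup[OF grade_subgroup] by (simp add: t)
  moreover have "monom (UP R) r i \<odot>\<^bsub>?T\<^esub> x \<in> grade ?T (i + n)"
    if "r \<in> carrier R" "x \<in> grade ?T n" for i n r x
    using that grade_closed by (auto simp: t intro!: imageI grade_smult)
  ultimately show ?thesis using mod unfolding is_graded_module_def by blast
qed

text \<open>Lists are encoded by iterating an injection \<open>p\<close> of pairs; \<open>list_code p a\<close> is injective only on lists
  of equal length.\<close>

primrec list_code :: "('a \<times> 'a \<Rightarrow> 'a) \<Rightarrow> 'a \<Rightarrow> 'a list \<Rightarrow> 'a" where
  "list_code p a [] = a"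
| "list_code p a (x # xs) = p (x, list_code p a xs)"

lemma list_code_inj:
  assumes "inj p"
  shows "\<lbrakk>length xs = length ys; list_code p a xs = list_code p a ys\<rbrakk> \<Longrightarrow> xs = ys"
  by (induction xs ys rule: list_induct2) (auto dest: injD[OF assms])

text \<open>Such a sequence is determined by a length beyond which it agrees with \<open>z\<close>
  and by the list of its earlier entries. The default value depends on the index because the zeros
  of the modules in different degrees are unrelated elements of \<open>'a\<close>.\<close>

lemma ex_inj_finite_support:
  fixes z :: "nat \<Rightarrow> 'a"
  assumes inf: "infinite (UNIV :: 'a set)"
  shows "\<exists>e :: (nat \<Rightarrow> 'a) \<Rightarrow> 'a. inj_on e {c. finite {n. c n \<noteq> z n}}"
proof -
  \<comment> \<open>An infinite set is equipotent with its square.\<close>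
  obtain p :: "'a \<times> 'a \<Rightarrow> 'a" where p: "inj p"
    using card_of_Times_same_infinite[OF inf] unfolding card_of_ordIso[symmetric]
    by (auto simp: bij_betw_def)
  obtain \<nu> :: "nat \<Rightarrow> 'a" where \<nu>: "inj \<nu>"
    using infinite_countable_subset[OF inf] by auto
  \<comment> \<open>The length is coded next to the list, since list codes are comparable only at
    equal length. The start value \<open>undefined\<close> of the code is arbitrary but common to
    all sequences.\<close>
  define len where "len c = (LEAST k. \<forall>n \<ge> k. c n = z n)" for c
  define e where "e c = p (\<nu> (len c), list_code p undefined (map c [0..<len c]))" for c
  have len: "c n = z n" if fin: "finite {n. c n \<noteq> z n}" and n: "n \<ge> len c" for c n
  proof -
    obtain k where "{n. c n \<noteq> z n} \<subseteq> {..<k}"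
      using fin finite_nat_iff_bounded by blast
    then have "\<forall>n \<ge> k. c n = z n" by force
    from LeastI[of "\<lambda>k. \<forall>n \<ge> k. c n = z n", OF this] n show ?thesis unfolding len_def by blast
  qed
  have "inj_on e {c. finite {n. c n \<noteq> z n}}"
  proof (rule inj_onI)
    fix c d assume c: "c \<in> {c. finite {n. c n \<noteq> z n}}" and d: "d \<in> {c. finite {n. c n \<noteq> z n}}"
      and eq: "e c = e d"
    have pair: "(\<nu> (len c), list_code p undefined (map c [0..<len c])) =
        (\<nu> (len d), list_code p undefined (map d [0..<len d]))"
      using eq unfolding e_def by (rule injD[OF p])
    then have l: "len c = len d" using inj_eq[OF \<nu>] by simp
    have "list_code p undefined (map c [0..<len d]) = list_code p undefined (map d [0..<len d])"
      using pair unfolding l by simp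
    then have m: "map c [0..<len d] = map d [0..<len d]"
      by (intro list_code_inj[OF p]) auto
    show "c = d"
    proof
      fix n show "c n = d n" using m l len[of c n] len[of d n] c d by (cases "n < len d") auto
    qed
  qed
  then show ?thesis by blast
qed

text \<open>For k = 0 this gives linearity over \<open>R\<close>, and for r = 1 compatibility with
  powers of t, of the comparison map that is built from \<open>single\<close>.\<close>

lemma (in mod_seq) monom_smult_single:
  assumes r: "r \<in> carrier R" and x: "x \<in> carrier (N i)"
  shows "monom (UP R) r k \<odot>\<^bsub>dsum\<^esub> single i x = single (k + i) (r \<odot>\<^bsub>N (k + i)\<^esub> \<tau> i (k + i) x)"
proof
  fix n
  have s: "single i x \<in> carrier dsum" using dsum_grade_closed[OF single_in_grade[OF x]] .
  show "(monom (UP R) r k \<odot>\<^bsub>dsum\<^esub> single i x) n = single (k + i) (r \<odot>\<^bsub>N (k + i)\<^esub> \<tau> i (k + i) x) n"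
  proof (cases "n = k + i")
    case False
    then have "k \<le> n \<Longrightarrow> n - k \<noteq> i" by auto
    with False r show ?thesis
      unfolding dsum_monom_smult[OF r s] by (simp add: single_def)
  next
    case True
    then show ?thesis unfolding dsum_monom_smult[OF r s] by (simp add: single_def)
  qed
qed

section \<open>The sheaf of graded modules of a sequence of sheaves\<close>

text \<open>The section modules of the sheaf are direct sums, which are moved into the universe \<open>'a\<close> by
  injections \<open>e U\<close>.\<close>

locale sheaf_seq =
  fixes X :: "'x topology" and R :: "('r, 'f) ring_scheme"
    and F :: "(nat, unit, ('x set, unit, ('r, 'a) module, 'a \<Rightarrow> 'a) fctr, 'x set \<Rightarrow> 'a \<Rightarrow> 'a) fctr"
    and e :: "'x set \<Rightarrow> (nat \<Rightarrow> 'a) \<Rightarrow> 'a"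
  assumes R: "cring R" and F: "is_functor nat_cat (Shv_Mod X R) F"
    and e_inj: "\<And>U. inj_on (e U) {c. finite {n. c n \<noteq> \<zero>\<^bsub>fobj (fobj F n) U\<^esub>}}"
begin

abbreviation N :: "'x set \<Rightarrow> nat \<Rightarrow> ('r, 'a) module" where "N U n \<equiv> fobj (fobj F n) U"

abbreviation \<tau> :: "'x set \<Rightarrow> nat \<Rightarrow> nat \<Rightarrow> 'a \<Rightarrow> 'a" where "\<tau> U i j \<equiv> fmap F i j () U"

abbreviation \<rho> :: "nat \<Rightarrow> 'x set \<Rightarrow> 'x set \<Rightarrow> 'a \<Rightarrow> 'a" where "\<rho> n U V \<equiv> fmap (fobj F n) U V ()"

abbreviation D :: "'x set \<Rightarrow> (nat \<Rightarrow> 'r, nat \<Rightarrow> 'a) graded_module" where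
  "D U \<equiv> mod_seq.dsum R (N U) (\<tau> U)"

abbreviation sg :: "'x set \<Rightarrow> nat \<Rightarrow> 'a \<Rightarrow> nat \<Rightarrow> 'a" where "sg U \<equiv> mod_seq.single (N U)"

lemma sheaf_F: "is_sheaf X (Mod_cat R) mod_prod (fobj F i)"
  using is_functorD(1)[OF F, of i] by simp

lemma psh_F: "is_functor (opens_op X) (Mod_cat R) (fobj F i)"
  using is_functorD(1)[OF F, of i] by simp

sublocale psh: mod_presheaf X R "fobj F i" for i
  by (rule mod_presheaf.intro[OF psh_F])

lemma trans_nat: "i \<le> j \<Longrightarrow> fmap F i j u \<in> nat_trans (opens_op X) (Mod_cat R) (fobj F i) (fobj F j)"
  using is_functorD(2)[OF F, of i j u] by simp

lemma \<tau>_\<rho>: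
  assumes "i \<le> j" "openin X U" "openin X V" "V \<subseteq> U" "x \<in> carrier (N U i)"
  shows "\<tau> V i j (\<rho> i U V x) = \<rho> j U V (\<tau> U i j x)"
  using nat_transD(3)[OF trans_nat[OF assms(1)], of U V "()"] assms
  by (auto simp: compose_def dest!: fun_cong[of _ _ x])

lemma mod_seq_F:
  assumes U: "openin X U"
  shows "mod_seq R (N U) (\<tau> U)"
proof (rule mod_seq.intro)
  show "cring R" by (rule R)
  show "Module.module R (N U i)" for i using psh.module_obj[OF U] .
  show "\<tau> U i j \<in> mod_hom R (N U i) (N U j)" if "i \<le> j" for i j
    using nat_transD(1)[OF trans_nat[OF that], of U] U by simp
  show "\<tau> U i i x = x" if "x \<in> carrier (N U i)" for i x
    using is_functorD(3)[OF F, of i] U that by simp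
  show "\<tau> U j k (\<tau> U i j x) = \<tau> U i k x" if "i \<le> j" "j \<le> k" "x \<in> carrier (N U i)" for i j k x
    using is_functorD(4)[OF F, of i j k "()" "()"] U that by (simp add: compose_def)
qed

lemma e_inj_D:
  assumes "openin X U"
  shows "inj_on (e U) (carrier (D U))"
proof -
  interpret mod_seq R "N U" "\<tau> U" by (rule mod_seq_F[OF assms])
  show ?thesis by (rule inj_on_subset[OF e_inj]) (auto simp: dsum_carrier_iff)
qed

definition dmap :: "'x set \<Rightarrow> 'x set \<Rightarrow> (nat \<Rightarrow> 'a) \<Rightarrow> nat \<Rightarrow> 'a" where
  "dmap U V c = (\<lambda>n. \<rho> n U V (c n))"

text \<open>A restriction map decodes a section by the inverse of \<open>e U\<close>, restricts
  every component and encodes the result by \<open>e V\<close>, since each open set has its own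
  encoding.\<close>

definition G :: "('x set, unit, (nat \<Rightarrow> 'r, 'a) graded_module, 'a \<Rightarrow> 'a) fctr" where
  "G = \<lparr>fobj = (\<lambda>U. transport (e U) (D U)),
    fmap = (\<lambda>U V u. \<lambda>x \<in> e U ` carrier (D U). e V (dmap U V (inv_into (carrier (D U)) (e U) x)))\<rparr>"

lemma G_obj: "fobj G U = transport (e U) (D U)"
  by (simp add: G_def)

lemma G_map: "openin X U \<Longrightarrow> c \<in> carrier (D U) \<Longrightarrow> fmap G U V u (e U c) = e V (dmap U V c)"
  using e_inj_D by (simp add: G_def)

lemma G_map_ext: "fmap G U V u \<in> extensional (e U ` carrier (D U))"
  by (simp add: G_def)

lemmas t = transport_simps[OF e_inj_D]

context
  fixes U V
  assumes U: "openin X U" and V: "openin X V" and VU: "V \<subseteq> U"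
begin

interpretation U: mod_seq R "N U" "\<tau> U" by (rule mod_seq_F[OF U])
interpretation V: mod_seq R "N V" "\<tau> V" by (rule mod_seq_F[OF V])

lemma \<rho>_hom: "\<rho> n U V \<in> mod_hom R (N U n) (N V n)"
  by (rule psh.res_hom[OF U V VU])

lemma \<rho>_zero: "\<rho> n U V \<zero>\<^bsub>N U n\<^esub> = \<zero>\<^bsub>N V n\<^esub>"
  by (rule mod_hom_zero[OF U.N.abelian_group_axioms V.N.abelian_group_axioms \<rho>_hom])

lemma dmap_closed: "c \<in> carrier (D U) \<Longrightarrow> dmap U V c \<in> carrier (D V)"
proof -
  assume c: "c \<in> carrier (D U)"
  have "{n. dmap U V c n \<noteq> \<zero>\<^bsub>N V n\<^esub>} \<subseteq> {n. c n \<noteq> \<zero>\<^bsub>N U n\<^esub>}"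
    using \<rho>_zero by (auto simp: dmap_def)
  then show ?thesis
    using c finite_subset by (auto simp: U.dsum_carrier_iff V.dsum_carrier_iff dmap_def mod_homD(1)[OF \<rho>_hom])
qed

lemma dmap_grade: "c \<in> grade (D U) n \<Longrightarrow> dmap U V c \<in> grade (D V) n"
  by (simp add: U.dsum_grade_iff V.dsum_grade_iff dmap_def mod_homD(1)[OF \<rho>_hom] \<rho>_zero)

lemma dmap_add:
  "c \<in> carrier (D U) \<Longrightarrow> d \<in> carrier (D U) \<Longrightarrow> dmap U V (c \<oplus>\<^bsub>D U\<^esub> d) = dmap U V c \<oplus>\<^bsub>D V\<^esub> dmap U V d"
  by (simp add: dmap_def U.dsum_in mod_homD(2)[OF \<rho>_hom])

text \<open>The action mixes degrees through the transition maps, so this uses that they are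
  morphisms of presheaves, in the form of \<open>\<tau>_\<rho>\<close>.\<close>

lemma dmap_smult:
  assumes p: "p \<in> carrier (UP R)" and c: "c \<in> carrier (D U)"
  shows "dmap U V (p \<odot>\<^bsub>D U\<^esub> c) = p \<odot>\<^bsub>D V\<^esub> dmap U V c"
proof
  fix n
  have "dmap U V (p \<odot>\<^bsub>D U\<^esub> c) n =
      (\<Oplus>\<^bsub>N V n\<^esub>i \<in> {..n}. \<rho> n U V (coeff (UP R) p i \<odot>\<^bsub>N U n\<^esub> \<tau> U (n - i) n (c (n - i))))"
    unfolding dmap_def U.dsum_simps using U.dsum_term_closed[OF p c]
    by (intro hom_finsum U.N.abelian_group_axioms V.N.abelian_group_axioms mod_homD(4)[OF \<rho>_hom]) auto
  also have "\<dots> = (\<Oplus>\<^bsub>N V n\<^esub>i \<in> {..n}. coeff (UP R) p i \<odot>\<^bsub>N V n\<^esub> \<tau> V (n - i) n (dmap U V c (n - i)))"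
    using p c V.dsum_in[OF dmap_closed[OF c]]
    by (intro V.N.finsum_cong') (auto simp: mod_homD(1,3)[OF \<rho>_hom] U.dsum_in dmap_def \<tau>_\<rho>[OF _ U V VU])
  finally show "dmap U V (p \<odot>\<^bsub>D U\<^esub> c) n = (p \<odot>\<^bsub>D V\<^esub> dmap U V c) n" by simp
qed

lemma dmap_single: "x \<in> carrier (N U i) \<Longrightarrow> dmap U V (sg U i x) = sg V i (\<rho> i U V x)"
  by (auto simp: dmap_def U.single_def V.single_def \<rho>_zero)

lemma G_map_hom: "fmap G U V u \<in> Mor (grMod_cat R) (fobj G U) (fobj G V)"
proof -
  interpret DU: Module.module "UP R" "D U" by (rule U.module_dsum)
  have "fmap G U V u \<in> mod_hom (UP R) (fobj G U) (fobj G V)"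
  proof (rule mod_homI)
    show "fmap G U V u \<in> extensional (carrier (fobj G U))"
      using G_map_ext by (simp add: G_obj t U)
  qed (auto simp: G_obj t U V G_map[OF U] dmap_closed dmap_add dmap_smult
      simp del: U.dsum_simps V.dsum_simps)
  moreover have "fmap G U V u ` grade (fobj G U) n \<subseteq> grade (fobj G V) n" for n
    by (auto simp: G_obj t U V G_map[OF U U.dsum_grade_closed] dmap_grade)
  ultimately show ?thesis by simp
qed

end

lemma functor_G: "is_functor (opens_op X) (grMod_cat R) G"
proof (rule is_functorI)
  fix U assume "U \<in> Ob (opens_op X)"
  then have U: "openin X U" by simp
  interpret mod_seq R "N U" "\<tau> U" by (rule mod_seq_F[OF U])
  show "fobj G U \<in> Ob (grMod_cat R)"
    using graded_transport[OF R graded_dsum e_inj_D[OF U]] by (simp add: G_obj)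
  have "dmap U U c = c" if "c \<in> carrier (D U)" for c
    using is_functorD(3)[OF psh_F, of U] U dsum_in[OF that] by (simp add: dmap_def)
  then show "fmap G U U (Idn (opens_op X) U) = Idn (grMod_cat R) (fobj G U)"
    using G_map_ext[of U U "()"]
    by (intro extensionalityI[of _ "e U ` carrier (D U)"]) (auto simp: G_obj t U G_map)
next
  fix U V u assume "U \<in> Ob (opens_op X)" "V \<in> Ob (opens_op X)" "u \<in> Mor (opens_op X) U V"
  then show "fmap G U V u \<in> Mor (grMod_cat R) (fobj G U) (fobj G V)"
    using G_map_hom[of U V u] by simp
next
  fix U V W u v assume "U \<in> Ob (opens_op X)" "V \<in> Ob (opens_op X)" "W \<in> Ob (opens_op X)"
    "u \<in> Mor (opens_op X) U V" "v \<in> Mor (opens_op X) V W"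
  then have *: "openin X U" "openin X V" "openin X W" "V \<subseteq> U" "W \<subseteq> V" by auto
  interpret mod_seq R "N U" "\<tau> U" by (rule mod_seq_F[OF *(1)])
  have "dmap V W (dmap U V c) = dmap U W c" if "c \<in> carrier (D U)" for c
    using dsum_in[OF that] * by (simp add: dmap_def psh.res_comp[where w = "()"])
  then show "fmap G U W (Cmp (opens_op X) U V W v u) =
      Cmp (grMod_cat R) (fobj G U) (fobj G V) (fobj G W) (fmap G V W v) (fmap G U V u)"
    using G_map_ext[of U W "()"] *
    by (intro extensionalityI[of _ "e U ` carrier (D U)"])
      (auto simp: G_obj t G_map dmap_closed compose_def)
qed

sublocale G: gr_presheaf X R G
  by (rule gr_presheaf.intro[OF R functor_G])

text \<open>The comparison map from \<open>F\<close> to the degree sequence of \<open>G\<close>: a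
  section becomes the element concentrated in degree \<open>i\<close>, in encoded form.\<close>

definition \<Theta> :: "nat \<Rightarrow> 'x set \<Rightarrow> 'a \<Rightarrow> 'a" where
  "\<Theta> i = (\<lambda>U \<in> {U. openin X U}. \<lambda>x \<in> carrier (N U i). e U (sg U i x))"

lemma \<Theta>_hom_bij:
  assumes U: "openin X U"
  shows "\<Theta> i U \<in> mod_hom R (N U i) (deg_part R (fobj G U) i)"
    and "bij_betw (\<Theta> i U) (carrier (N U i)) (grade (fobj G U) i)"
proof -
  interpret mod_seq R "N U" "\<tau> U" by (rule mod_seq_F[OF U])
  have sgc: "sg U i x \<in> carrier (D U)" if "x \<in> carrier (N U i)" for x
    using dsum_grade_closed[OF single_in_grade[OF that]] .
  have add: "sg U i (x \<oplus>\<^bsub>N U i\<^esub> y) = sg U i x \<oplus>\<^bsub>D U\<^esub> sg U i y"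
    if "x \<in> carrier (N U i)" "y \<in> carrier (N U i)" for x y
    using that by (auto simp: single_def)
  have smult: "monom (UP R) r 0 \<odot>\<^bsub>D U\<^esub> sg U i x = sg U i (r \<odot>\<^bsub>N U i\<^esub> x)"
    if "r \<in> carrier R" "x \<in> carrier (N U i)" for r x
    using monom_smult_single[OF that, of 0] that by (simp add: \<tau>_id del: dsum_simps)
  show "\<Theta> i U \<in> mod_hom R (N U i) (deg_part R (fobj G U) i)"
    by (rule mod_homI)
      (use U in \<open>auto simp: \<Theta>_def G_obj t sgc add smult single_in_grade simp del: dsum_simps\<close>)
  show "bij_betw (\<Theta> i U) (carrier (N U i)) (grade (fobj G U) i)"
    unfolding bij_betw_def
  proof
    show "inj_on (\<Theta> i U) (carrier (N U i))"
    proof (rule inj_onI)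
      fix x y assume "x \<in> carrier (N U i)" "y \<in> carrier (N U i)" "\<Theta> i U x = \<Theta> i U y"
      then have "sg U i x = sg U i y"
        using U sgc by (auto simp: \<Theta>_def intro: inj_onD[OF e_inj_D[OF U]])
      then have "sg U i x i = sg U i y i" by simp
      then show "x = y" by (simp add: single_def)
    qed
    have "c \<in> sg U i ` carrier (N U i)" if "c \<in> grade (D U) i" for c
      using that grade_single[OF that] by (auto simp: dsum_grade_iff)
    then have "grade (D U) i = sg U i ` carrier (N U i)" using single_in_grade by auto
    then show "\<Theta> i U ` carrier (N U i) = grade (fobj G U) i"
      using U by (auto simp: \<Theta>_def G_obj t image_image)
  qed
qed

lemma \<Theta>_nat: "\<Theta> i \<in> nat_trans (opens_op X) (Mod_cat R) (fobj F i) (deg_psh R G i)"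
proof (rule nat_transI)
  fix U V u assume "U \<in> Ob (opens_op X)" "V \<in> Ob (opens_op X)" "u \<in> Mor (opens_op X) U V"
  then have *: "openin X U" "openin X V" "V \<subseteq> U" by auto
  interpret U: mod_seq R "N U" "\<tau> U" by (rule mod_seq_F[OF *(1)])
  have sgg: "sg U i x \<in> grade (D U) i" "sg U i x \<in> carrier (D U)" if "x \<in> carrier (N U i)" for x
    using U.single_in_grade[OF that] U.dsum_grade_closed by auto
  show "Cmp (Mod_cat R) (fobj (fobj F i) U) (fobj (fobj F i) V) (fobj (deg_psh R G i) V) (\<Theta> i V) (fmap (fobj F i) U V u) =
      Cmp (Mod_cat R) (fobj (fobj F i) U) (fobj (deg_psh R G i) U) (fobj (deg_psh R G i) V)
        (fmap (deg_psh R G i) U V u) (\<Theta> i U)"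
    using * sgg by (auto simp: fun_eq_iff compose_def \<Theta>_def G_obj t G_map dmap_single
        mod_homD(1)[OF \<rho>_hom])
qed (use \<Theta>_hom_bij in \<open>auto simp: \<Theta>_def\<close>)

text \<open>The sheaf condition for \<open>G\<close> is tested on its degree parts, and \<Theta>
  identifies these with the sheaves \<open>fobj F i\<close>.\<close>

lemma sheaf_G: "is_sheaf X (grMod_cat R) gr_prod G"
  unfolding G.is_sheaf_iff_deg
  using is_sheaf_iso[OF psh_F G.functor_deg_psh \<Theta>_nat _ sheaf_F] \<Theta>_hom_bij(2) by simp

text \<open>\<Theta> is treated on three levels: over each open set it is a bijective homomorphism,
  by naturality over the open sets an isomorphism of sheaves, and by naturality over the degrees an
  isomorphism of sequences.\<close>

lemma isomorphic_deg_seq_G: "isomorphic_in (Fun_cat nat_cat (Shv_Mod X R)) F (deg_seq X R G)"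
  unfolding isomorphic_in_def
proof (intro exI is_iso_Fun_catI[OF category_Shv_Mod F G.functor_deg_seq[OF sheaf_G]])
  show "is_iso (Shv_Mod X R) (fobj F i) (fobj (deg_seq X R G) i) (\<Theta> i)" if "i \<in> Ob nat_cat" for i
    unfolding Shv_Mod_def is_iso_full_subcat
  proof (rule is_iso_Fun_catI[OF category_Mod_cat psh_F])
    fix U assume "U \<in> Ob (opens_op X)"
    then have U: "openin X U" by simp
    then show "is_iso (Mod_cat R) (fobj (fobj F i) U) (fobj (fobj (deg_seq X R G) i) U) (\<Theta> i U)"
      using \<Theta>_hom_bij[OF U] psh.module_obj[OF U] gr_module.module_deg_part[OF G.gr_module_obj[OF U]]
      by (simp add: is_iso_Mod_cat_iff)
  qed (simp_all add: G.functor_deg_psh \<Theta>_nat)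
  show "\<Theta> \<in> nat_trans nat_cat (Shv_Mod X R) F (deg_seq X R G)"
  proof (rule nat_transI)
    fix i j f assume "f \<in> Mor nat_cat i j"
    then have ij: "i \<le> j" by simp
    have "e U (sg U j (\<tau> U i j x)) = monom (UP R) \<one>\<^bsub>R\<^esub> (j - i) \<odot>\<^bsub>fobj G U\<^esub> e U (sg U i x) \<and>
        \<tau> U i j x \<in> carrier (N U j) \<and> e U (sg U i x) \<in> grade (fobj G U) i"
      if U: "openin X U" and x: "x \<in> carrier (N U i)" for U x
    proof -
      interpret mod_seq R "N U" "\<tau> U" by (rule mod_seq_F[OF U])
      have "\<tau> U i j x \<in> carrier (N U j)" using ij x by simp
      then show ?thesis
        using x ij monom_smult_single[OF U.R.one_closed x, of "j - i"] single_in_grade[OF x]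
        by (simp add: G_obj t U dsum_grade_closed del: dsum_simps)
    qed
    then show "Cmp (Shv_Mod X R) (fobj F i) (fobj F j) (fobj (deg_seq X R G) j) (\<Theta> j) (fmap F i j f) =
        Cmp (Shv_Mod X R) (fobj F i) (fobj (deg_seq X R G) i) (fobj (deg_seq X R G) j)
          (fmap (deg_seq X R G) i j f) (\<Theta> i)"
      by (auto simp: fun_eq_iff compose_def \<Theta>_def)
  qed (simp_all add: \<Theta>_nat)
qed

end

theorem deg_fctr_ess_surj:
  fixes R :: "('r, 'e) ring_scheme" and X :: "'x topology"
    and F :: "(nat, unit, ('x set, unit, ('r, 'a) module, 'a \<Rightarrow> 'a) fctr, 'x set \<Rightarrow> 'a \<Rightarrow> 'a) fctr"
  assumes R: "cring R" and inf: "infinite (UNIV :: 'a set)"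
    and F: "F \<in> Ob (Fun_cat nat_cat (Shv_Mod X R))"
  shows "\<exists>G \<in> Ob (Shv_grMod X R). isomorphic_in (Fun_cat nat_cat (Shv_Mod X R)) F (fobj (deg_fctr X R) G)"
proof -
  \<comment> \<open>Each \<open>U\<close> gets its own encoding because the default values are the
    zeros over \<open>U\<close>; a suitable injection exists for any default values, so
    \<open>U\<close> need not be open here.\<close>
  define e :: "'x set \<Rightarrow> (nat \<Rightarrow> 'a) \<Rightarrow> 'a"
    where "e U = (SOME f. inj_on f {c. finite {n. c n \<noteq> \<zero>\<^bsub>fobj (fobj F n) U\<^esub>}})" for U
  have e: "inj_on (e U) {c. finite {n. c n \<noteq> \<zero>\<^bsub>fobj (fobj F n) U\<^esub>}}" for U
    unfolding e_def by (rule someI_ex[OF ex_inj_finite_support[OF inf]])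
  interpret sheaf_seq X R F e
    by (rule sheaf_seq.intro[OF R _ e]) (use F in simp)
  show ?thesis
  proof
    show "G \<in> Ob (Shv_grMod X R)" using sheaf_G functor_G by simp
    show "isomorphic_in (Fun_cat nat_cat (Shv_Mod X R)) F (fobj (deg_fctr X R) G)"
      using isomorphic_deg_seq_G by simp
  qed
qed

section \<open>Finite generation\<close>

text \<open>Negatives are multiples by -1, so closure under scalars provides them.\<close>

lemma (in Module.module) submoduleI':
  assumes "H \<subseteq> carrier M" and "\<zero>\<^bsub>M\<^esub> \<in> H"
    and "\<And>x y. x \<in> H \<Longrightarrow> y \<in> H \<Longrightarrow> x \<oplus>\<^bsub>M\<^esub> y \<in> H"
    and smult: "\<And>r x. r \<in> carrier R \<Longrightarrow> x \<in> H \<Longrightarrow> r \<odot>\<^bsub>M\<^esub> x \<in> H"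
  shows "submodule H R M"
proof (rule submoduleI)
  show "\<ominus>\<^bsub>M\<^esub> x \<in> H" if x: "x \<in> H" for x
    using smult[of "\<ominus>\<^bsub>R\<^esub> \<one>\<^bsub>R\<^esub>" x] x assms(1) by (auto simp: smult_l_minus)
qed (use assms in auto)

lemma submoduleD:
  assumes "submodule H R M"
  shows "x \<in> H \<Longrightarrow> x \<in> carrier M" and "\<zero>\<^bsub>M\<^esub> \<in> H"
    and "x \<in> H \<Longrightarrow> y \<in> H \<Longrightarrow> x \<oplus>\<^bsub>M\<^esub> y \<in> H"
    and "x \<in> H \<Longrightarrow> \<ominus>\<^bsub>M\<^esub> x \<in> H"
    and "r \<in> carrier R \<Longrightarrow> x \<in> H \<Longrightarrow> r \<odot>\<^bsub>M\<^esub> x \<in> H"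
proof -
  interpret submodule H R M by fact
  show "x \<in> H \<Longrightarrow> x \<in> carrier M" "\<zero>\<^bsub>M\<^esub> \<in> H" "x \<in> H \<Longrightarrow> y \<in> H \<Longrightarrow> x \<oplus>\<^bsub>M\<^esub> y \<in> H"
    "x \<in> H \<Longrightarrow> \<ominus>\<^bsub>M\<^esub> x \<in> H" "r \<in> carrier R \<Longrightarrow> x \<in> H \<Longrightarrow> r \<odot>\<^bsub>M\<^esub> x \<in> H"
    using subset one_closed m_closed m_inv_closed by (auto simp: a_inv_def)
qed

lemma submodule_vimage:
  assumes M: "Module.module R M" and N: "Module.module R N" and f: "f \<in> mod_hom R M N"
    and H: "submodule H R N"
  shows "submodule {x \<in> carrier M. f x \<in> H} R M"
proof -
  interpret M: Module.module R M by fact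
  interpret N: Module.module R N by fact
  show ?thesis
    using mod_hom_zero[OF M.abelian_group_axioms N.abelian_group_axioms f]
    by (intro M.submoduleI') (auto simp: mod_homD[OF f] submoduleD[OF H])
qed

lemma submodule_image:
  assumes M: "Module.module R M" and N: "Module.module R N" and f: "f \<in> mod_hom R M N"
  shows "submodule (f ` carrier M) R N"
proof -
  interpret M: Module.module R M by fact
  interpret N: Module.module R N by fact
  show ?thesis
  proof (rule N.submoduleI')
    show "\<zero>\<^bsub>N\<^esub> \<in> f ` carrier M"
      using mod_hom_zero[OF M.abelian_group_axioms N.abelian_group_axioms f] by (metis M.zero_closed imageI)
    fix u v assume "u \<in> f ` carrier M" "v \<in> f ` carrier M"
    then obtain x y where xy: "x \<in> carrier M" "y \<in> carrier M" "u = f x" "v = f y" by blast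
    then have "u \<oplus>\<^bsub>N\<^esub> v = f (x \<oplus>\<^bsub>M\<^esub> y)" by (simp add: mod_homD(2)[OF f])
    then show "u \<oplus>\<^bsub>N\<^esub> v \<in> f ` carrier M" using xy by simp
  next
    fix r u assume r: "r \<in> carrier R" and "u \<in> f ` carrier M"
    then obtain x where x: "x \<in> carrier M" "u = f x" by blast
    then have "r \<odot>\<^bsub>N\<^esub> u = f (r \<odot>\<^bsub>M\<^esub> x)" using r by (simp add: mod_homD(3)[OF f])
    then show "r \<odot>\<^bsub>N\<^esub> u \<in> f ` carrier M" using x r by simp
  qed (auto simp: mod_homD(1)[OF f])
qed

section \<open>Spans and finite generation\<close>

definition mspan :: "('r, 'e) ring_scheme \<Rightarrow> ('r, 'a, 'b) module_scheme \<Rightarrow> 'a set \<Rightarrow> 'a set" where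
  "mspan R M S = \<Inter>{H. submodule H R M \<and> S \<subseteq> H}"

lemma mspan_least: "submodule H R M \<Longrightarrow> S \<subseteq> H \<Longrightarrow> mspan R M S \<subseteq> H"
  by (auto simp: mspan_def)

lemma mspan_superset: "S \<subseteq> mspan R M S"
  by (auto simp: mspan_def)

lemma submodule_mspan:
  assumes "Module.module R M" and "S \<subseteq> carrier M"
  shows "submodule (mspan R M S) R M"
proof -
  interpret Module.module R M by fact
  show ?thesis
    using carrier_is_submodule assms(2)
    by (intro submoduleI') (auto simp: mspan_def intro: submoduleD(2,3,5))
qed

text \<open>The span is the least submodule containing \<open>S\<close>, so it is everything iff
  every such submodule is. Generators of degree parts are handled in this form.\<close>

lemma fin_gen_module_iff:
  assumes "Module.module R M"
  shows "fin_gen_module R M \<longleftrightarrow> (\<exists>S \<subseteq> carrier M. finite S \<and> mspan R M S = carrier M)"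
proof -
  interpret Module.module R M by fact
  have "(\<forall>H. submodule H R M \<and> S \<subseteq> H \<longrightarrow> H = carrier M) \<longleftrightarrow> mspan R M S = carrier M"
    if S: "S \<subseteq> carrier M" for S
  proof
    assume "\<forall>H. submodule H R M \<and> S \<subseteq> H \<longrightarrow> H = carrier M"
    then show "mspan R M S = carrier M" 
      using submodule_mspan[OF assms S] mspan_superset[of S R M] by blast
  next
    assume "mspan R M S = carrier M"
    then show "\<forall>H. submodule H R M \<and> S \<subseteq> H \<longrightarrow> H = carrier M"
      using mspan_least[of _ R M S] submoduleD(1)[of _ R M] by blast
  qed
  then show ?thesis unfolding fin_gen_module_def by (simp cong: conj_cong)
qed

text \<open>Preimages of submodules are submodules, so the images of generators generate.\<close>

lemma fin_gen_module_surj: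
  assumes M: "Module.module R M" and N: "Module.module R N" and f: "f \<in> mod_hom R M N"
    and surj: "f ` carrier M = carrier N" and fg: "fin_gen_module R M"
  shows "fin_gen_module R N"
proof -
  obtain S where S: "S \<subseteq> carrier M" "finite S" "\<And>H. submodule H R M \<Longrightarrow> S \<subseteq> H \<Longrightarrow> H = carrier M"
    using fg by (auto simp: fin_gen_module_def)
  have "H = carrier N" if H: "submodule H R N" "f ` S \<subseteq> H" for H
  proof -
    have "{x \<in> carrier M. f x \<in> H} = carrier M"
      by (rule S(3)[OF submodule_vimage[OF M N f H(1)]]) (use S(1) H(2) in auto)
    then have "f ` carrier M \<subseteq> H" by blast
    then show ?thesis using surj submoduleD(1)[OF H(1)] by blast
  qed
  moreover have "f ` S \<subseteq> carrier N" using S(1) surj by blast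
  ultimately show ?thesis using S(2) unfolding fin_gen_module_def by blast
qed

text \<open>The sums of an element of the span of \<open>S\<close> and a multiple of
  \<open>g\<close> already form a submodule containing \<open>insert g S\<close>.\<close>

lemma mspan_insertE:
  assumes "Module.module R M" and S: "S \<subseteq> carrier M" and g: "g \<in> carrier M"
    and x: "x \<in> mspan R M (insert g S)"
  obtains y r where "y \<in> mspan R M S" "r \<in> carrier R" "x = y \<oplus>\<^bsub>M\<^esub> r \<odot>\<^bsub>M\<^esub> g"
proof -
  interpret Module.module R M by fact
  let ?L = "mspan R M S"
  note L = submoduleD[OF submodule_mspan[OF assms(1) S]]
  let ?H = "{y \<oplus>\<^bsub>M\<^esub> r \<odot>\<^bsub>M\<^esub> g | y r. y \<in> ?L \<and> r \<in> carrier R}"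
  have "submodule ?H R M"
  proof (rule submoduleI')
    show "?H \<subseteq> carrier M" using L(1) g by auto
    have "\<zero>\<^bsub>M\<^esub> = \<zero>\<^bsub>M\<^esub> \<oplus>\<^bsub>M\<^esub> \<zero>\<^bsub>R\<^esub> \<odot>\<^bsub>M\<^esub> g" using g by simp
    then show "\<zero>\<^bsub>M\<^esub> \<in> ?H" using L(2) by blast
  next
    fix u v assume "u \<in> ?H" "v \<in> ?H"
    then obtain y r z s where *: "y \<in> ?L" "r \<in> carrier R" "u = y \<oplus>\<^bsub>M\<^esub> r \<odot>\<^bsub>M\<^esub> g"
      "z \<in> ?L" "s \<in> carrier R" "v = z \<oplus>\<^bsub>M\<^esub> s \<odot>\<^bsub>M\<^esub> g" by blast
    then have "u \<oplus>\<^bsub>M\<^esub> v = (y \<oplus>\<^bsub>M\<^esub> z) \<oplus>\<^bsub>M\<^esub> (r \<oplus>\<^bsub>R\<^esub> s) \<odot>\<^bsub>M\<^esub> g"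
      using g L(1) by (simp add: smult_l_distr M.a_ac)
    then show "u \<oplus>\<^bsub>M\<^esub> v \<in> ?H" using * L(3) by blast
  next
    fix s u assume s: "s \<in> carrier R" and "u \<in> ?H"
    then obtain y r where *: "y \<in> ?L" "r \<in> carrier R" "u = y \<oplus>\<^bsub>M\<^esub> r \<odot>\<^bsub>M\<^esub> g" by blast
    then have "s \<odot>\<^bsub>M\<^esub> u = s \<odot>\<^bsub>M\<^esub> y \<oplus>\<^bsub>M\<^esub> (s \<otimes>\<^bsub>R\<^esub> r) \<odot>\<^bsub>M\<^esub> g"
      using g s L(1) by (simp add: smult_r_distr smult_assoc1)
    then show "s \<odot>\<^bsub>M\<^esub> u \<in> ?H" using * s L(5) by blast
  qed
  moreover have "insert g S \<subseteq> ?H"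
  proof -
    have "g = \<zero>\<^bsub>M\<^esub> \<oplus>\<^bsub>M\<^esub> \<one>\<^bsub>R\<^esub> \<odot>\<^bsub>M\<^esub> g" using g by simp
    then have "g \<in> ?H" using L(2) by blast
    moreover have "y \<in> ?H" if "y \<in> S" for y
    proof -
      have y: "y \<in> ?L" using subsetD[OF mspan_superset that] .
      then have "y = y \<oplus>\<^bsub>M\<^esub> \<zero>\<^bsub>R\<^esub> \<odot>\<^bsub>M\<^esub> g" using g L(1) by simp
      then show ?thesis using y by blast
    qed
    ultimately show ?thesis by blast
  qed
  ultimately have "x \<in> ?H" by (rule subsetD[OF mspan_least x])
  then show thesis using that by blast
qed

text \<open>The induction over the generators replaces the theorem that finitely generated modules over
  noetherian rings are noetherian: a new generator \<open>g\<close> contributes the chain of the ideals of those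
  \<open>r\<close> for which \<open>r g\<close> lies in \<open>K k\<close> modulo the span of the old generators.\<close>

lemma submodule_chain_stabilizes:
  assumes "noetherian_ring R" and "Module.module R M"
    and K: "\<And>k. submodule (K k) R M" and mono: "\<And>k. K k \<subseteq> K (Suc k)"
    and "finite S" and "S \<subseteq> carrier M"
  shows "\<exists>m. \<forall>k \<ge> m. K k \<inter> mspan R M S \<subseteq> K m"
  using \<open>finite S\<close> \<open>S \<subseteq> carrier M\<close>
proof (induction S)
  case empty
  interpret Module.module R M by fact
  have "submodule {\<zero>\<^bsub>M\<^esub>} R M" by (intro submoduleI') auto
  then have "mspan R M {} \<subseteq> {\<zero>\<^bsub>M\<^esub>}" by (rule mspan_least) simp
  then show ?case using submoduleD(2)[OF K[of 0]] by auto
next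
  case (insert g S)
  interpret Module.module R M by fact
  interpret nr: noetherian_ring R by fact
  have S: "S \<subseteq> carrier M" and g: "g \<in> carrier M" using insert.prems by auto
  note K' = submoduleD[OF K]
  have mono': "K i \<subseteq> K j" if "i \<le> j" for i j using lift_Suc_mono_le[of K, OF mono that] .
  let ?L = "mspan R M S"
  note L = submoduleD[OF submodule_mspan[OF assms(2) S]]
  obtain m where m: "\<And>k. k \<ge> m \<Longrightarrow> K k \<inter> ?L \<subseteq> K m" using insert.IH[OF S] by blast
  define J where "J k = {r \<in> carrier R. \<exists>y \<in> ?L. r \<odot>\<^bsub>M\<^esub> g \<oplus>\<^bsub>M\<^esub> y \<in> K k}" for k
  have "ideal (J k) R" for k
  proof (rule idealI)
    have smult: "s \<otimes>\<^bsub>R\<^esub> r \<in> J k" if "r \<in> J k" "s \<in> carrier R" for r s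
    proof -
      obtain y where y: "r \<in> carrier R" "y \<in> ?L" "r \<odot>\<^bsub>M\<^esub> g \<oplus>\<^bsub>M\<^esub> y \<in> K k" using \<open>r \<in> J k\<close> by (auto simp: J_def)
      have "(s \<otimes>\<^bsub>R\<^esub> r) \<odot>\<^bsub>M\<^esub> g \<oplus>\<^bsub>M\<^esub> s \<odot>\<^bsub>M\<^esub> y = s \<odot>\<^bsub>M\<^esub> (r \<odot>\<^bsub>M\<^esub> g \<oplus>\<^bsub>M\<^esub> y)"
        using y that g L(1) by (simp add: smult_r_distr smult_assoc1)
      then have "(s \<otimes>\<^bsub>R\<^esub> r) \<odot>\<^bsub>M\<^esub> g \<oplus>\<^bsub>M\<^esub> s \<odot>\<^bsub>M\<^esub> y \<in> K k" using K'(5)[OF that(2) y(3)] by simp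
      then show ?thesis using y(1) that(2) L(5)[OF that(2) y(2)] unfolding J_def by blast
    qed
    show "ring R" ..
    show "s \<otimes>\<^bsub>R\<^esub> r \<in> J k" if "r \<in> J k" "s \<in> carrier R" for r s using smult that .
    show "r \<otimes>\<^bsub>R\<^esub> s \<in> J k" if "r \<in> J k" "s \<in> carrier R" for r s
      using smult[OF that] that by (simp add: J_def R.m_comm)
    show "subgroup (J k) (add_monoid R)"
    proof (rule R.add.subgroupI)
      have "\<zero>\<^bsub>R\<^esub> \<in> J k" using g L(2) K'(2) by (auto simp: J_def intro!: bexI[of _ "\<zero>\<^bsub>M\<^esub>"])
      then show "J k \<noteq> {}" by blast
      show "\<ominus>\<^bsub>R\<^esub> r \<in> J k" if "r \<in> J k" for r
        using smult[OF that, of "\<ominus>\<^bsub>R\<^esub> \<one>\<^bsub>R\<^esub>"] that by (auto simp: J_def R.l_minus)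
      fix r s assume "r \<in> J k" "s \<in> J k"
      then obtain y z where *: "r \<in> carrier R" "y \<in> ?L" "r \<odot>\<^bsub>M\<^esub> g \<oplus>\<^bsub>M\<^esub> y \<in> K k"
        "s \<in> carrier R" "z \<in> ?L" "s \<odot>\<^bsub>M\<^esub> g \<oplus>\<^bsub>M\<^esub> z \<in> K k" by (auto simp: J_def)
      have "(r \<oplus>\<^bsub>R\<^esub> s) \<odot>\<^bsub>M\<^esub> g \<oplus>\<^bsub>M\<^esub> (y \<oplus>\<^bsub>M\<^esub> z) = (r \<odot>\<^bsub>M\<^esub> g \<oplus>\<^bsub>M\<^esub> y) \<oplus>\<^bsub>M\<^esub> (s \<odot>\<^bsub>M\<^esub> g \<oplus>\<^bsub>M\<^esub> z)"
        using * g L(1) by (simp add: smult_l_distr M.a_ac)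
      then have "(r \<oplus>\<^bsub>R\<^esub> s) \<odot>\<^bsub>M\<^esub> g \<oplus>\<^bsub>M\<^esub> (y \<oplus>\<^bsub>M\<^esub> z) \<in> K k" using K'(3)[OF *(3) *(6)] by simp
      then show "r \<oplus>\<^bsub>R\<^esub> s \<in> J k" using *(1,4) L(3)[OF *(2) *(5)] unfolding J_def by blast
    qed (auto simp: J_def)
  qed
  moreover have J_mono: "J i \<subseteq> J j" if "i \<le> j" for i j using mono'[OF that] by (auto simp: J_def)
  then have "J i \<subseteq> J j \<or> J j \<subseteq> J i" for i j using nat_le_linear by blast
  \<comment> \<open>In a noetherian ring the union of a nonempty chain of ideals is a member of the
    chain.\<close>
  ultimately have "\<Union>(range J) \<in> range J"
    by (intro nr.ideal_chain_is_trivial) (auto simp: subset_chain_def)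
  then obtain m' where m': "\<And>k. J k \<subseteq> J m'" by blast
  let ?m = "max m m'"
  have "K k \<inter> mspan R M (insert g S) \<subseteq> K ?m" if k: "k \<ge> ?m" for k
  proof
    fix x assume x: "x \<in> K k \<inter> mspan R M (insert g S)"
    then obtain y r where y: "y \<in> ?L" and r: "r \<in> carrier R" and xe: "x = y \<oplus>\<^bsub>M\<^esub> r \<odot>\<^bsub>M\<^esub> g"
      using mspan_insertE[OF assms(2) S g] by blast
    have yc: "y \<in> carrier M" using y L(1) by simp
    have "r \<odot>\<^bsub>M\<^esub> g \<oplus>\<^bsub>M\<^esub> y \<in> K k" using x r g yc by (simp add: xe M.a_comm)
    then have "r \<in> J k" using y r unfolding J_def by blast
    then obtain z where z: "z \<in> ?L" "r \<odot>\<^bsub>M\<^esub> g \<oplus>\<^bsub>M\<^esub> z \<in> K m'" using m'[of k] by (auto simp: J_def)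
    have zc: "z \<in> carrier M" using z L(1) by simp
    have zk: "r \<odot>\<^bsub>M\<^esub> g \<oplus>\<^bsub>M\<^esub> z \<in> K k" using z(2) mono'[of m' k] k by auto
    \<comment> \<open>Subtracting an element of \<open>K m'\<close> with the same coefficient of
      \<open>g\<close> leaves \<open>x\<close> as the difference of \<open>y\<close> and
      \<open>z\<close> in the old span, where the induction hypothesis applies. The subtracted
      element is added back afterwards.\<close>
    have eq: "y \<oplus>\<^bsub>M\<^esub> \<ominus>\<^bsub>M\<^esub> z = x \<oplus>\<^bsub>M\<^esub> \<ominus>\<^bsub>M\<^esub> (r \<odot>\<^bsub>M\<^esub> g \<oplus>\<^bsub>M\<^esub> z)"
      using yc zc r g by (simp add: xe M.minus_add M.a_ac M.r_neg M.r_neg1 M.r_neg2)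
    have "y \<oplus>\<^bsub>M\<^esub> \<ominus>\<^bsub>M\<^esub> z \<in> K k \<inter> ?L"
      using x zk K'(3,4) L(3,4) y z(1) by (simp add: eq[symmetric]) (simp add: eq K'(3,4))
    then have "y \<oplus>\<^bsub>M\<^esub> \<ominus>\<^bsub>M\<^esub> z \<in> K ?m" using m[of k] k mono'[of m ?m] by auto
    moreover have "r \<odot>\<^bsub>M\<^esub> g \<oplus>\<^bsub>M\<^esub> z \<in> K ?m" using z(2) mono'[of m' ?m] by auto
    moreover have "x = (y \<oplus>\<^bsub>M\<^esub> \<ominus>\<^bsub>M\<^esub> z) \<oplus>\<^bsub>M\<^esub> (r \<odot>\<^bsub>M\<^esub> g \<oplus>\<^bsub>M\<^esub> z)"
      using yc zc r g by (simp add: xe M.a_ac M.r_neg1 M.r_neg2)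
    ultimately show "x \<in> K ?m" using K'(3) by simp
  qed
  then show ?case by blast
qed

text \<open>Only zero and closure under addition are asked of \<open>H\<close>, so that the lemma is
  available while \<open>H\<close> is still being shown to be a submodule.\<close>

lemma (in abelian_monoid) finsum_mem:
  assumes "finite A" and "H \<subseteq> carrier G" and "\<zero> \<in> H"
    and "\<And>x y. x \<in> H \<Longrightarrow> y \<in> H \<Longrightarrow> x \<oplus> y \<in> H" and "f \<in> A \<rightarrow> H"
  shows "finsum G f A \<in> H"
  using \<open>finite A\<close> \<open>f \<in> A \<rightarrow> H\<close>
proof (induction A)
  case (insert a A)
  then have "f \<in> A \<rightarrow> carrier G" "f a \<in> carrier G" using assms(2) by auto
  with insert assms(4) show ?case by simp
qed (use assms in simp)

section \<open>Finitely generated graded modules and their degree parts\<close>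

context gr_module
begin

text \<open>A submodule containing the generators of degrees up to \<open>m\<close> contains these
  degree parts, then each further one by surjectivity of t, and so all finite sums of homogeneous
  elements.\<close>

lemma fin_gen_if_deg_parts:
  assumes fg: "\<And>i. fin_gen_module R (deg_part R M i)"
    and surj: "\<And>i y. i \<ge> m \<Longrightarrow> y \<in> grade M (Suc i) \<Longrightarrow> \<exists>x \<in> grade M i. y = mon \<one>\<^bsub>R\<^esub> 1 \<odot>\<^bsub>M\<^esub> x"
  shows "fin_gen_module (UP R) M"
proof -
  obtain S where S: "\<And>i. S i \<subseteq> grade M i" "\<And>i. finite (S i)"
    and gen: "\<And>i H. submodule H R (deg_part R M i) \<Longrightarrow> S i \<subseteq> H \<Longrightarrow> H = grade M i"
    using fg unfolding fin_gen_module_def deg_part_simps by metis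
  have "H = carrier M" if H: "submodule H (UP R) M" and SH: "(\<Union>i \<in> {..m}. S i) \<subseteq> H" for H
  proof -
    note h = submoduleD[OF H]
    have low: "grade M i \<subseteq> H" if "i \<le> m" for i
    proof -
      interpret d: Module.module R "deg_part R M i" by (rule module_deg_part)
      \<comment> \<open>Constants are among the scalars, so a submodule over \<open>R[t]\<close>
        meets each degree part in a submodule over \<open>R\<close>.\<close>
      have "submodule (H \<inter> grade M i) R (deg_part R M i)"
        using grade_smult[of _ _ i 0] h by (intro d.submoduleI') (auto simp: grade_add)
      from gen[OF this] show ?thesis using S(1) SH that by blast
    qed
    have "grade M i \<subseteq> H" for i
    proof (induction i)
      case 0 then show ?case using low by simp
    next
      case (Suc i)
      show ?case
      proof (cases "Suc i \<le> m")
        case False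
        then show ?thesis using surj[of i] Suc h(5)[of "mon \<one>\<^bsub>R\<^esub> 1"] by fastforce
      qed (rule low)
    qed
    then have gc: "gcomp M x n \<in> H" if "x \<in> carrier M" for x n using gcomp_in[OF that] by blast
    have "x \<in> H" if x: "x \<in> carrier M" for x
      using finsum_mem[OF finite_gcomp[OF x] _ h(2,3), of "gcomp M x"] gc[OF x] h(1) gcomp_finsum[OF x]
      by auto
    then show ?thesis using h(1) by blast
  qed
  moreover have "(\<Union>i \<in> {..m}. S i) \<subseteq> carrier M" "finite (\<Union>i \<in> {..m}. S i)"
    using S(1) grade_closed by blast (simp add: S(2))
  ultimately show ?thesis unfolding fin_gen_module_def by blast
qed

text \<open>\<open>T\<close> holds homogeneous generators paired with their degrees. Those of degree
  at most \<open>i\<close> are multiplied into degree \<open>i\<close> by a power of t; since t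
  raises degrees, the others cannot contribute there.\<close>

definition hgens :: "(nat \<times> 'a) set \<Rightarrow> nat \<Rightarrow> 'a set" where
  "hgens T i = (\<lambda>(n, y). mon \<one>\<^bsub>R\<^esub> (i - n) \<odot>\<^bsub>M\<^esub> y) ` {(n, y) \<in> T. n \<le> i}"

lemma hgens_subset:
  assumes "\<And>n y. (n, y) \<in> T \<Longrightarrow> y \<in> grade M n"
  shows "hgens T i \<subseteq> grade M i"
proof
  fix z assume "z \<in> hgens T i"
  then obtain n y where "(n, y) \<in> T" "n \<le> i" "z = mon \<one>\<^bsub>R\<^esub> (i - n) \<odot>\<^bsub>M\<^esub> y"
    by (auto simp: hgens_def)
  then show "z \<in> grade M i" using grade_smult[of "\<one>\<^bsub>R\<^esub>" y n "i - n"] assms[of n y] by simp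
qed

text \<open>\<open>T\<close> consists of the nonzero components of given generators. The elements
  whose components all lie in the spans \<open>L i\<close> form a set \<open>H\<close> that is
  stable under \<open>R[t]\<close> and contains the given generators, so \<open>H\<close> is
  everything and each \<open>L i\<close> is a full degree part.\<close>

lemma fin_gen_hgensE:
  assumes fg: "fin_gen_module (UP R) M"
  obtains T where "finite T" "\<And>n y. (n, y) \<in> T \<Longrightarrow> y \<in> grade M n"
    "\<And>i. mspan R (deg_part R M i) (hgens T i) = grade M i"
proof -
  obtain S where S: "S \<subseteq> carrier M" "finite S"
    and gen: "\<And>H. submodule H (UP R) M \<Longrightarrow> S \<subseteq> H \<Longrightarrow> H = carrier M"
    using fg unfolding fin_gen_module_def by blast
  define T where "T = (\<Union>s \<in> S. (\<lambda>n. (n, gcomp M s n)) ` {n. gcomp M s n \<noteq> \<zero>\<^bsub>M\<^esub>})"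
  have T: "finite T" using S finite_gcomp by (auto simp: T_def)
  have Tg: "y \<in> grade M n" if "(n, y) \<in> T" for n y
    using that S gcomp_in by (auto simp: T_def)
  define L where "L i = mspan R (deg_part R M i) (hgens T i)" for i
  have L: "submodule (L i) R (deg_part R M i)" for i
    unfolding L_def using hgens_subset[OF Tg] by (intro submodule_mspan module_deg_part) simp
  note l = submoduleD[OF L, unfolded deg_part_simps]
  \<comment> \<open>Generators of \<open>L i\<close> are mapped to generators of
    \<open>L (k + i)\<close>, and the preimage of \<open>L (k + i)\<close> is a submodule. The
    exponent \<open>k + i - i\<close> below is the form in which \<open>shift_hom\<close> supplies
    \<open>k\<close>.\<close>
  have shift: "mon \<one>\<^bsub>R\<^esub> k \<odot>\<^bsub>M\<^esub> x \<in> L (k + i)" if x: "x \<in> L i" for k i x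
  proof -
    let ?f = "\<lambda>x \<in> grade M i. mon \<one>\<^bsub>R\<^esub> (k + i - i) \<odot>\<^bsub>M\<^esub> x"
    let ?H = "{x \<in> carrier (deg_part R M i). ?f x \<in> L (k + i)}"
    have "submodule ?H R (deg_part R M i)"
      by (rule submodule_vimage[OF module_deg_part module_deg_part shift_hom L]) simp
    moreover have "hgens T i \<subseteq> ?H"
    proof
      fix z assume z: "z \<in> hgens T i"
      then obtain n y where ny: "(n, y) \<in> T" "n \<le> i" and ze: "z = mon \<one>\<^bsub>R\<^esub> (i - n) \<odot>\<^bsub>M\<^esub> y"
        by (auto simp: hgens_def)
      have zg: "z \<in> grade M i" using z hgens_subset[OF Tg] by blast
      have "mon \<one>\<^bsub>R\<^esub> k \<odot>\<^bsub>M\<^esub> z = mon \<one>\<^bsub>R\<^esub> (k + i - n) \<odot>\<^bsub>M\<^esub> y"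
        using ny grade_closed[OF Tg[OF ny(1)]] by (simp add: ze monom_smult_monom)
      also have "\<dots> \<in> hgens T (k + i)" using ny by (force simp: hgens_def)
      finally show "z \<in> ?H" 
          using zg by (auto simp: L_def intro: subsetD[OF mspan_superset])
    qed
    ultimately have "L i \<subseteq> ?H" unfolding L_def[of i] by (rule mspan_least)
    then show ?thesis using x by auto
  qed
  have shift_smult: "mon r k \<odot>\<^bsub>M\<^esub> x \<in> L (k + i)" if r: "r \<in> carrier R" and x: "x \<in> L i" for r k i x
    using l(5)[OF r shift[OF x, of k]] r grade_closed[OF l(1)[OF x]] by (simp add: monom_smult_monom)
  define H where "H = {x \<in> carrier M. \<forall>i. gcomp M x i \<in> L i}"
  have LH: "L i \<subseteq> H" for i
  proof
    fix x assume x: "x \<in> L i"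
    then show "x \<in> H"
      using l(2) grade_closed[OF l(1)[OF x]] by (auto simp: H_def gcomp_homogeneous[OF l(1)[OF x]])
  qed
  have H0: "\<zero>\<^bsub>M\<^esub> \<in> H" using l(2) by (simp add: H_def)
  have H_add: "x \<oplus>\<^bsub>M\<^esub> y \<in> H" if "x \<in> H" "y \<in> H" for x y
    using that l(3) by (simp add: H_def gcomp_add)
  have Hc: "H \<subseteq> carrier M" by (auto simp: H_def)
  note H_sum = finsum_mem[OF _ Hc H0 H_add]
  have mon_H: "mon r k \<odot>\<^bsub>M\<^esub> x \<in> H" if r: "r \<in> carrier R" and x: "x \<in> H" for r k x
  proof -
    have xc: "x \<in> carrier M" and xL: "\<And>i. gcomp M x i \<in> L i" using x by (auto simp: H_def)
    have "mon r k \<odot>\<^bsub>M\<^esub> x = (\<Oplus>\<^bsub>M\<^esub>n \<in> {n. gcomp M x n \<noteq> \<zero>\<^bsub>M\<^esub>}. mon r k \<odot>\<^bsub>M\<^esub> gcomp M x n)"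
      by (subst gcomp_finsum[OF xc, symmetric], subst finsum_smult_ldistr)
        (use r xc gcomp_closed finite_gcomp in auto)
    also have "\<dots> \<in> H"
      using finite_gcomp[OF xc] shift_smult[OF r xL] LH by (intro H_sum) blast+
    finally show ?thesis .
  qed
  have "submodule H (UP R) M"
  proof (rule submoduleI'[OF Hc H0 H_add])
    fix p x assume p: "p \<in> carrier (UP R)" and x: "x \<in> H"
    show "p \<odot>\<^bsub>M\<^esub> x \<in> H"
      unfolding smult_expand[OF p subsetD[OF Hc x]] using p x mon_H by (rule_tac H_sum) auto
  qed
  moreover have "S \<subseteq> H"
  proof
    fix s assume s: "s \<in> S"
    then have sc: "s \<in> carrier M" using S by blast
    have "gcomp M s i \<in> L i" for i
    proof (cases "gcomp M s i = \<zero>\<^bsub>M\<^esub>")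
      case False
      then have "(i, gcomp M s i) \<in> T" using s by (auto simp: T_def)
      \<comment> \<open>A generator occurs in its own degree with exponent 0.\<close>
      then have "mon \<one>\<^bsub>R\<^esub> (i - i) \<odot>\<^bsub>M\<^esub> gcomp M s i \<in> hgens T i" by (force simp: hgens_def)
      then have "gcomp M s i \<in> hgens T i" using gcomp_closed[OF sc] by simp
      then show ?thesis by (auto simp: L_def intro: subsetD[OF mspan_superset])
    qed (use l(2) in simp)
    then show "s \<in> H" using sc by (simp add: H_def)
  qed
  ultimately have HM: "H = carrier M" by (rule gen)
  have "L i = grade M i" for i
  proof
    show "grade M i \<subseteq> L i"
    proof
      fix x assume x: "x \<in> grade M i"
      then have "x \<in> H" using HM grade_closed by simp
      then have "gcomp M x i \<in> L i" by (simp add: H_def)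
      then show "x \<in> L i" using gcomp_homogeneous[OF x] by simp
    qed
  qed (use l(1) in blast)
  then show thesis using that[OF T Tg] by (simp add: L_def)
qed

lemma fin_gen_deg_part:
  assumes "fin_gen_module (UP R) M"
  shows "fin_gen_module R (deg_part R M i)"
proof -
  obtain T where T: "finite T" "\<And>n y. (n, y) \<in> T \<Longrightarrow> y \<in> grade M n"
    "\<And>i. mspan R (deg_part R M i) (hgens T i) = grade M i"
    using fin_gen_hgensE[OF assms] by blast
  have "finite {(n, y) \<in> T. n \<le> i}" using T(1) by (rule rev_finite_subset) auto
  then have "finite (hgens T i)" by (simp add: hgens_def)
  moreover have "hgens T i \<subseteq> grade M i" by (rule hgens_subset[OF T(2)])
  ultimately show ?thesis
    using T(3)[of i] unfolding fin_gen_module_iff[OF module_deg_part] deg_part_simps by blast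
qed

text \<open>\<open>d\<close> bounds the degrees of the generators. From there on every shifted
  generator in degree \<open>k + i\<close> is the k-th power of t times one in degree
  \<open>i\<close>, and the image of that power is a submodule.\<close>

lemma fin_gen_shift_surj:
  assumes "fin_gen_module (UP R) M"
  obtains d where "\<And>i k y. i \<ge> d \<Longrightarrow> y \<in> grade M (k + i) \<Longrightarrow> \<exists>x \<in> grade M i. y = mon \<one>\<^bsub>R\<^esub> k \<odot>\<^bsub>M\<^esub> x"
proof -
  obtain T where T: "finite T" "\<And>n y. (n, y) \<in> T \<Longrightarrow> y \<in> grade M n"
    "\<And>i. mspan R (deg_part R M i) (hgens T i) = grade M i"
    using fin_gen_hgensE[OF assms] by blast
  obtain d where d: "\<And>n y. (n, y) \<in> T \<Longrightarrow> n \<le> d"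
    using finite_imageI[OF T(1), of fst] unfolding finite_nat_set_iff_bounded_le by force
  have "\<exists>x \<in> grade M i. y = mon \<one>\<^bsub>R\<^esub> k \<odot>\<^bsub>M\<^esub> x" if i: "i \<ge> d" and y: "y \<in> grade M (k + i)" for i k y
  proof -
    let ?f = "\<lambda>x \<in> grade M i. mon \<one>\<^bsub>R\<^esub> (k + i - i) \<odot>\<^bsub>M\<^esub> x"
    have "submodule (?f ` carrier (deg_part R M i)) R (deg_part R M (k + i))"
      by (rule submodule_image[OF module_deg_part module_deg_part shift_hom]) simp
    moreover have "hgens T (k + i) \<subseteq> ?f ` carrier (deg_part R M i)"
    proof
      fix z assume "z \<in> hgens T (k + i)"
      then obtain n y where ny: "(n, y) \<in> T" and ze: "z = mon \<one>\<^bsub>R\<^esub> (k + i - n) \<odot>\<^bsub>M\<^esub> y"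
        by (auto simp: hgens_def)
      have n: "n \<le> i" using d[OF ny] i by simp
      have "mon \<one>\<^bsub>R\<^esub> (i - n) \<odot>\<^bsub>M\<^esub> y \<in> hgens T i" using ny n by (force simp: hgens_def)
      then have "mon \<one>\<^bsub>R\<^esub> (i - n) \<odot>\<^bsub>M\<^esub> y \<in> grade M i" using hgens_subset[OF T(2)] by blast
      moreover from this have "z = ?f (mon \<one>\<^bsub>R\<^esub> (i - n) \<odot>\<^bsub>M\<^esub> y)"
        using n grade_closed[OF T(2)[OF ny]] by (simp add: ze monom_smult_monom)
      ultimately show "z \<in> ?f ` carrier (deg_part R M i)" by simp
    qed
    ultimately have "grade M (k + i) \<subseteq> ?f ` carrier (deg_part R M i)"
      using mspan_least[of _ R "deg_part R M (k + i)" "hgens T (k + i)"] T(3)[of "k + i"] by simp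
    then show ?thesis using y by auto
  qed
  then show thesis by (rule that)
qed

text \<open>From degree \<open>d\<close> on, each degree part is the quotient of the part of degree
  \<open>d\<close> by the kernel of a power of t. Once these kernels are constant, t induces
  isomorphisms of the quotients.\<close>

lemma fin_gen_shift_bij:
  assumes nr: "noetherian_ring R" and fg: "fin_gen_module (UP R) M"
  shows "\<exists>m. \<forall>i \<ge> m. bij_betw (\<lambda>x. mon \<one>\<^bsub>R\<^esub> 1 \<odot>\<^bsub>M\<^esub> x) (grade M i) (grade M (Suc i))"
proof -
  obtain d where d: "\<And>i k y. i \<ge> d \<Longrightarrow> y \<in> grade M (k + i) \<Longrightarrow> \<exists>x \<in> grade M i. y = mon \<one>\<^bsub>R\<^esub> k \<odot>\<^bsub>M\<^esub> x"
    using fin_gen_shift_surj[OF fg] by blast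
  define K where "K k = {x \<in> grade M d. mon \<one>\<^bsub>R\<^esub> k \<odot>\<^bsub>M\<^esub> x = \<zero>\<^bsub>M\<^esub>}" for k
  have one: "\<one>\<^bsub>R\<^esub> \<in> carrier R" by simp
  have K_sub: "submodule (K k) R (deg_part R M d)" for k
  proof -
    let ?f = "\<lambda>x \<in> grade M d. mon \<one>\<^bsub>R\<^esub> (k + d - d) \<odot>\<^bsub>M\<^esub> x"
    interpret e: Module.module R "deg_part R M (k + d)" by (rule module_deg_part)
    have "submodule {\<zero>\<^bsub>M\<^esub>} R (deg_part R M (k + d))"
      by (intro e.submoduleI') auto
    from submodule_vimage[OF module_deg_part module_deg_part shift_hom this, of d]
    have "submodule {x \<in> grade M d. ?f x \<in> {\<zero>\<^bsub>M\<^esub>}} R (deg_part R M d)" by simp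
    moreover have "{x \<in> grade M d. ?f x \<in> {\<zero>\<^bsub>M\<^esub>}} = K k" by (auto simp: K_def)
    ultimately show ?thesis by simp
  qed
  have K_mono: "K k \<subseteq> K (Suc k)" for k
  proof
    fix x assume x: "x \<in> K k"
    then have "mon \<one>\<^bsub>R\<^esub> (Suc k) \<odot>\<^bsub>M\<^esub> x = mon \<one>\<^bsub>R\<^esub> 1 \<odot>\<^bsub>M\<^esub> (mon \<one>\<^bsub>R\<^esub> k \<odot>\<^bsub>M\<^esub> x)"
      using grade_closed by (subst monom_smult_monom) (auto simp: K_def)
    then show "x \<in> K (Suc k)" using x by (simp add: K_def)
  qed
  obtain S where S: "S \<subseteq> grade M d" "finite S" "mspan R (deg_part R M d) S = grade M d"
    using fin_gen_deg_part[OF fg, of d] by (auto simp: fin_gen_module_iff[OF module_deg_part])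
  have "\<exists>m. \<forall>k \<ge> m. K k \<inter> grade M d \<subseteq> K m"
    using submodule_chain_stabilizes[where K = K and M = "deg_part R M d", OF nr module_deg_part K_sub K_mono S(2)]
      S(1,3) by simp
  moreover have "K k \<inter> grade M d = K k" for k by (auto simp: K_def)
  ultimately obtain m where m: "\<And>k. k \<ge> m \<Longrightarrow> K k \<subseteq> K m" by auto
  have "bij_betw (\<lambda>x. mon \<one>\<^bsub>R\<^esub> 1 \<odot>\<^bsub>M\<^esub> x) (grade M i) (grade M (Suc i))" if i: "i \<ge> m + d" for i
    unfolding bij_betw_def
  proof
    define k where "k = i - d"
    have ik: "i = k + d" and km: "k \<ge> m" using i by (auto simp: k_def)
    \<comment> \<open>Write \<open>x\<close> as the k-th power of t times some \<open>y\<close> of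
      degree \<open>d\<close>. If t annihilates \<open>x\<close>, then \<open>y\<close> lies in
      \<open>K (Suc k)\<close>, hence in \<open>K m\<close> and in \<open>K k\<close>, so that
      \<open>x\<close> is zero.\<close>
    have inj0: "x = \<zero>\<^bsub>M\<^esub>" if x: "x \<in> grade M i" and x0: "mon \<one>\<^bsub>R\<^esub> 1 \<odot>\<^bsub>M\<^esub> x = \<zero>\<^bsub>M\<^esub>" for x
    proof -
      obtain y where y: "y \<in> grade M d" "x = mon \<one>\<^bsub>R\<^esub> k \<odot>\<^bsub>M\<^esub> y" using d[of d x k] x ik by auto
      have "mon \<one>\<^bsub>R\<^esub> (Suc k) \<odot>\<^bsub>M\<^esub> y = mon \<one>\<^bsub>R\<^esub> 1 \<odot>\<^bsub>M\<^esub> x"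
        using y grade_closed by (simp add: monom_smult_monom)
      then have "y \<in> K (Suc k)" using x0 y by (simp add: K_def)
      then have "y \<in> K k" using m[of "Suc k"] lift_Suc_mono_le[of K, OF K_mono km] km by auto
      then show ?thesis using y by (simp add: K_def)
    qed
    show "inj_on (\<lambda>x. mon \<one>\<^bsub>R\<^esub> 1 \<odot>\<^bsub>M\<^esub> x) (grade M i)"
    proof (rule inj_onI)
      fix x y assume x: "x \<in> grade M i" and y: "y \<in> grade M i"
        and eq: "mon \<one>\<^bsub>R\<^esub> 1 \<odot>\<^bsub>M\<^esub> x = mon \<one>\<^bsub>R\<^esub> 1 \<odot>\<^bsub>M\<^esub> y"
      have xc: "x \<in> carrier M" "y \<in> carrier M" using x y grade_closed by auto
      have "mon \<one>\<^bsub>R\<^esub> 1 \<odot>\<^bsub>M\<^esub> (x \<oplus>\<^bsub>M\<^esub> \<ominus>\<^bsub>M\<^esub> y) = \<zero>\<^bsub>M\<^esub>"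
        using xc eq by (simp add: smult_r_distr smult_r_minus r_neg)
      then have "x \<oplus>\<^bsub>M\<^esub> \<ominus>\<^bsub>M\<^esub> y = \<zero>\<^bsub>M\<^esub>" 
        by (rule inj0[OF grade_add[OF x grade_inv[OF y]]])
      then show "x = y" using xc minus_equality[of x "\<ominus>\<^bsub>M\<^esub> y"] by simp
    qed
    show "(\<lambda>x. mon \<one>\<^bsub>R\<^esub> 1 \<odot>\<^bsub>M\<^esub> x) ` grade M i = grade M (Suc i)"
    proof
      show "(\<lambda>x. mon \<one>\<^bsub>R\<^esub> 1 \<odot>\<^bsub>M\<^esub> x) ` grade M i \<subseteq> grade M (Suc i)"
        using grade_smult[OF one, of _ i 1] by auto
      show "grade M (Suc i) \<subseteq> (\<lambda>x. mon \<one>\<^bsub>R\<^esub> 1 \<odot>\<^bsub>M\<^esub> x) ` grade M i"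
        using d[of i _ 1] i by auto
    qed
  qed
  then show ?thesis by blast
qed

end

section \<open>Functors of finite type and sheaves with finitely generated sections\<close>

lemma (in gr_presheaf) is_iso_deg_seq_iff:
  assumes sheaf: "is_sheaf X (grMod_cat R) gr_prod G"
  shows "is_iso (Shv_Mod X R) (deg_psh R G i) (deg_psh R G (i + 1)) (fmap (deg_seq X R G) i (i + 1) ()) \<longleftrightarrow>
    (\<forall>U. openin X U \<longrightarrow> bij_betw (\<lambda>x. monom (UP R) \<one>\<^bsub>R\<^esub> 1 \<odot>\<^bsub>fobj G U\<^esub> x)
      (grade (fobj G U) i) (grade (fobj G U) (Suc i)))" (is "is_iso _ _ _ ?f \<longleftrightarrow> ?bij")
proof -
  have f: "?f \<in> nat_trans (opens_op X) (Mod_cat R) (deg_psh R G i) (deg_psh R G (i + 1))"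
    using is_functorD(2)[OF functor_deg_seq[OF sheaf], of i "i + 1" "()"] by simp
  have iff: "is_iso (Mod_cat R) (deg_part R (fobj G U) i) (deg_part R (fobj G U) (i + 1)) (?f U) \<longleftrightarrow>
      bij_betw (\<lambda>x. monom (UP R) \<one>\<^bsub>R\<^esub> 1 \<odot>\<^bsub>fobj G U\<^esub> x) (grade (fobj G U) i) (grade (fobj G U) (Suc i))"
    if U: "openin X U" for U
  proof -
    have "?f U \<in> mod_hom R (deg_part R (fobj G U) i) (deg_part R (fobj G U) (i + 1))"
      using nat_transD(1)[OF f, of U] U by simp
    then have "is_iso (Mod_cat R) (deg_part R (fobj G U) i) (deg_part R (fobj G U) (i + 1)) (?f U) \<longleftrightarrow>
        bij_betw (?f U) (grade (fobj G U) i) (grade (fobj G U) (Suc i))"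
      using gr_module.module_deg_part[OF gr_module_obj[OF U]] by (simp add: is_iso_Mod_cat_iff)
    also have "\<dots> \<longleftrightarrow> bij_betw (\<lambda>x. monom (UP R) \<one>\<^bsub>R\<^esub> 1 \<odot>\<^bsub>fobj G U\<^esub> x)
        (grade (fobj G U) i) (grade (fobj G U) (Suc i))"
      using U by (intro bij_betw_cong) simp
    finally show ?thesis .
  qed
  show ?thesis
    unfolding Shv_Mod_def is_iso_full_subcat
  proof
    assume iso: "is_iso (Fun_cat (opens_op X) (Mod_cat R)) (deg_psh R G i) (deg_psh R G (i + 1)) ?f"
    show ?bij using is_iso_Fun_catD[OF iso] iff by simp
  next
    assume ?bij
    then show "is_iso (Fun_cat (opens_op X) (Mod_cat R)) (deg_psh R G i) (deg_psh R G (i + 1)) ?f"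
      using iff
      by (intro is_iso_Fun_catI[OF category_Mod_cat functor_deg_psh functor_deg_psh f])
        (simp del: deg_simps(4))
  qed
qed

text \<open>A transition map is an isomorphism iff it is bijective over every open set, so both
  sides are compared one section module at a time. Only the index from which t is bijective has to
  be made uniform, as a maximum over the open sets.\<close>

theorem (in gr_presheaf) finite_type_deg_seq_iff:
  assumes sheaf: "is_sheaf X (grMod_cat R) gr_prod G"
    and nr: "noetherian_ring R" and fin: "finite (topspace X)"
  shows "finite_type X R (deg_seq X R G) \<longleftrightarrow> (\<forall>U. openin X U \<longrightarrow> fin_gen_module (UP R) (fobj G U))"
proof
  assume ft: "finite_type X R (deg_seq X R G)"
  then obtain m where fg: "\<And>i U. openin X U \<Longrightarrow> fin_gen_module R (deg_part R (fobj G U) i)"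
    and "\<forall>i \<ge> m. is_iso (Shv_Mod X R) (deg_psh R G i) (deg_psh R G (i + 1)) (fmap (deg_seq X R G) i (i + 1) ())"
    unfolding finite_type_def deg_simps(1,3) by blast
  then have bij: "bij_betw (\<lambda>x. monom (UP R) \<one>\<^bsub>R\<^esub> 1 \<odot>\<^bsub>fobj G U\<^esub> x)
      (grade (fobj G U) i) (grade (fobj G U) (Suc i))" if "i \<ge> m" "openin X U" for i U
    using that unfolding is_iso_deg_seq_iff[OF sheaf] by blast
  show "\<forall>U. openin X U \<longrightarrow> fin_gen_module (UP R) (fobj G U)"
  proof (intro allI impI)
    fix U assume U: "openin X U"
    show "fin_gen_module (UP R) (fobj G U)"
    proof (rule gr_module.fin_gen_if_deg_parts[OF gr_module_obj[OF U] fg[OF U]])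
      fix i y assume "m \<le> i" "y \<in> grade (fobj G U) (Suc i)"
      then have "y \<in> (\<lambda>x. monom (UP R) \<one>\<^bsub>R\<^esub> 1 \<odot>\<^bsub>fobj G U\<^esub> x) ` grade (fobj G U) i"
        using bij[of i U] U by (simp add: bij_betw_def)
      then show "\<exists>x \<in> grade (fobj G U) i. y = monom (UP R) \<one>\<^bsub>R\<^esub> 1 \<odot>\<^bsub>fobj G U\<^esub> x" by blast
    qed
  qed
next
  assume fg: "\<forall>U. openin X U \<longrightarrow> fin_gen_module (UP R) (fobj G U)"
  have "\<exists>m. \<forall>i \<ge> m. bij_betw (\<lambda>x. monom (UP R) \<one>\<^bsub>R\<^esub> 1 \<odot>\<^bsub>fobj G U\<^esub> x)
      (grade (fobj G U) i) (grade (fobj G U) (Suc i))" if "openin X U" for U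
    using gr_module.fin_gen_shift_bij[OF gr_module_obj nr] fg that by blast
  then obtain m where m: "\<And>U i. openin X U \<Longrightarrow> i \<ge> m U \<Longrightarrow>
      bij_betw (\<lambda>x. monom (UP R) \<one>\<^bsub>R\<^esub> 1 \<odot>\<^bsub>fobj G U\<^esub> x) (grade (fobj G U) i) (grade (fobj G U) (Suc i))"
    by metis
  have "{U. openin X U} \<subseteq> Pow (topspace X)" using openin_subset by auto
  then have opens: "finite {U. openin X U}" using fin finite_subset by blast
  have "is_iso (Shv_Mod X R) (deg_psh R G i) (deg_psh R G (i + 1)) (fmap (deg_seq X R G) i (i + 1) ())"
    if "i \<ge> Max (m ` {U. openin X U})" for i
    unfolding is_iso_deg_seq_iff[OF sheaf]
  proof (intro allI impI m)
    fix U assume "openin X U"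
    then have "m U \<le> Max (m ` {U. openin X U})" using opens by (intro Max_ge) auto
    then show "m U \<le> i" using that by simp
  qed
  moreover have "fin_gen_module R (deg_part R (fobj G U) i)" if "openin X U" for i U
    using gr_module.fin_gen_deg_part[OF gr_module_obj] fg that by blast
  ultimately show "finite_type X R (deg_seq X R G)"
    unfolding finite_type_def deg_simps(1,3) by blast
qed

text \<open>Finite generation passes along the isomorphisms over each open set, and the transition
  map of \<open>B\<close> is that of \<open>A\<close> conjugated by the components of
  \<eta>.\<close>

lemma finite_type_isomorphic:
  assumes A: "A \<in> Ob (Fun_cat nat_cat (Shv_Mod X R))" and B: "B \<in> Ob (Fun_cat nat_cat (Shv_Mod X R))"
    and AB: "isomorphic_in (Fun_cat nat_cat (Shv_Mod X R)) A B" and ft: "finite_type X R A"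
  shows "finite_type X R B"
proof -
  interpret Shv: category "Shv_Mod X R" by (rule category_Shv_Mod)
  obtain \<eta> where iso: "is_iso (Fun_cat nat_cat (Shv_Mod X R)) A B \<eta>"
    using AB by (auto simp: isomorphic_in_def)
  then have \<eta>: "\<eta> \<in> nat_trans nat_cat (Shv_Mod X R) A B" by (auto simp: is_iso_def)
  have isoi: "is_iso (Shv_Mod X R) (fobj A i) (fobj B i) (\<eta> i)" for i
    using is_iso_Fun_catD[OF iso, of i] by simp
  have Ai: "fobj A i \<in> Ob (Shv_Mod X R)" and Bi: "fobj B i \<in> Ob (Shv_Mod X R)" for i
    using A B is_functorD(1)[of nat_cat "Shv_Mod X R"] by simp_all
  have "fin_gen_module R (fobj (fobj B i) U)" if U: "openin X U" for i U
  proof -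
    have M: "Module.module R (fobj (fobj A i) U)" "Module.module R (fobj (fobj B i) U)"
      using Ai[of i] Bi[of i] U is_functorD(1)[of "opens_op X" "Mod_cat R" _ U] by auto
    have "is_iso (Mod_cat R) (fobj (fobj A i) U) (fobj (fobj B i) U) (\<eta> i U)"
      using is_iso_Fun_catD[of "opens_op X" "Mod_cat R" "fobj A i" "fobj B i" "\<eta> i" U] isoi[of i] U
      by (simp add: Shv_Mod_def)
    then show ?thesis
      using ft U unfolding is_iso_Mod_cat_iff[OF M] bij_betw_def finite_type_def
      by (intro fin_gen_module_surj[OF M, of "\<eta> i U"]) auto
  qed
  moreover obtain m where m: "\<And>i. i \<ge> m \<Longrightarrow>
      is_iso (Shv_Mod X R) (fobj A i) (fobj A (i + 1)) (fmap A i (i + 1) ())"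
    using ft unfolding finite_type_def by blast
  have "is_iso (Shv_Mod X R) (fobj B i) (fobj B (i + 1)) (fmap B i (i + 1) ())" if "i \<ge> m" for i
  proof -
    let ?a = "fmap A i (i + 1) ()" and ?b = "fmap B i (i + 1) ()"
    obtain \<theta> where \<theta>: "is_iso (Shv_Mod X R) (fobj B i) (fobj A i) \<theta>"
      and \<eta>\<theta>: "Cmp (Shv_Mod X R) (fobj B i) (fobj A i) (fobj B i) (\<eta> i) \<theta> = Idn (Shv_Mod X R) (fobj B i)"
      using Shv.is_iso_inverse[OF isoi] by blast
    have b: "?b \<in> Mor (Shv_Mod X R) (fobj B i) (fobj B (i + 1))"
      using is_functorD(2)[of nat_cat "Shv_Mod X R" B i "i + 1" "()"] B by simp
    have nat: "Cmp (Shv_Mod X R) (fobj A i) (fobj A (i + 1)) (fobj B (i + 1)) (\<eta> (i + 1)) ?a =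
        Cmp (Shv_Mod X R) (fobj A i) (fobj B i) (fobj B (i + 1)) ?b (\<eta> i)"
      using nat_transD(3)[OF \<eta>, of i "i + 1" "()"] by simp
    have "Cmp (Shv_Mod X R) (fobj B i) (fobj A i) (fobj B (i + 1))
        (Cmp (Shv_Mod X R) (fobj A i) (fobj A (i + 1)) (fobj B (i + 1)) (\<eta> (i + 1)) ?a) \<theta> = ?b"
      unfolding nat using \<eta>\<theta> \<theta> isoi[of i] by (intro Shv.Cmp_cancel_right Ai Bi b) (simp_all only: is_iso_def)
    then show ?thesis
      using Shv.is_iso_Cmp[OF Bi Ai Bi \<theta> Shv.is_iso_Cmp[OF Ai Ai Bi m[OF that] isoi]] by simp
  qed
  ultimately show ?thesis unfolding finite_type_def by blast
qed

text \<open>Both equivalences come from the functor \<open>deg_fctr X R\<close>. Infinitude of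
  \<open>'a\<close> lets direct sums be encoded in \<open>'a\<close>, which gives essential
  surjectivity.\<close>

theorem theorem3p6:
  fixes R :: "'r ring" and X :: "'x topology"
  assumes "cring R" and "infinite (UNIV :: 'a set)"
  shows "equivalent_cats
      (Fun_cat nat_cat (Shv_Mod X R :: (('x set, unit, ('r, 'a) module, 'a \<Rightarrow> 'a) fctr, _) cat))
      (Shv_grMod X R :: (('x set, unit, (nat \<Rightarrow> 'r, 'a) graded_module, 'a \<Rightarrow> 'a) fctr, _) cat)
    \<and> (noetherian_ring R \<and> finite (topspace X) \<longrightarrow> equivalent_cats
      (full_subcat
        (Fun_cat nat_cat (Shv_Mod X R :: (('x set, unit, ('r, 'a) module, 'a \<Rightarrow> 'a) fctr, _) cat))
        (finite_type X R))
      (Shv_grmod_fg X R :: (('x set, unit, (nat \<Rightarrow> 'r, 'a) graded_module, 'a \<Rightarrow> 'a) fctr, _) cat))"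
proof (intro conjI impI)
  let ?C = "Fun_cat nat_cat (Shv_Mod X R :: (('x set, unit, ('r, 'a) module, 'a \<Rightarrow> 'a) fctr, _) cat)"
  let ?D = "Shv_grMod X R :: (('x set, unit, (nat \<Rightarrow> 'r, 'a) graded_module, 'a \<Rightarrow> 'a) fctr, _) cat"
  have C: "category ?C" and D: "category ?D"
    by (simp_all add: category_Fun_cat category_Shv_Mod category_Shv_grMod)
  note P = functor_deg_fctr[OF assms(1)] and faithful = deg_fctr_faithful[OF assms(1)]
    and full = deg_fctr_full[OF assms(1)] and ess_surj = deg_fctr_ess_surj[OF assms]
  show "equivalent_cats ?C ?D"
    by (rule equivalent_catsI[OF C D P faithful full ess_surj])
  assume fin: "noetherian_ring R \<and> finite (topspace X)"
  show "equivalent_cats (full_subcat ?C (finite_type X R))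
      (Shv_grmod_fg X R :: (('x set, unit, (nat \<Rightarrow> 'r, 'a) graded_module, 'a \<Rightarrow> 'a) fctr, _) cat)"
    unfolding Shv_grmod_fg_def
  proof (rule equivalent_cats_full_subcatsI[OF C D P])
    fix G :: "('x set, unit, (nat \<Rightarrow> 'r, 'a) graded_module, 'a \<Rightarrow> 'a) fctr"
    assume G: "G \<in> Ob ?D"
    interpret gr_presheaf X R G using assms(1) G by (rule Shv_grMod_presheaf)
    show "finite_type X R (fobj (deg_fctr X R) G) \<longleftrightarrow> (\<forall>U. openin X U \<longrightarrow> fin_gen_module (UP R) (fobj G U))"
      using finite_type_deg_seq_iff fin G by simp
  qed (erule (4) faithful, erule (2) full, erule ess_surj, erule (3) finite_type_isomorphic)
qed

end
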